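(* Let $n$ and $N$ be positive integers. The following four cubature formulas (the first two for polynomials $f$ of degree at most $2N-1$, the last two for polynomials $f$ of degree at most $2(N-n)+1$) are optimal Gaussian cubature formulas: $$\int_{\mathfrak{F}}f(Y)\,\omega^{I,+}(Y)\,dY=\left(\frac{1}{N}\right)^n\sum_{Y\in \mathfrak{F}_N^{\mathrm{II},+}}\mathcal{H}_Y^{-1}f(Y),$$ $$\int_{\mathfrak{F}}f(Y)\,\omega^{III,+}(Y)\,dY=\left(\frac{2}{2N+1}\right)^n\sum_{Y\in \mathfrak{F}_N^{\mathrm{VIII},+}}\mathcal{H}_Y^{-1}f(Y)\,\mathcal{J}^{III,+}(Y),$$ $$\int_{\mathfrak{F}}f(Y)\,\omega^{I,-}(Y)\,dY=\left(\frac{1}{N}\right)^n\sum_{Y\in \mathfrak{F}_N^{\mathrm{II},-}}f(Y)\,\mathcal{J}^{I,-}(Y),$$ $$\int_{\mathfrak{F}}f(Y)\,\omega^{III,-}(Y)\,dY=\left(\frac{2}{2N+1}\right)^n\sum_{Y\in \mathfrak{F}_N^{\mathrm{VIII},-}}f(Y)\,\mathcal{J}^{III,-}(Y).$$ Moreover, for $k\in P^+$: - the polynomials $\mathcal{P}^{I,+}_k$ with $k_1=N$ vanish at all points of $\mathfrak{F}_N^{\mathrm{II},+}$; - the polynomials $\mathcal{P}^{III,+}_k$ with $k_1=N$ vanish at all points of $\mathfrak{F}_N^{\mathrm{VIII},+}$; - the polynomials $\mathcal{P}^{I,-}_k$ with $k_1=N-n+1$ vanish at all points of $\mathfrak{F}_N^{\mathrm{II},-}$;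 - the polynomials $\mathcal{P}^{III,-}_k$ with $k_1=N-n+1$ vanish at all points of $\mathfrak{F}_N^{\mathrm{VIII},-}$.
   Context: A cubature formula that is exact for all polynomials in $n$ variables of degree at most $2d-1$ needs at least as many nodes as the dimension of the space of polynomials in $n$ variables of degree at most $d-1$; it is called (optimal) Gaussian if its number of nodes equals this dimension (for $d\le 0$ the space is taken to be $\{0\}$). For $\lambda,x\in\mathbb{R}^n$: $\cos^-_\lambda(x)=\sum_{\sigma\in S_n}\mathrm{sgn}(\sigma)\prod_{i=1}^n\cos(\pi\lambda_{\sigma(i)}x_i)$ and $\cos^+_\lambda(x)=\sum_{\sigma\in S_n}\prod_{i=1}^n\cos(\pi\lambda_{\sigma(i)}x_i)$. Put $P^+=\{(k_1,\dots,k_n)\in\mathbb{Z}^n : k_1\ge\dots\ge k_n\ge0\}$, $\rho=(\frac12,\dots,\frac12)$, $\rho_1=(n-1,n-2,\dots,0)$, $\rho_2=(n-\frac12,n-\frac32,\dots,\frac12)$. $F=\{x\in\mathbb{R}^n : 1\ge x_1\ge x_2\ge\dots\ge x_n\ge0\}$ with interior $F^\circ$. Let $X_j(x)=\cos^+_{(1,\dots,1,0,\dots,0)}(x)$ with $j$ ones and $n-j$ zeros, $j=1,\dots,n$; let $\varphi(x)=(X_1(x),\dots,X_n(x))$ for $x\in F$ and $\mathfrak{F}=\varphi(F)$. The map $\varphi$ is injective on $F$. For $k\in P^+$ the polynomials $\mathcal{P}^{I,\pm}_k,\mathcal{P}^{III,\pm}_k$ in $n$ real variables are determined by the relations, for all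 $x\in F^\circ$: $$\mathcal{P}^{I,+}_k(\varphi(x))=\cos^+_k(x),\quad \mathcal{P}^{I,-}_k(\varphi(x))=\frac{\cos^-_{k+\rho_1}(x)}{\cos^-_{\rho_1}(x)},\quad \mathcal{P}^{III,+}_k(\varphi(x))=\frac{\cos^+_{k+\rho}(x)}{\cos^+_{\rho}(x)},\quad \mathcal{P}^{III,-}_k(\varphi(x))=\frac{\cos^-_{k+\rho_2}(x)}{\cos^-_{\rho_2}(x)}.$$ Let $J(x)=\det\frac{\partial(X_1,\dots,X_n)}{\partial(x_1,\dots,x_n)}$. Then $J(x)^2=p^{I,+}(\varphi(x))$ for a polynomial $p^{I,+}$, and $\mathcal{J}(Y)=\sqrt{p^{I,+}(Y)}$ for $Y\in\mathfrak{F}$, so $\mathcal{J}(\varphi(x))=|J(x)|$ for $x\in F$. The polynomials $\mathcal{J}^{I,-},\mathcal{J}^{III,+},\mathcal{J}^{III,-}$ are determined by $\mathcal{J}^{I,-}(\varphi(x))=\cos^-_{\rho_1}(x)^2$, $\mathcal{J}^{III,+}(\varphi(x))=\cos^+_{\rho}(x)^2$, $\mathcal{J}^{III,-}(\varphi(x))=\cos^-_{\rho_2}(x)^2$. The weight functions are $\omega^{I,+}=1/\mathcal{J}$, $\omega^{I,-}=\mathcal{J}^{I,-}/\mathcal{J}$, $\omega^{III,+}=\mathcal{J}^{III,+}/\mathcal{J}$, $\omega^{III,-}=\mathcal{J}^{III,-}/\mathcal{J}$. Let $D_N^+=\{r\in\mathbb{Z}^n : N-1\ge r_1\ge\dots\ge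 r_n\ge0\}$ and $D_N^-=\{r\in\mathbb{Z}^n : N-1\ge r_1>\dots>r_n\ge0\}$. Grids: $F_N^{\mathrm{II},\pm}=\left\{\left(\frac{r_1+\frac12}{N},\dots,\frac{r_n+\frac12}{N}\right): r\in D_N^\pm\right\}$, $F_N^{\mathrm{VIII},\pm}=\left\{\left(\frac{2(r_1+\frac12)}{2N+1},\dots,\frac{2(r_n+\frac12)}{2N+1}\right): r\in D_N^\pm\right\}$, and $\mathfrak{F}_N^{t,\pm}=\varphi(F_N^{t,\pm})$ for $t\in\{\mathrm{II},\mathrm{VIII}\}$. For $Y=\varphi(s)$ with $s$ in one of these grids, $\mathcal{H}_Y=H_s=\#\{\sigma\in S_n : (s_{\sigma(1)},\dots,s_{\sigma(n)})=s\}$. *)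

theory Defs
  imports "HOL-Analysis.Analysis" "HOL-Library.Poly_Mapping"
begin

section \<open>Polynomials in \<open>n\<close> variables and cubature formulas\<close>

text \<open>
  The \<open>n\<close> coordinates are indexed by a finite well-ordered type \<open>'n\<close> with \<open>CARD('n) = n\<close>; its order
  is the order of the positions \<open>1, \<dots>, n\<close>. A polynomial assigns a coefficient to each exponent vector.
\<close>

type_synonym 'n mpoly = "('n \<Rightarrow>\<^sub>0 nat) \<Rightarrow>\<^sub>0 real"

definition mpoly_eval :: "'n::finite mpoly \<Rightarrow> real^'n \<Rightarrow> real" where
  "mpoly_eval p Y =
     (\<Sum>m\<in>Poly_Mapping.keys p. Poly_Mapping.lookup p m * (\<Prod>i\<in>UNIV. (Y $ i) ^ Poly_Mapping.lookup m i))"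

text \<open>The degree bound is an integer; for a negative bound only the zero polynomial remains.\<close>

definition mpolys_le :: "int \<Rightarrow> 'n::finite mpoly set" where
  "mpolys_le d = {p. \<forall>m\<in>Poly_Mapping.keys p. int (\<Sum>i\<in>UNIV. Poly_Mapping.lookup m i) \<le> d}"

definition mpoly_scale :: "real \<Rightarrow> 'n mpoly \<Rightarrow> 'n mpoly" where
  "mpoly_scale c p = Poly_Mapping.map ((*) c) p"

interpretation mpoly: vector_space "mpoly_scale :: real \<Rightarrow> 'n mpoly \<Rightarrow> 'n mpoly"
proof
  fix a b :: real and p q :: "'n mpoly"
  show "mpoly_scale a (p + q) = mpoly_scale a p + mpoly_scale a q"
    by (simp add: mpoly_scale_def mult_map_scale_conv_mult distrib_left)
  show "mpoly_scale (a + b) p = mpoly_scale a p + mpoly_scale b p"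
    by (simp add: mpoly_scale_def mult_map_scale_conv_mult single_add distrib_right)
  show "mpoly_scale a (mpoly_scale b p) = mpoly_scale (a * b) p"
    by (simp add: mpoly_scale_def mult_map_scale_conv_mult mult_single flip: mult.assoc)
  show "mpoly_scale 1 p = p"
    by (simp add: mpoly_scale_def mult_map_scale_conv_mult)
qed

text \<open>
  The cubature formula with domain \<open>\<Omega>\<close>, weight function \<open>\<omega>\<close>, nodes \<open>X\<close> and node weights \<open>w\<close> is exact
  up to degree \<open>D\<close> (existence of the integrals included).
\<close>

definition cubature_exact ::
  "(real^'n) set \<Rightarrow> (real^'n \<Rightarrow> real) \<Rightarrow> (real^'n) set \<Rightarrow> (real^'n \<Rightarrow> real) \<Rightarrow> int \<Rightarrow> bool" where
  "cubature_exact \<Omega> \<omega> X w D \<longleftrightarrow> finite X \<and>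
     (\<forall>f\<in>mpolys_le D.
        set_integrable lebesgue \<Omega> (\<lambda>Y. mpoly_eval f Y * \<omega> Y) \<and>
        (LINT Y:\<Omega>|lebesgue. mpoly_eval f Y * \<omega> Y) = (\<Sum>Y\<in>X. w Y * mpoly_eval f Y))"

definition optimal_gaussian_cubature ::
  "(real^'n) set \<Rightarrow> (real^'n \<Rightarrow> real) \<Rightarrow> (real^'n) set \<Rightarrow> (real^'n \<Rightarrow> real) \<Rightarrow> int \<Rightarrow> bool" where
  "optimal_gaussian_cubature \<Omega> \<omega> X w d \<longleftrightarrow>
     cubature_exact \<Omega> \<omega> X w (2 * d - 1) \<and>
     card X = mpoly.dim (mpolys_le (d - 1) :: 'n mpoly set)"


section \<open>Antisymmetric and symmetric cosine functions\<close>

definition cos_minus :: "real^'n \<Rightarrow> real^'n \<Rightarrow> real" where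
  "cos_minus l x =
     (\<Sum>\<sigma> | \<sigma> permutes UNIV. of_int (sign \<sigma>) * (\<Prod>i\<in>UNIV. cos (pi * l $ \<sigma> i * x $ i)))"

definition cos_plus :: "real^'n \<Rightarrow> real^'n \<Rightarrow> real" where
  "cos_plus l x = (\<Sum>\<sigma> | \<sigma> permutes UNIV. \<Prod>i\<in>UNIV. cos (pi * l $ \<sigma> i * x $ i))"

definition real_vec :: "int^'n \<Rightarrow> real^'n" where
  "real_vec k = (\<chi> i. real_of_int (k $ i))"

definition P_plus :: "(int^'n::{finite,wellorder}) set" where
  "P_plus = {k. (\<forall>i j. i \<le> j \<longrightarrow> k $ i \<ge> k $ j) \<and> (\<forall>i. k $ i \<ge> 0)}"

text \<open>The first component of a vector.\<close>

definition vec_first :: "'a^'n::{finite,wellorder} \<Rightarrow> 'a" where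
  "vec_first k = k $ Min UNIV"

text \<open>At position \<open>i\<close> the number of later positions is \<open>n - i\<close>.\<close>

definition rho :: "real^'n" where
  "rho = (\<chi> i. 1/2)"

definition rho1 :: "real^'n::{finite,wellorder}" where
  "rho1 = (\<chi> i. real (card {j. i < j}))"

definition rho2 :: "real^'n::{finite,wellorder}" where
  "rho2 = (\<chi> i. real (card {j. i < j}) + 1/2)"

definition F_dom :: "(real^'n::{finite,wellorder}) set" where
  "F_dom = {x. (\<forall>i. 0 \<le> x $ i \<and> x $ i \<le> 1) \<and> (\<forall>i j. i \<le> j \<longrightarrow> x $ i \<ge> x $ j)}"

text \<open>For \<open>j\<close> the \<open>m\<close>-th position, the parameter below consists of \<open>m\<close> ones followed by zeros.\<close>

definition X_fun :: "'n::{finite,wellorder} \<Rightarrow> real^'n::_ \<Rightarrow> real" where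
  "X_fun j x = cos_plus (\<chi> i. if i \<le> j then 1 else 0) x"

definition phi :: "real^'n::{finite,wellorder} \<Rightarrow> real^'n::_" where
  "phi x = (\<chi> j. X_fun j x)"

definition frakF :: "(real^'n::{finite,wellorder}) set" where
  "frakF = phi ` F_dom"


section \<open>The polynomials and weight functions\<close>

text \<open>
  The relations below have exactly one polynomial solution: \<open>phi\<close> maps the nonempty open set
  \<open>interior F_dom\<close> onto a set with nonempty interior.
\<close>

definition P_I_plus :: "int^'n::{finite,wellorder} \<Rightarrow> 'n mpoly" where
  "P_I_plus k = (THE p. \<forall>x\<in>interior F_dom. mpoly_eval p (phi x) = cos_plus (real_vec k) x)"

definition P_I_minus :: "int^'n::{finite,wellorder} \<Rightarrow> 'n mpoly" where
  "P_I_minus k = (THE p. \<forall>x\<in>interior F_dom.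
     mpoly_eval p (phi x) = cos_minus (real_vec k + rho1) x / cos_minus rho1 x)"

definition P_III_plus :: "int^'n::{finite,wellorder} \<Rightarrow> 'n mpoly" where
  "P_III_plus k = (THE p. \<forall>x\<in>interior F_dom.
     mpoly_eval p (phi x) = cos_plus (real_vec k + rho) x / cos_plus rho x)"

definition P_III_minus :: "int^'n::{finite,wellorder} \<Rightarrow> 'n mpoly" where
  "P_III_minus k = (THE p. \<forall>x\<in>interior F_dom.
     mpoly_eval p (phi x) = cos_minus (real_vec k + rho2) x / cos_minus rho2 x)"

definition jac_det :: "real^'n::{finite,wellorder} \<Rightarrow> real" where
  "jac_det x = det (jacobian phi (at x))"

definition p_I_plus :: "'n::{finite,wellorder} mpoly" where
  "p_I_plus = (THE p. \<forall>x\<in>F_dom. mpoly_eval p (phi x) = (jac_det x)\<^sup>2)"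

definition calJ :: "real^'n::{finite,wellorder} \<Rightarrow> real" where
  "calJ Y = sqrt (mpoly_eval p_I_plus Y)"

definition J_I_minus :: "'n::{finite,wellorder} mpoly" where
  "J_I_minus = (THE p. \<forall>x\<in>F_dom. mpoly_eval p (phi x) = (cos_minus rho1 x)\<^sup>2)"

definition J_III_plus :: "'n::{finite,wellorder} mpoly" where
  "J_III_plus = (THE p. \<forall>x\<in>F_dom. mpoly_eval p (phi x) = (cos_plus rho x)\<^sup>2)"

definition J_III_minus :: "'n::{finite,wellorder} mpoly" where
  "J_III_minus = (THE p. \<forall>x\<in>F_dom. mpoly_eval p (phi x) = (cos_minus rho2 x)\<^sup>2)"

text \<open>
  \<open>calJ\<close> vanishes on the image of the boundary of \<open>F_dom\<close>, a null set; there the quotients take the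
  value \<open>0\<close>, which does not affect the integrals.
\<close>

definition omega_I_plus :: "real^'n::{finite,wellorder} \<Rightarrow> real" where
  "omega_I_plus Y = 1 / calJ Y"

definition omega_I_minus :: "real^'n::{finite,wellorder} \<Rightarrow> real" where
  "omega_I_minus Y = mpoly_eval J_I_minus Y / calJ Y"

definition omega_III_plus :: "real^'n::{finite,wellorder} \<Rightarrow> real" where
  "omega_III_plus Y = mpoly_eval J_III_plus Y / calJ Y"

definition omega_III_minus :: "real^'n::{finite,wellorder} \<Rightarrow> real" where
  "omega_III_minus Y = mpoly_eval J_III_minus Y / calJ Y"


section \<open>Grids\<close>

definition D_plus :: "nat \<Rightarrow> (int^'n::{finite,wellorder}) set" where
  "D_plus N = {r. (\<forall>i. 0 \<le> r $ i \<and> r $ i \<le> int N - 1) \<and> (\<forall>i j. i < j \<longrightarrow> r $ i \<ge> r $ j)}"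

definition D_minus :: "nat \<Rightarrow> (int^'n::{finite,wellorder}) set" where
  "D_minus N = {r. (\<forall>i. 0 \<le> r $ i \<and> r $ i \<le> int N - 1) \<and> (\<forall>i j. i < j \<longrightarrow> r $ i > r $ j)}"

definition node_II :: "nat \<Rightarrow> int^'n \<Rightarrow> real^'n" where
  "node_II N r = (\<chi> i. (real_of_int (r $ i) + 1/2) / real N)"

definition node_VIII :: "nat \<Rightarrow> int^'n \<Rightarrow> real^'n" where
  "node_VIII N r = (\<chi> i. 2 * (real_of_int (r $ i) + 1/2) / (2 * real N + 1))"

definition frakF_II_plus :: "nat \<Rightarrow> (real^'n::{finite,wellorder}) set" where
  "frakF_II_plus N = phi ` node_II N ` D_plus N"

definition frakF_II_minus :: "nat \<Rightarrow> (real^'n::{finite,wellorder}) set" where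
  "frakF_II_minus N = phi ` node_II N ` D_minus N"

definition frakF_VIII_plus :: "nat \<Rightarrow> (real^'n::{finite,wellorder}) set" where
  "frakF_VIII_plus N = phi ` node_VIII N ` D_plus N"

definition frakF_VIII_minus :: "nat \<Rightarrow> (real^'n::{finite,wellorder}) set" where
  "frakF_VIII_minus N = phi ` node_VIII N ` D_minus N"

definition stab_card :: "real^'n \<Rightarrow> nat" where
  "stab_card s = card {\<sigma>. \<sigma> permutes UNIV \<and> (\<chi> i. s $ \<sigma> i) = s}"

text \<open>The grids lie in \<open>F_dom\<close>, on which \<open>phi\<close> is injective.\<close>

definition calH :: "real^'n::{finite,wellorder} \<Rightarrow> nat" where
  "calH Y = stab_card (inv_into F_dom phi Y)"

end

theory Submission
  imports Defs
begin

text \<open>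
  Put \<open>y\<^sub>i = cos (\<pi> x\<^sub>i)\<close>. Up to positive constants the components of \<open>phi x\<close> are the elementary
  symmetric polynomials in \<open>y\<close>, so a polynomial \<open>f\<close> of degree at most \<open>D\<close> becomes a symmetric
  polynomial \<open>f (phi x)\<close> in \<open>y\<close> whose degree in each single \<open>y\<^sub>i\<close> is at most \<open>D\<close>. The substitution
  \<open>Y = phi x\<close> cancels \<open>calJ\<close> against the Jacobian determinant, and the integral over \<open>frakF\<close> turns
  into the integral over \<open>F_dom\<close> of \<open>f (phi x)\<close> times \<open>1\<close>, a squared alternant in \<open>y\<close>, the product
  of the \<open>(1 + y\<^sub>i) / 2\<close>, or both, up to constants (\<open>integral_frakF\<close>). All of these are symmetric in \<open>x\<close>, so the
  integral is \<open>1 / n!\<close> times the integral over the unit cube (\<open>integral_unit_cube_symmetric\<close>). There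
  the integrand is a sum of products of univariate polynomials in the \<open>y\<^sub>i\<close>, and Fubini's theorem leaves
  one-dimensional integrals, for which the Chebyshev quadrature rules are exact
  (\<open>quadrature_midpoints\<close>, \<open>quadrature_third_kind\<close>): the weight factors account exactly for the
  difference between the stated degree and the degree of the quadrature rule. Folding the cubic grid back
  to its sorted points (\<open>sum_symmetric_eq_sum_sorted\<close>) produces the stabilizer orders, and an alternant
  kills the points with a repeated coordinate.

  The number of nodes is the number of nonincreasing integer sequences in a range. Taking differences
  identifies them with exponent vectors of bounded total degree, that is, with a basis of the polynomial
  space (\<open>bij_betw_tail_sums\<close>); strictly decreasing sequences are first straightened by subtracting
  the staircase.

  The polynomials in the statement are defined by their values on \<open>phi x\<close>, so their existence and
  uniqueness have to be shown. Uniqueness holds because \<open>phi\<close> is injective on \<open>F_dom\<close> and hence has an open image of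
  the interior (\<open>the_mpoly_eval\<close>). Existence rests on one device: reducing modulo the polynomial
  \<open>(t - y\<^sub>1) \<dots> (t - y\<^sub>n)\<close>, whose coefficients are elementary symmetric, every power of a coordinate
  is a combination of the powers below \<open>n\<close> with the same symmetric coefficients for all coordinates. Hence
  every alternant is a symmetric polynomial times a fixed basis alternant (\<open>alternant_factorization\<close>),
  which is the quotient formula for the antisymmetric families, and multiplying a symmetric polynomial
  with the Vandermonde determinant gives a sum of alternants, which proves the fundamental theorem of
  symmetric polynomials (\<open>symmetric_imp_sym_polys\<close>).

  The zeros come from the factor \<open>cos (\<pi> (r + 1/2))\<close> that the first component of \<open>k\<close> contributes to each
  product at a node.
\<close>

section \<open>Positions, sorting and symmetrization\<close>

text \<open>The staircase \<open>n - 1, \<dots>, 0\<close>: the exponents of the Vandermonde determinant in the order of the positions.\<close>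

definition delta :: "'n::{finite,wellorder} \<Rightarrow> nat" where
  "delta j = card {i. j < i}"

lemma delta_strict_antimono: "i < j \<Longrightarrow> delta j < delta i"
  unfolding delta_def by (rule psubset_card_mono) auto

lemma inj_delta: "inj delta"
  by (rule linorder_injI) (metis delta_strict_antimono nat_less_le)

lemma delta_less_CARD: "delta (j::'n::{finite,wellorder}) < CARD('n)"
  unfolding delta_def by (rule psubset_card_mono) auto

lemma range_delta: "range (delta :: 'n::{finite,wellorder} \<Rightarrow> nat) = {..<CARD('n)}"
  by (rule card_subset_eq) (auto simp: delta_less_CARD card_image[OF inj_delta])

lemma card_atMost_eq: "card {..j} = CARD('n) - delta (j::'n::{finite,wellorder})"
proof -
  have "{..j} = UNIV - {i. j < i}" by auto
  then show ?thesis unfolding delta_def by (simp add: card_Diff_subset)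
qed

text \<open>The upper level sets of a nonincreasing family are initial segments of the index type, and an initial
  segment is determined by its size.\<close>

lemma antimono_eqI_card:
  fixes a b :: "'n::{finite,wellorder} \<Rightarrow> 'a::linorder"
  assumes "antimono a" "antimono b" and card: "\<And>c. card {i. c \<le> a i} = card {i. c \<le> b i}"
  shows "a = b"
proof -
  have "{i. c \<le> a i} = {i. c \<le> b i}" for c
  proof -
    have "{i. c \<le> a i} \<subseteq> {i. c \<le> b i} \<or> {i. c \<le> b i} \<subseteq> {i. c \<le> a i}"
      using assms(1,2) unfolding antimono_def by (smt (verit) Collect_mono linear order_trans)
    then show ?thesis using card[of c] card_subset_eq finite by metis
  qed
  then have "c \<le> a i \<longleftrightarrow> c \<le> b i" for c i by blast
  then show ?thesis by (intro ext antisym) (blast intro: order_refl)+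
qed

lemma card_Collect_permutes:
  assumes "\<sigma> permutes UNIV"
  shows "card {i. P (\<sigma> i)} = card {i. P i}"
proof -
  have "{i. P i} = \<sigma> ` {i. P (\<sigma> i)}"
    using permutes_surj[OF assms] by (auto simp: surj_def image_iff)
  then show ?thesis by (simp add: card_image inj_on_subset[OF permutes_inj[OF assms]])
qed

lemma antimono_rearrangement_eq:
  fixes a :: "'n::{finite,wellorder} \<Rightarrow> 'a::linorder"
  assumes "antimono a" "antimono (a \<circ> \<sigma>)" "\<sigma> permutes UNIV"
  shows "a \<circ> \<sigma> = a"
  using assms(2,1)
proof (rule antimono_eqI_card)
  show "card {i. c \<le> (a \<circ> \<sigma>) i} = card {i. c \<le> a i}" for c
    using card_Collect_permutes[OF assms(3), of "\<lambda>j. c \<le> a j"] by simp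
qed

text \<open>Among all rearrangements one maximizes the pairing with the strictly decreasing sequence
  \<open>delta\<close>; exchanging two entries in the wrong order would increase that pairing. Ranks stand in
  for the values, so that the pairing makes sense in any linear order.\<close>

lemma sorting_permutation_exists:
  fixes a :: "'n::{finite,wellorder} \<Rightarrow> 'a::linorder"
  obtains \<sigma> where "\<sigma> permutes UNIV" "antimono (a \<circ> \<sigma>)"
proof -
  define r where "r i = int (card {j. a j < a i})" for i
  have r: "r i < r j" if "a i < a j" for i j
    unfolding r_def using that by (auto intro!: psubset_card_mono)
  define f where "f \<sigma> = (\<Sum>i\<in>UNIV. int (delta i) * r (\<sigma> i))" for \<sigma> :: "'n \<Rightarrow> 'n"
  define S where "S = {\<sigma>::'n \<Rightarrow> 'n. \<sigma> permutes UNIV}"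
  have S: "finite S" "S \<noteq> {}" unfolding S_def using permutes_id[of UNIV] by (auto simp del: permutes_id)
  then have "Max (f ` S) \<in> f ` S" by simp
  then obtain \<sigma> where \<sigma>: "\<sigma> \<in> S" "f \<sigma> = Max (f ` S)" by auto
  have max: "f \<tau> \<le> f \<sigma>" if "\<tau> \<in> S" for \<tau>
    using S \<sigma> that by simp
  have "a (\<sigma> j) \<le> a (\<sigma> i)" if "i < j" for i j
  proof (rule ccontr)
    assume "\<not> ?thesis"
    then have lt: "r (\<sigma> i) < r (\<sigma> j)" by (intro r) auto
    define \<tau> where "\<tau> = \<sigma> \<circ> Transposition.transpose i j"
    have \<tau>: "\<tau> \<in> S" unfolding \<tau>_def S_def
      using \<sigma> permutes_compose permutes_swap_id[of i UNIV j] unfolding S_def by blast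
    have split: "f \<upsilon> = int (delta i) * r (\<upsilon> i) + (int (delta j) * r (\<upsilon> j)
        + (\<Sum>k\<in>UNIV-{i}-{j}. int (delta k) * r (\<upsilon> k)))" for \<upsilon>
      unfolding f_def using that
      by (subst sum.remove[of _ i], simp, simp, subst sum.remove[of _ j]) auto
    have "(\<Sum>k\<in>UNIV-{i}-{j}. int (delta k) * r (\<tau> k)) = (\<Sum>k\<in>UNIV-{i}-{j}. int (delta k) * r (\<sigma> k))"
      by (rule sum.cong) (auto simp: \<tau>_def Transposition.transpose_def)
    moreover have "\<tau> i = \<sigma> j" "\<tau> j = \<sigma> i" by (simp_all add: \<tau>_def)
    ultimately have "f \<tau> - f \<sigma> = (int (delta i) - int (delta j)) * (r (\<sigma> j) - r (\<sigma> i))"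
      unfolding split by (simp add: algebra_simps)
    also have "\<dots> > 0" using lt delta_strict_antimono[OF that] by (intro mult_pos_pos) auto
    finally show False using max[OF \<tau>] by simp
  qed
  then have "antimono (a \<circ> \<sigma>)" by (intro antimonoI) (metis comp_apply order_le_less order_refl)
  then show ?thesis using \<sigma> that unfolding S_def by auto
qed

lemma card_sorting_permutations:
  fixes a :: "'n::{finite,wellorder} \<Rightarrow> 'a::linorder"
  shows "card {\<sigma>. \<sigma> permutes UNIV \<and> antimono (a \<circ> \<sigma>)} = card {\<sigma>. \<sigma> permutes UNIV \<and> a \<circ> \<sigma> = a}"
proof -
  obtain \<tau> where \<tau>: "\<tau> permutes UNIV" "antimono (a \<circ> \<tau>)" by (rule sorting_permutation_exists)
  have eq: "a \<circ> \<sigma> = a \<circ> \<tau>" if "\<sigma> permutes UNIV" "antimono (a \<circ> \<sigma>)" for \<sigma>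
  proof -
    have "a \<circ> \<sigma> = (a \<circ> \<tau>) \<circ> (inv \<tau> \<circ> \<sigma>)"
      using permutes_inv_o(1)[OF \<tau>(1)] by (simp add: fun_eq_iff permutes_inverses[OF \<tau>(1)])
    then show ?thesis
      using antimono_rearrangement_eq[OF \<tau>(2)] that permutes_compose[OF that(1) permutes_inv[OF \<tau>(1)]]
      by metis
  qed
  have "bij_betw (\<lambda>\<sigma>. \<sigma> \<circ> inv \<tau>) {\<sigma>. \<sigma> permutes UNIV \<and> antimono (a \<circ> \<sigma>)}
    {\<sigma>. \<sigma> permutes UNIV \<and> a \<circ> \<sigma> = a}"
  proof (rule bij_betw_byWitness[where f' = "\<lambda>\<sigma>. \<sigma> \<circ> \<tau>"])
    show "\<forall>\<sigma>\<in>{\<sigma>. \<sigma> permutes UNIV \<and> antimono (a \<circ> \<sigma>)}. \<sigma> \<circ> inv \<tau> \<circ> \<tau> = \<sigma>"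
      "\<forall>\<sigma>\<in>{\<sigma>. \<sigma> permutes UNIV \<and> a \<circ> \<sigma> = a}. \<sigma> \<circ> \<tau> \<circ> inv \<tau> = \<sigma>"
      by (auto simp: fun_eq_iff permutes_inverses[OF \<tau>(1)])
    show "(\<lambda>\<sigma>. \<sigma> \<circ> inv \<tau>) ` {\<sigma>. \<sigma> permutes UNIV \<and> antimono (a \<circ> \<sigma>)}
      \<subseteq> {\<sigma>. \<sigma> permutes UNIV \<and> a \<circ> \<sigma> = a}"
    proof safe
      fix \<sigma> assume "\<sigma> permutes (UNIV::'n set)" "antimono (a \<circ> \<sigma>)"
      note this eq[OF this]
      then show "\<sigma> \<circ> inv \<tau> permutes UNIV" "a \<circ> (\<sigma> \<circ> inv \<tau>) = a"
        using \<tau>(1) permutes_compose permutes_inv apply blast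
        by (metis \<open>a \<circ> \<sigma> = a \<circ> \<tau>\<close> comp_assoc comp_id permutes_inv_o(1)[OF \<tau>(1)])
    qed
    show "(\<lambda>\<sigma>. \<sigma> \<circ> \<tau>) ` {\<sigma>. \<sigma> permutes UNIV \<and> a \<circ> \<sigma> = a}
      \<subseteq> {\<sigma>. \<sigma> permutes UNIV \<and> antimono (a \<circ> \<sigma>)}"
      using \<tau> by (auto simp: permutes_compose fun.map_comp[symmetric] o_assoc)
  qed
  then show ?thesis by (rule bij_betw_same_card)
qed

definition permute_vec :: "('n \<Rightarrow> 'n) \<Rightarrow> 'a^'n \<Rightarrow> 'a^'n" where
  "permute_vec \<sigma> x = (\<chi> i. x $ \<sigma> i)"

definition sorted_vecs :: "('a::linorder^'n::{finite,wellorder}) set" where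
  "sorted_vecs = {x. antimono (($) x)}"

definition vec_stab :: "'a^'n \<Rightarrow> nat" where
  "vec_stab x = card {\<sigma>. \<sigma> permutes UNIV \<and> permute_vec \<sigma> x = x}"

lemma permute_vec_compose: "permute_vec \<sigma> (permute_vec \<tau> x) = permute_vec (\<tau> \<circ> \<sigma>) x"
  by (simp add: permute_vec_def)

lemma permute_vec_id [simp]: "permute_vec id x = x"
  by (simp add: permute_vec_def)

lemma permute_vec_inv:
  assumes "\<sigma> permutes UNIV"
  shows "permute_vec \<sigma> (permute_vec (inv \<sigma>) x) = x" "permute_vec (inv \<sigma>) (permute_vec \<sigma> x) = x"
  by (simp_all add: permute_vec_compose permutes_inv_o[OF assms])

text \<open>All sorted rearrangements of \<open>x\<close> coincide, so the permutations that sort \<open>x\<close> form a coset of its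
  stabilizer.\<close>

lemma sum_indicator_sorted_vecs:
  "(\<Sum>\<sigma> | \<sigma> permutes UNIV. indicator sorted_vecs (permute_vec \<sigma> x)) = (real (vec_stab x))"
proof -
  have 1: "permute_vec \<sigma> x \<in> sorted_vecs \<longleftrightarrow> antimono ((($) x) \<circ> \<sigma>)" for \<sigma>
    by (simp add: sorted_vecs_def permute_vec_def comp_def antimono_def)
  have 2: "permute_vec \<sigma> x = x \<longleftrightarrow> (($) x) \<circ> \<sigma> = ($) x" for \<sigma>
    by (simp add: permute_vec_def vec_eq_iff fun_eq_iff)
  have "(\<Sum>\<sigma> | \<sigma> permutes UNIV. indicator sorted_vecs (permute_vec \<sigma> x))
     = real (card {\<sigma>. \<sigma> permutes UNIV \<and> permute_vec \<sigma> x \<in> sorted_vecs})"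
    by (simp add: indicator_def sum.If_cases Int_def)
  then show ?thesis by (simp add: 1 2 vec_stab_def card_sorting_permutations)
qed

lemma vec_stab_pos: "vec_stab x > 0"
  unfolding vec_stab_def by (subst card_gt_0_iff) (auto intro!: exI[of _ id] permutes_id)

lemma vec_stab_permute:
  assumes "\<tau> permutes UNIV"
  shows "vec_stab (permute_vec \<tau> x) = vec_stab x"
proof -
  have "bij_betw (\<lambda>\<sigma>. \<tau> \<circ> \<sigma> \<circ> inv \<tau>) {\<sigma>. \<sigma> permutes UNIV \<and> permute_vec \<sigma> (permute_vec \<tau> x) = permute_vec \<tau> x}
     {\<sigma>. \<sigma> permutes UNIV \<and> permute_vec \<sigma> x = x}"
  proof (rule bij_betw_byWitness[where f' = "\<lambda>\<sigma>. inv \<tau> \<circ> \<sigma> \<circ> \<tau>"])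
    show "(\<lambda>\<sigma>. \<tau> \<circ> \<sigma> \<circ> inv \<tau>) ` {\<sigma>. \<sigma> permutes UNIV \<and> permute_vec \<sigma> (permute_vec \<tau> x) = permute_vec \<tau> x}
       \<subseteq> {\<sigma>. \<sigma> permutes UNIV \<and> permute_vec \<sigma> x = x}"
    proof safe
      fix \<sigma> assume s: "\<sigma> permutes UNIV" "permute_vec \<sigma> (permute_vec \<tau> x) = permute_vec \<tau> x"
      show "\<tau> \<circ> \<sigma> \<circ> inv \<tau> permutes UNIV"
        using s(1) assms permutes_compose permutes_inv by blast
      show "permute_vec (\<tau> \<circ> \<sigma> \<circ> inv \<tau>) x = x"
        by (metis permute_vec_compose s(2) permute_vec_inv(2)[OF assms])
    qed
    show "(\<lambda>\<sigma>. inv \<tau> \<circ> \<sigma> \<circ> \<tau>) ` {\<sigma>. \<sigma> permutes UNIV \<and> permute_vec \<sigma> x = x}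
       \<subseteq> {\<sigma>. \<sigma> permutes UNIV \<and> permute_vec \<sigma> (permute_vec \<tau> x) = permute_vec \<tau> x}"
    proof safe
      fix \<sigma> assume s: "\<sigma> permutes UNIV" "permute_vec \<sigma> x = x"
      show "inv \<tau> \<circ> \<sigma> \<circ> \<tau> permutes UNIV"
        using s(1) assms permutes_compose permutes_inv by blast
      show "permute_vec (inv \<tau> \<circ> \<sigma> \<circ> \<tau>) (permute_vec \<tau> x) = permute_vec \<tau> x"
        by (metis permute_vec_compose s(2) permute_vec_inv(2)[OF assms])
    qed
  qed (auto simp: fun_eq_iff permutes_inverses[OF assms])
  then show ?thesis unfolding vec_stab_def by (rule bij_betw_same_card)
qed

lemma vec_stab_inj:
  assumes "inj (($) x)" shows "vec_stab x = 1"
proof -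
  have "{\<sigma>. \<sigma> permutes UNIV \<and> permute_vec \<sigma> x = x} = {id}"
    using assms by (auto simp: permute_vec_def vec_eq_iff inj_def permutes_id)
  then show ?thesis by (simp add: vec_stab_def)
qed

text \<open>Each term is spread over the permutations that sort its point; after exchanging the two sums every
  permutation contributes the same.\<close>

lemma sum_symmetric_eq_sum_sorted:
  fixes h :: "'a::linorder^'n::{finite,wellorder} \<Rightarrow> real"
  assumes A: "finite A" "\<And>\<sigma> x. \<sigma> permutes UNIV \<Longrightarrow> x \<in> A \<Longrightarrow> permute_vec \<sigma> x \<in> A"
    and h: "\<And>\<sigma> x. \<sigma> permutes UNIV \<Longrightarrow> h (permute_vec \<sigma> x) = h x"
  shows "(\<Sum>x\<in>A. h x) = fact CARD('n) * (\<Sum>x\<in>A \<inter> sorted_vecs. h x / vec_stab x)"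
proof -
  have bij: "bij_betw (permute_vec \<sigma>) A A" if "\<sigma> permutes UNIV" for \<sigma>
    by (rule bij_betw_byWitness[where f' = "permute_vec (inv \<sigma>)"])
       (use A(2) that permutes_inv[OF that] permute_vec_inv[OF that] in auto)
  have "(\<Sum>x\<in>A. h x) = (\<Sum>x\<in>A. \<Sum>\<sigma> | \<sigma> permutes UNIV. h x / vec_stab x * indicator sorted_vecs (permute_vec \<sigma> x))"
    by (intro sum.cong refl, subst sum_distrib_left[symmetric], subst sum_indicator_sorted_vecs)
       (simp add: vec_stab_pos[THEN less_imp_neq, symmetric])
  also have "\<dots> = (\<Sum>\<sigma> | \<sigma> permutes (UNIV::'n set). \<Sum>x\<in>A. h x / vec_stab x * indicator sorted_vecs (permute_vec \<sigma> x))"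
    by (rule sum.swap)
  also have "\<dots> = (\<Sum>\<sigma> | \<sigma> permutes (UNIV::'n set). \<Sum>x\<in>A. h x / vec_stab x * indicator sorted_vecs x)"
  proof (rule sum.cong[OF refl])
    fix \<sigma> :: "'n \<Rightarrow> 'n" assume "\<sigma> \<in> {\<sigma>. \<sigma> permutes UNIV}"
    then have s: "\<sigma> permutes UNIV" by simp
    show "(\<Sum>x\<in>A. h x / vec_stab x * indicator sorted_vecs (permute_vec \<sigma> x)) = (\<Sum>x\<in>A. h x / vec_stab x * indicator sorted_vecs x)"
      using sum.reindex_bij_betw[OF bij[OF s], of "\<lambda>x. h x / vec_stab x * indicator sorted_vecs x"]
      by (simp add: vec_stab_permute[OF s] h[OF s])
  qed
  also have "\<dots> = fact CARD('n) * (\<Sum>x\<in>A. h x / vec_stab x * indicator sorted_vecs x)"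
    by (simp add: card_permutations[OF refl finite])
  also have "(\<Sum>x\<in>A. h x / vec_stab x * indicator sorted_vecs x) = (\<Sum>x\<in>A \<inter> sorted_vecs. h x / vec_stab x)"
    using A(1) by (intro sum.mono_neutral_cong_right) (auto simp: indicator_def)
  finally show ?thesis .
qed

section \<open>Polynomials as functions\<close>

lemma poly_mapping_sum_single:
  "p = (\<Sum>m\<in>Poly_Mapping.keys p. Poly_Mapping.single m (Poly_Mapping.lookup p m))"
  by (rule poly_mapping_eqI) (auto simp: lookup_sum lookup_single when_def in_keys_iff)

lemma mpoly_eval_superset:
  assumes "finite A" "Poly_Mapping.keys p \<subseteq> A"
  shows "mpoly_eval p Y =
    (\<Sum>m\<in>A. Poly_Mapping.lookup p m * (\<Prod>i\<in>UNIV. (Y $ i) ^ Poly_Mapping.lookup m i))"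
  unfolding mpoly_eval_def using assms
  by (intro sum.mono_neutral_left) (auto simp: in_keys_iff)

lemma mpoly_eval_add: "mpoly_eval (p + q) Y = mpoly_eval p Y + mpoly_eval q Y"
  using keys_add[of p q]
  by (simp add: mpoly_eval_superset[of "Poly_Mapping.keys p \<union> Poly_Mapping.keys q"] lookup_add
      distrib_right sum.distrib)

lemma mpoly_eval_0 [simp]: "mpoly_eval 0 Y = 0"
  by (simp add: mpoly_eval_def)

lemma mpoly_eval_single:
  "mpoly_eval (Poly_Mapping.single m c) Y = c * (\<Prod>i\<in>UNIV. (Y $ i) ^ Poly_Mapping.lookup m i)"
  by (subst mpoly_eval_superset[of "{m}"]) auto

lemma mpoly_eval_sum: "mpoly_eval (sum f A) Y = (\<Sum>a\<in>A. mpoly_eval (f a) Y)"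
  by (induction A rule: infinite_finite_induct) (auto simp: mpoly_eval_add)

lemma mpoly_eval_diff: "mpoly_eval (p - q) Y = mpoly_eval p Y - mpoly_eval q Y"
  using mpoly_eval_add[of "p - q" q Y] by simp

lemma mpoly_eval_mult: "mpoly_eval (p * q) Y = mpoly_eval p Y * mpoly_eval q Y"
proof -
  let ?s = "\<lambda>p m. Poly_Mapping.single m (Poly_Mapping.lookup p m)"
  have "p * q = (\<Sum>a\<in>Poly_Mapping.keys p. ?s p a) * (\<Sum>b\<in>Poly_Mapping.keys q. ?s q b)"
    using poly_mapping_sum_single[of p] poly_mapping_sum_single[of q] by simp
  also have "\<dots> = (\<Sum>a\<in>Poly_Mapping.keys p. \<Sum>b\<in>Poly_Mapping.keys q. ?s p a * ?s q b)"
    by (rule sum_product)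
  finally show ?thesis
    by (simp add: mpoly_eval_sum mult_single mpoly_eval_single lookup_add power_add prod.distrib)
       (simp add: mpoly_eval_def sum_product mult_ac)
qed

lemma mpoly_eval_continuous: "continuous_on S (mpoly_eval p)"
  unfolding mpoly_eval_def by (intro continuous_intros)

text \<open>Both the degree bound in each variable and the validity of a univariate quadrature formula are
  properties of the univariate factors; \<open>G\<close> collects the admissible ones.\<close>

inductive_set prodsums :: "real poly set \<Rightarrow> (real^'n::finite \<Rightarrow> real) set" for G where
  prod: "(\<And>i. q i \<in> G) \<Longrightarrow> (\<lambda>y. \<Prod>i\<in>UNIV. poly (q i) (y $ i)) \<in> prodsums G"
| zero: "(\<lambda>_. 0) \<in> prodsums G"
| add: "f \<in> prodsums G \<Longrightarrow> g \<in> prodsums G \<Longrightarrow> (\<lambda>y. f y + g y) \<in> prodsums G"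

lemma prodsums_mult:
  assumes "f \<in> prodsums G1" "g \<in> prodsums G2" and G: "\<And>p q. p \<in> G1 \<Longrightarrow> q \<in> G2 \<Longrightarrow> p * q \<in> G"
  shows "(\<lambda>y. f y * g y) \<in> prodsums G"
  using assms(1)
proof induction
  case (prod q)
  note q = this
  from assms(2) show ?case
  proof induction
    case (prod r)
    have "(\<lambda>y. \<Prod>i\<in>UNIV. poly (q i * r i) (y $ i)) \<in> prodsums G"
      by (rule prodsums.prod) (use G q prod in auto)
    then show ?case by (simp add: prod.distrib)
  next
    case (add f g)
    then show ?case using prodsums.add by (simp add: distrib_left)
  qed (simp add: prodsums.zero)
next
  case (add f g)
  then show ?case using prodsums.add by (simp add: distrib_right)
qed (simp add: prodsums.zero)

lemma prodsums_sum:
  assumes "\<And>a. a \<in> A \<Longrightarrow> f a \<in> prodsums G"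
  shows "(\<lambda>y. \<Sum>a\<in>A. f a y) \<in> prodsums G"
  using assms
proof (induction A rule: infinite_finite_induct)
  case (insert a A)
  then show ?case by (simp add: prodsums.add)
qed (simp_all add: prodsums.zero)

lemma prodsums_mono: "G1 \<subseteq> G2 \<Longrightarrow> f \<in> prodsums G1 \<Longrightarrow> f \<in> prodsums G2"
  by (rotate_tac, induction f rule: prodsums.induct) (auto intro: prodsums.intros)

definition deg_le :: "nat \<Rightarrow> real poly set" where
  "deg_le d = {p. degree p \<le> d}"

lemma prodsums_deg_mult:
  "f \<in> prodsums (deg_le d) \<Longrightarrow> g \<in> prodsums (deg_le e) \<Longrightarrow> (\<lambda>y. f y * g y) \<in> prodsums (deg_le (d + e))"
  by (erule prodsums_mult, assumption) (auto simp: deg_le_def intro: order_trans[OF degree_mult_le])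

lemma prodsums_const: "(\<lambda>_. c) \<in> prodsums (deg_le d)"
proof -
  have "(\<lambda>y. \<Prod>i\<in>UNIV. poly (if i = undefined then [:c:] else 1) ((y::real^'n::finite) $ i)) \<in> prodsums (deg_le d)"
    by (rule prodsums.prod) (auto simp: deg_le_def)
  also have "(\<lambda>y. \<Prod>i\<in>UNIV. poly (if i = undefined then [:c:] else 1) ((y::real^'n::finite) $ i)) = (\<lambda>_. c)"
    by (simp add: if_distrib[of "\<lambda>p. poly p _"] cong: if_cong)
  finally show ?thesis .
qed

lemma prodsums_scale: "f \<in> prodsums (deg_le d) \<Longrightarrow> (\<lambda>y. c * f y) \<in> prodsums (deg_le d)"
  using prodsums_deg_mult[OF prodsums_const[of c 0], of f d] by simp

lemma prodsums_deg_prod: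
  assumes "finite J" "\<And>j. j \<in> J \<Longrightarrow> f j \<in> prodsums (deg_le (d j))"
  shows "(\<lambda>y. \<Prod>j\<in>J. f j y) \<in> prodsums (deg_le (\<Sum>j\<in>J. d j))"
  using assms by (induction J) (simp_all add: prodsums_const prodsums_deg_mult)

lemma prodsums_deg_power:
  "f \<in> prodsums (deg_le d) \<Longrightarrow> (\<lambda>y. f y ^ m) \<in> prodsums (deg_le (m * d))"
  by (induction m) (simp_all add: prodsums_const prodsums_deg_mult)

lemma deg_le_mono: "d \<le> e \<Longrightarrow> deg_le d \<subseteq> deg_le e"
  by (auto simp: deg_le_def)

lemma det_in_prodsums:
  assumes "\<And>k. degree (q k) \<le> d"
  shows "(\<lambda>y::real^'n::finite. det (\<chi> i k. poly (q k) (y $ i))) \<in> prodsums (deg_le d)"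
  unfolding det_def
proof (intro prodsums_sum prodsums_scale)
  fix p :: "'n \<Rightarrow> 'n"
  show "(\<lambda>y::real^'n::finite. \<Prod>i\<in>UNIV. (\<chi> i k. poly (q k) (y $ i)) $ i $ p i) \<in> prodsums (deg_le d)"
    using prodsums.prod[of "\<lambda>i. q (p i)" "deg_le d"] assms by (simp add: deg_le_def)
qed

lemma prodsums_continuous: "f \<in> prodsums G \<Longrightarrow> continuous_on S f"
  by (induction rule: prodsums.induct) (auto intro!: continuous_intros)

section \<open>Symmetric polynomials\<close>

text \<open>The map whose composition with the coordinatewise cosine is \<open>phi\<close>; its components are positive
  multiples of the elementary symmetric polynomials.\<close>

definition elem_map :: "real^'n::{finite,wellorder} \<Rightarrow> real^'n::_" where
  "elem_map y = (\<chi> j. \<Sum>\<sigma> | \<sigma> permutes UNIV. \<Prod>i\<in>UNIV. if \<sigma> i \<le> j then y $ i else 1)"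

definition sym_polys :: "(real^'n::{finite,wellorder} \<Rightarrow> real) set" where
  "sym_polys = {g. \<exists>p. \<forall>y. g y = mpoly_eval p (elem_map y)}"

lemma sym_polys_const: "(\<lambda>_. c) \<in> sym_polys"
  unfolding sym_polys_def
  by (rule CollectI, rule exI[of _ "Poly_Mapping.single 0 c"]) (simp add: mpoly_eval_single)

lemma sym_polys_add: "f \<in> sym_polys \<Longrightarrow> g \<in> sym_polys \<Longrightarrow> (\<lambda>y. f y + g y) \<in> sym_polys"
  unfolding sym_polys_def mem_Collect_eq by (metis mpoly_eval_add)

lemma sym_polys_mult: "f \<in> sym_polys \<Longrightarrow> g \<in> sym_polys \<Longrightarrow> (\<lambda>y. f y * g y) \<in> sym_polys"
  unfolding sym_polys_def mem_Collect_eq by (metis mpoly_eval_mult)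

lemma sym_polys_sum:
  "(\<And>a. a \<in> A \<Longrightarrow> f a \<in> sym_polys) \<Longrightarrow> (\<lambda>y. \<Sum>a\<in>A. f a y) \<in> sym_polys"
  by (induction A rule: infinite_finite_induct) (simp_all add: sym_polys_const sym_polys_add)

lemma sym_polys_prod:
  "(\<And>a. a \<in> A \<Longrightarrow> f a \<in> sym_polys) \<Longrightarrow> (\<lambda>y. \<Prod>a\<in>A. f a y) \<in> sym_polys"
  by (induction A rule: infinite_finite_induct) (simp_all add: sym_polys_const sym_polys_mult)

lemma sym_polys_elem: "(\<lambda>y. elem_map y $ (j::'n::{finite,wellorder})) \<in> sym_polys"
proof -
  have "mpoly_eval (Poly_Mapping.single (Poly_Mapping.single j 1) 1) Y = Y $ j" for Y :: "real^'n::_"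
    by (simp add: mpoly_eval_single lookup_single when_def if_distrib[of "(^) _"] cong: if_cong)
  then show ?thesis unfolding sym_polys_def mem_Collect_eq by metis
qed

lemma elem_map_in_prodsums: "(\<lambda>y. elem_map y $ (j::'n::{finite,wellorder})) \<in> prodsums (deg_le 1)"
proof -
  have "(\<lambda>y::real^'n::_. \<Prod>i\<in>UNIV. if \<sigma> i \<le> j then y $ i else 1) \<in> prodsums (deg_le 1)" for \<sigma>
    using prodsums.prod[of "\<lambda>i. if \<sigma> i \<le> j then [:0,1:] else 1" "deg_le 1"]
    by (simp add: deg_le_def if_distrib[of "\<lambda>p. poly p _"] cong: if_cong)
  then show ?thesis unfolding elem_map_def by (simp add: prodsums_sum)
qed

lemma elem_map_continuous: "continuous_on S elem_map"
proof -
  have "continuous_on S (\<lambda>y. \<chi> j. elem_map y $ j)"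
    by (intro continuous_on_vec_lambda prodsums_continuous[OF elem_map_in_prodsums])
  then show ?thesis by simp
qed

lemma sym_polys_continuous:
  assumes "g \<in> sym_polys" shows "continuous_on S g"
proof -
  obtain p where "g = mpoly_eval p \<circ> elem_map" using assms by (auto simp: sym_polys_def fun_eq_iff)
  then show ?thesis
    using continuous_on_compose[OF elem_map_continuous mpoly_eval_continuous] by metis
qed

text \<open>Composition with a permutation that moves \<open>B\<close> onto the initial segment identifies the two sets of
  permutations. The common number is the factor between a component of \<open>elem_map\<close> and the
  elementary symmetric polynomial.\<close>

lemma card_permutations_onto_initial:
  obtains c :: nat where "c > 0"
    "\<And>B. card B = card {..j::'n::{finite,wellorder}} \<Longrightarrow> card {\<sigma>. \<sigma> permutes UNIV \<and> {i. \<sigma> i \<le> j} = B} = c"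
proof -
  define M where "M B = {\<sigma>::'n \<Rightarrow> 'n. \<sigma> permutes UNIV \<and> {i. \<sigma> i \<le> j} = B}" for B
  have "id \<in> M {..j}" by (auto simp: M_def permutes_id)
  then have "card (M {..j}) > 0" by (metis card_gt_0_iff empty_iff finite)
  moreover have "card (M B) = card (M {..j})" if B: "card B = card {..j}" for B
  proof -
    define a b :: "'n \<Rightarrow> nat" where "a i = (if i \<in> B then 1 else 0)" and "b i = (if i \<le> j then 1 else 0)" for i
    obtain \<tau> where \<tau>: "\<tau> permutes UNIV" "antimono (a \<circ> \<tau>)" by (rule sorting_permutation_exists)
    have "a \<circ> \<tau> = b"
    proof (rule antimono_eqI_card[OF \<tau>(2)])
      show "antimono b" by (auto simp: antimono_def b_def)
      fix c
      have "card {i. c \<le> a i} = card {i. c \<le> b i}"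
      proof (cases "c = 0")
        case False
        then have "{i. c \<le> a i} = (if c = 1 then B else {})" "{i. c \<le> b i} = (if c = 1 then {..j} else {})"
          by (auto simp: a_def b_def split: if_splits)
        then show ?thesis using B by simp
      qed simp
      then show "card {i. c \<le> (a \<circ> \<tau>) i} = card {i. c \<le> b i}"
        using card_Collect_permutes[OF \<tau>(1), of "\<lambda>i. c \<le> a i"] by simp
    qed
    then have \<tau>B: "\<tau> i \<in> B \<longleftrightarrow> i \<le> j" for i
      using fun_cong[OF \<open>a \<circ> \<tau> = b\<close>, of i] unfolding a_def b_def comp_def by (metis zero_neq_one)
    have "bij_betw (\<lambda>\<sigma>. \<sigma> \<circ> \<tau>) (M B) (M {..j})"
    proof (rule bij_betw_byWitness[where f' = "\<lambda>\<sigma>. \<sigma> \<circ> inv \<tau>"])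
      show "(\<lambda>\<sigma>. \<sigma> \<circ> \<tau>) ` M B \<subseteq> M {..j}"
        using permutes_compose[OF \<tau>(1)] \<tau>B by (fastforce simp: M_def)
      show "(\<lambda>\<sigma>. \<sigma> \<circ> inv \<tau>) ` M {..j} \<subseteq> M B"
      proof safe
        fix \<sigma> assume s: "\<sigma> \<in> M {..j}"
        have "(\<sigma> \<circ> inv \<tau>) i \<le> j \<longleftrightarrow> i \<in> B" for i
          using s \<tau>B[of "inv \<tau> i"] permutes_inverses(1)[OF \<tau>(1)] by (auto simp: M_def)
        then show "\<sigma> \<circ> inv \<tau> \<in> M B"
          using s permutes_compose[OF permutes_inv[OF \<tau>(1)]] by (auto simp: M_def)
      qed
    qed (auto simp: fun_eq_iff permutes_inverses[OF \<tau>(1)])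
    then show ?thesis by (rule bij_betw_same_card)
  qed
  ultimately show ?thesis using that unfolding M_def by blast
qed

lemma elem_map_eq_elementary:
  obtains c :: nat where "c > 0"
    "\<And>y::real^'n::{finite,wellorder}. elem_map y $ j = real c * (\<Sum>B | card B = card {..j}. \<Prod>i\<in>B. y $ i)"
proof -
  obtain c where c: "c > 0"
    "\<And>B. card B = card {..j} \<Longrightarrow> card {\<sigma>. \<sigma> permutes UNIV \<and> {i. \<sigma> i \<le> j} = B} = c"
    by (rule card_permutations_onto_initial[of j]) blast
  have "elem_map y $ j = real c * (\<Sum>B | card B = card {..j}. \<Prod>i\<in>B. y $ i)" for y :: "real^'n::_"
  proof -
    have "elem_map y $ j = (\<Sum>\<sigma> | \<sigma> permutes UNIV. \<Prod>i\<in>{i. \<sigma> i \<le> j}. y $ i)"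
      unfolding elem_map_def
      by (simp add: prod.If_cases)
    also have "\<dots> = (\<Sum>B | card B = card {..j}. \<Sum>\<sigma> | \<sigma> \<in> {\<sigma>. \<sigma> permutes UNIV} \<and> {i. \<sigma> i \<le> j} = B. \<Prod>i\<in>{i. \<sigma> i \<le> j}. y $ i)"
    proof (rule sum.group[symmetric])
      show "(\<lambda>\<sigma>. {i. \<sigma> i \<le> j}) ` {\<sigma>. \<sigma> permutes UNIV} \<subseteq> {B. card B = card {..j}}"
        using card_Collect_permutes[of _ "\<lambda>i. i \<le> j"] by (auto simp: atMost_def)
    qed auto
    also have "\<dots> = (\<Sum>B | card B = card {..j}. real c * (\<Prod>i\<in>B. y $ i))"
    proof (rule sum.cong[OF refl])
      fix B :: "'n set" assume "B \<in> {B. card B = card {..j}}"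
      then have "card {\<sigma>. \<sigma> permutes UNIV \<and> {i. \<sigma> i \<le> j} = B} = c" using c by simp
      moreover have "(\<Sum>\<sigma> | \<sigma> \<in> {\<sigma>. \<sigma> permutes UNIV} \<and> {i. \<sigma> i \<le> j} = B. \<Prod>i\<in>{i. \<sigma> i \<le> j}. y $ i)
         = (\<Sum>\<sigma> | \<sigma> permutes UNIV \<and> {i. \<sigma> i \<le> j} = B. \<Prod>i\<in>B. y $ i)"
        by (rule sum.cong) auto
      ultimately show "(\<Sum>\<sigma> | \<sigma> \<in> {\<sigma>. \<sigma> permutes UNIV} \<and> {i. \<sigma> i \<le> j} = B. \<Prod>i\<in>{i. \<sigma> i \<le> j}. y $ i)
         = real c * (\<Prod>i\<in>B. y $ i)" by simp
    qed
    finally show ?thesis by (simp add: sum_distrib_left)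
  qed
  with c(1) show ?thesis using that by blast
qed

text \<open>The polynomial with roots \<open>y\<close> has coefficients that are nonzero multiples of the components of
  \<open>elem_map y\<close>: Vieta's formulas with the constants of \<open>elem_map\<close> absorbed in \<open>\<alpha>\<close>.\<close>

lemma prod_minus_roots_expansion:
  obtains \<alpha> :: "'n::{finite,wellorder} \<Rightarrow> real" where "\<And>j. \<alpha> j \<noteq> 0"
    "\<And>(y::real^'n::_) t. (\<Prod>i\<in>UNIV. t - y $ i) = t ^ CARD('n) + (\<Sum>j\<in>UNIV. \<alpha> j * elem_map y $ j * t ^ delta j)"
proof -
  have "\<exists>c>0. \<forall>y::real^'n::_. elem_map y $ j = real c * (\<Sum>B | card B = card {..j}. \<Prod>i\<in>B. y $ i)" for j
    using elem_map_eq_elementary[of j] by metis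
  then obtain c :: "'n \<Rightarrow> nat" where c: "\<And>j. c j > 0"
    "\<And>j (y::real^'n::_). elem_map y $ j = real (c j) * (\<Sum>B | card B = card {..j}. \<Prod>i\<in>B. y $ i)"
    by metis
  define \<alpha> where "\<alpha> j = (-1) ^ card {..j} / real (c j)" for j
  have "(\<Prod>i\<in>UNIV. t - y $ i) = t ^ CARD('n) + (\<Sum>j\<in>UNIV. \<alpha> j * elem_map y $ j * t ^ delta j)"
    for y :: "real^'n::_" and t
  proof -
    have "(\<Prod>i\<in>UNIV. t - y $ i) = (\<Prod>i\<in>UNIV. (- (y $ i)) + t)" by simp
    also have "\<dots> = (\<Sum>B\<in>UNIV. (\<Prod>i\<in>B. - (y $ i)) * t ^ card (UNIV - B))"
      by (subst prod_add) simp_all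
    also have "\<dots> = t ^ CARD('n) + (\<Sum>B\<in>UNIV-{{}}. (\<Prod>i\<in>B. - (y $ i)) * t ^ card (UNIV - B))"
      by (subst sum.remove[of _ "{}"]) auto
    also have "(\<Sum>B\<in>UNIV-{{}}. (\<Prod>i\<in>B. - (y $ i)) * t ^ card (UNIV - B))
       = (\<Sum>B\<in>(\<Union>j\<in>UNIV. {B. card B = card {..j::'n}}). (\<Prod>i\<in>B. - (y $ i)) * t ^ card (UNIV - B))"
    proof (rule arg_cong[where f = "sum _"], intro subset_antisym subsetI)
      fix B :: "'n set" assume "B \<in> UNIV - {{}}"
      then have "card B > 0" "card B \<le> CARD('n)" by (auto simp: card_gt_0_iff card_mono)
      then have "CARD('n) - card B \<in> range (delta :: 'n \<Rightarrow> nat)" by (simp add: range_delta)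
      then obtain j :: 'n where "delta j = CARD('n) - card B" by auto
      then show "B \<in> (\<Union>j\<in>UNIV. {B. card B = card {..j::'n}})"
        using \<open>card B > 0\<close> \<open>card B \<le> CARD('n)\<close> by (auto simp: card_atMost_eq intro!: exI[of _ j])
    qed (auto simp: card_eq_0_iff)
    also have "\<dots> = (\<Sum>j\<in>UNIV. \<Sum>B | card B = card {..j::'n}. (\<Prod>i\<in>B. - (y $ i)) * t ^ card (UNIV - B))"
    proof (rule sum.UNION_disjoint, simp, simp, intro ballI impI)
      fix i j :: 'n assume "i \<noteq> j"
      show "{B::'n set. card B = card {..i::'n}} \<inter> {B. card B = card {..j}} = {}"
      proof (rule ccontr)
        assume "{B::'n set. card B = card {..i::'n}} \<inter> {B. card B = card {..j}} \<noteq> {}"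
        then have "CARD('n) - delta i = CARD('n) - delta j" by (auto simp: card_atMost_eq)
        then have "delta i = delta j" using delta_less_CARD[of i] delta_less_CARD[of j] by linarith
        then show False using \<open>i \<noteq> j\<close> inj_delta by (auto simp: inj_def)
      qed
    qed
    also have "\<dots> = (\<Sum>j\<in>UNIV. \<alpha> j * elem_map y $ j * t ^ delta j)"
    proof (rule sum.cong[OF refl])
      fix j :: 'n
      have "(\<Prod>i\<in>B. - (y $ i)) * t ^ card (UNIV - B) = (-1) ^ card {..j} * t ^ delta j * (\<Prod>i\<in>B. y $ i)"
        if "card B = card {..j}" for B
      proof -
        have "card (UNIV - B) = delta j"
          using that delta_less_CARD[of j] by (simp add: card_Diff_subset card_atMost_eq)
        moreover have "(\<Prod>i\<in>B. - (y $ i)) = (-1) ^ card {..j} * (\<Prod>i\<in>B. y $ i)"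
          by (subst that[symmetric]) (simp add: prod_uminus)
        ultimately show ?thesis by simp
      qed
      then have "(\<Sum>B | card B = card {..j::'n}. (\<Prod>i\<in>B. - (y $ i)) * t ^ card (UNIV - B))
        = (-1) ^ card {..j} * t ^ delta j * (\<Sum>B | card B = card {..j::'n}. \<Prod>i\<in>B. y $ i)"
        unfolding sum_distrib_left by (intro sum.cong) auto
      also have "\<dots> = \<alpha> j * elem_map y $ j * t ^ delta j"
        using c(1)[of j] by (simp add: c(2) \<alpha>_def)
      finally show "(\<Sum>B | card B = card {..j::'n}. (\<Prod>i\<in>B. - (y $ i)) * t ^ card (UNIV - B))
        = \<alpha> j * elem_map y $ j * t ^ delta j" .
    qed
    finally show ?thesis .
  qed
  moreover have "\<alpha> j \<noteq> 0" for j using c(1)[of j] by (simp add: \<alpha>_def)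
  ultimately show ?thesis using that by blast
qed

text \<open>The values of \<open>elem_map\<close> determine the polynomial with the given roots, hence the roots
  with their multiplicities.\<close>

lemma elem_map_eq_imp_card_eq:
  fixes y z :: "real^'n::{finite,wellorder}"
  assumes "elem_map y = elem_map z"
  shows "card {i. P (y $ i)} = card {i. P (z $ i)}"
proof -
  obtain \<alpha> :: "'n \<Rightarrow> real" where \<alpha>:
    "\<And>(y::real^'n::_) t. (\<Prod>i\<in>UNIV. t - y $ i) = t ^ CARD('n) + (\<Sum>j\<in>UNIV. \<alpha> j * elem_map y $ j * t ^ delta j)"
    by (rule prod_minus_roots_expansion) blast
  define R where "R y = (\<Prod>i\<in>UNIV. [:- y $ i, 1:])" for y :: "real^'n::_"
  have "poly (R y) t = poly (R z) t" for t
    using \<alpha>[of t y] \<alpha>[of t z] assms by (simp add: R_def poly_prod)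
  then have "R y = R z" by (simp add: poly_eq_poly_eq_iff[symmetric] fun_eq_iff)
  moreover have "proots (R y) = image_mset (($) y) (mset_set UNIV)" for y
    unfolding R_def by (subst proots_prod) (auto simp: sum_unfold_sum_mset)
  ultimately have "image_mset (($) y) (mset_set UNIV) = image_mset (($) z) (mset_set UNIV)" by metis
  then have "filter_mset P (image_mset (($) y) (mset_set UNIV)) = filter_mset P (image_mset (($) z) (mset_set UNIV))"
    by simp
  then have "size (filter_mset P (image_mset (($) y) (mset_set UNIV))) = size (filter_mset P (image_mset (($) z) (mset_set UNIV)))"
    by (rule arg_cong)
  moreover have "size (filter_mset P (image_mset (($) y) (mset_set UNIV))) = card {i. P (y $ i)}" for y :: "real^'n::_"
    by (simp add: filter_mset_image_mset)
  ultimately show ?thesis by simp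
qed

section \<open>Reduction modulo the polynomial with the given roots\<close>

text \<open>The degrees \<open>delta j\<close> are \<open>0, \<dots>, n - 1\<close>, each once, so these are bases of the polynomials of
  degree less than \<open>n\<close>. The monomials and the two kinds of Chebyshev polynomials are the cases used.\<close>

definition graded_basis :: "('n::{finite,wellorder} \<Rightarrow> real poly) \<Rightarrow> bool" where
  "graded_basis b \<longleftrightarrow> (\<forall>j. b j \<noteq> 0 \<and> degree (b j) = delta j)"

text \<open>The decisive point is that the symmetric coefficients \<open>C j\<close> do not depend on the position \<open>i\<close>.\<close>

definition reducible :: "('n::{finite,wellorder} \<Rightarrow> real poly) \<Rightarrow> (real^'n::_ \<Rightarrow> 'n \<Rightarrow> real) set" where
  "reducible b = {h. \<exists>C. (\<forall>j. C j \<in> sym_polys) \<and> (\<forall>y i. h y i = (\<Sum>j\<in>UNIV. C j y * poly (b j) (y $ i)))}"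

lemma reducible_basis: "(\<lambda>y i. poly (b j) (y $ i)) \<in> reducible b"
  unfolding reducible_def mem_Collect_eq
  by (rule exI[of _ "\<lambda>k y. if k = j then 1 else 0"])
     (auto simp: sym_polys_const if_distrib[of "\<lambda>c. c * _"] cong: if_cong)

lemma reducible_zero: "(\<lambda>y i. 0) \<in> reducible b"
  unfolding reducible_def mem_Collect_eq
  by (rule exI[of _ "\<lambda>k y. 0"]) (auto simp: sym_polys_const)

lemma reducible_add:
  assumes "g \<in> reducible b" "h \<in> reducible b"
  shows "(\<lambda>y i. g y i + h y i) \<in> reducible b"
proof -
  obtain C D where C: "\<forall>j. C j \<in> sym_polys" "\<forall>y i. g y i = (\<Sum>j\<in>UNIV. C j y * poly (b j) (y $ i))"
    and D: "\<forall>j. D j \<in> sym_polys" "\<forall>y i. h y i = (\<Sum>j\<in>UNIV. D j y * poly (b j) (y $ i))"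
    using assms unfolding reducible_def by blast
  show ?thesis unfolding reducible_def mem_Collect_eq
    by (rule exI[of _ "\<lambda>j y. C j y + D j y"])
       (auto simp: C D sym_polys_add distrib_right sum.distrib)
qed

lemma reducible_mult:
  assumes "f \<in> sym_polys" "h \<in> reducible b"
  shows "(\<lambda>y i. f y * h y i) \<in> reducible b"
proof -
  obtain C where C: "\<forall>j. C j \<in> sym_polys" "\<forall>y i. h y i = (\<Sum>j\<in>UNIV. C j y * poly (b j) (y $ i))"
    using assms unfolding reducible_def by blast
  show ?thesis unfolding reducible_def mem_Collect_eq
    by (rule exI[of _ "\<lambda>j y. f y * C j y"])
       (use C assms(1) in \<open>auto simp: sym_polys_mult sum_distrib_left mult.assoc\<close>)
qed

lemma reducible_scale: "h \<in> reducible b \<Longrightarrow> (\<lambda>y i. c * h y i) \<in> reducible b"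
  by (rule reducible_mult[OF sym_polys_const])

lemma reducible_sum:
  "(\<And>a. a \<in> A \<Longrightarrow> h a \<in> reducible b) \<Longrightarrow> (\<lambda>y i. \<Sum>a\<in>A. h a y i) \<in> reducible b"
  by (induction A rule: infinite_finite_induct) (simp_all add: reducible_zero reducible_add)

text \<open>Powers below \<open>n\<close> come from the graded basis; the power \<open>n\<close> of a coordinate is eliminated with
  the polynomial that has the coordinates as roots, and higher powers follow by multiplication.\<close>

lemma reducible_low_power:
  fixes b :: "'n::{finite,wellorder} \<Rightarrow> real poly"
  assumes b: "graded_basis b"
  shows "m < CARD('n) \<Longrightarrow> (\<lambda>y i. (y $ i) ^ m) \<in> reducible b"
proof (induction m rule: less_induct)
  case (less m)
  then obtain j :: 'n where j: "delta j = m" using range_delta by (metis imageE lessThan_iff)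
  define l where "l = coeff (b j) m"
  have l: "l \<noteq> 0" using b j unfolding l_def graded_basis_def by (metis leading_coeff_0_iff)
  have "(\<lambda>y i. (1 / l) * (poly (b j) (y $ i) + (-1) * (\<Sum>k<m. coeff (b j) k * (y $ i) ^ k))) \<in> reducible b"
    using less by (intro reducible_scale reducible_add reducible_basis reducible_sum) auto
  moreover have "poly (b j) t = l * t ^ m + (\<Sum>k<m. coeff (b j) k * t ^ k)" for t
    using b j by (simp add: poly_altdef l_def graded_basis_def lessThan_Suc_atMost[symmetric])
  ultimately show ?case using l by simp
qed

lemma reducible_power_CARD:
  fixes b :: "'n::{finite,wellorder} \<Rightarrow> real poly"
  assumes b: "graded_basis b"
  shows "(\<lambda>y i. (y $ i) ^ CARD('n)) \<in> reducible b"
proof -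
  obtain \<alpha> :: "'n \<Rightarrow> real" where \<alpha>:
    "\<And>(y::real^'n::_) t. (\<Prod>i\<in>UNIV. t - y $ i) = t ^ CARD('n) + (\<Sum>j\<in>UNIV. \<alpha> j * elem_map y $ j * t ^ delta j)"
    by (rule prod_minus_roots_expansion) blast
  have "(\<lambda>y i. \<Sum>j\<in>UNIV. (- \<alpha> j) * (elem_map y $ j * (y $ i) ^ delta j)) \<in> reducible b"
    using delta_less_CARD
    by (intro reducible_scale reducible_sum reducible_mult sym_polys_elem reducible_low_power[OF b]) auto
  moreover have "(\<Sum>j\<in>UNIV. (- \<alpha> j) * (elem_map y $ j * (y $ i) ^ delta j)) = (y $ i) ^ CARD('n)" for y i
  proof -
    have "(\<Prod>k\<in>UNIV. y $ i - y $ k) = 0" by (auto intro!: prod_zero bexI[of _ i])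
    then show ?thesis using \<alpha>[of "y $ i" y] by (simp add: sum_negf mult.assoc)
  qed
  ultimately show ?thesis by simp
qed

lemma reducible_power:
  fixes b :: "'n::{finite,wellorder} \<Rightarrow> real poly"
  assumes b: "graded_basis b"
  shows "(\<lambda>y i. (y $ i) ^ m) \<in> reducible b"
proof (induction m)
  case 0
  then show ?case using reducible_low_power[OF b, of 0] by simp
next
  case (Suc m)
  obtain C where C: "\<forall>j. C j \<in> sym_polys"
    "\<forall>(y::real^'n::_) i. (y $ i) ^ m = (\<Sum>j\<in>UNIV. C j y * poly (b j) (y $ i))"
    using Suc unfolding reducible_def mem_Collect_eq by blast
  have "(\<lambda>y i. (y $ i) ^ Suc k) \<in> reducible b" if "k \<le> delta j" for j :: 'n and k
    using that delta_less_CARD[of j] reducible_low_power[OF b, of "Suc k"] reducible_power_CARD[OF b]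
    by (cases "Suc k = CARD('n)") auto
  then have "(\<lambda>y i. \<Sum>j\<in>UNIV. C j y * (\<Sum>k\<le>delta j. coeff (b j) k * (y $ i) ^ Suc k)) \<in> reducible b"
    using C(1) by (intro reducible_sum reducible_mult reducible_scale) auto
  moreover have "(\<Sum>k\<le>delta j. coeff (b j) k * t ^ Suc k) = t * poly (b j) t" for j t
    using b by (simp add: poly_altdef graded_basis_def sum_distrib_left mult_ac)
  moreover have "(y $ i) ^ Suc m = (\<Sum>j\<in>UNIV. C j y * (y $ i * poly (b j) (y $ i)))" for y i
    by (simp only: power_Suc C(2) sum_distrib_left mult_ac)
  ultimately show ?case by simp
qed

lemma reducible_poly:
  assumes "graded_basis b"
  shows "(\<lambda>y i. poly q (y $ i)) \<in> reducible b"
  unfolding poly_altdef by (intro reducible_sum reducible_scale reducible_power assms)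

text \<open>Reducing every column factors the matrix through the matrix of the graded basis; the other factor
  has entries that are symmetric polynomials, and its determinant is the quotient.\<close>

theorem alternant_factorization:
  fixes b q :: "'n::{finite,wellorder} \<Rightarrow> real poly"
  assumes b: "graded_basis b"
  obtains g where "g \<in> sym_polys"
    "\<And>y. det (\<chi> i k. poly (q k) (y $ i)) = g y * det (\<chi> i k. poly (b k) (y $ i))"
proof -
  have "\<exists>C. (\<forall>j. C j \<in> sym_polys) \<and> (\<forall>(y::real^'n::_) i. poly (q k) (y $ i) = (\<Sum>j\<in>UNIV. C j y * poly (b j) (y $ i)))" for k
    using reducible_poly[OF b, of "q k"] unfolding reducible_def mem_Collect_eq by blast
  then obtain C where C: "\<And>k j. C k j \<in> sym_polys"
    "\<And>k (y::real^'n::_) i. poly (q k) (y $ i) = (\<Sum>j\<in>UNIV. C k j y * poly (b j) (y $ i))" by metis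
  have "(\<lambda>y. det (\<chi> j k. C k j y)) \<in> sym_polys"
    unfolding det_def by (simp, intro sym_polys_sum sym_polys_mult sym_polys_const sym_polys_prod C)
  moreover have "(\<chi> i k. poly (q k) (y $ i)) = (\<chi> i k. poly (b k) (y $ i)) ** (\<chi> j k. C k j y)" for y
    by (simp add: matrix_matrix_mult_def C(2)[of _ y] mult.commute)
  ultimately show ?thesis using that[of "\<lambda>y. det (\<chi> j k. C k j y)"] by (simp add: det_mul mult.commute)
qed

lemma graded_basis_monom: "graded_basis (\<lambda>j. monom 1 (delta j))"
  by (simp add: graded_basis_def degree_monom_eq)

definition update_coord :: "real^'n \<Rightarrow> 'n \<Rightarrow> real \<Rightarrow> real^'n" where
  "update_coord y i c = (\<chi> k. if k = i then c else y $ k)"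

text \<open>The elementary symmetric polynomials are affine in each variable, so a difference of two values
  is the partial derivative.\<close>

definition elem_partial :: "real^'n::{finite,wellorder} \<Rightarrow> real^'n::_^'n::_" where
  "elem_partial y = (\<chi> j i. elem_map (update_coord y i 1) $ j - elem_map (update_coord y i 0) $ j)"

text \<open>Differentiating the expansion of \<open>(t - y\<^sub>1) \<dots> (t - y\<^sub>n)\<close> with respect to the roots and evaluating at
  the roots shows that a scaled Vandermonde matrix times \<open>elem_partial y\<close> is diagonal, with entries that
  are products of differences of roots. For distinct roots both factors are therefore invertible.\<close>

lemma inj_alternants_nonzero:
  fixes y :: "real^'n::{finite,wellorder}"
  assumes inj: "inj (($) y)"
  shows "det (elem_partial y) \<noteq> 0" and "graded_basis b \<Longrightarrow> det (\<chi> i k. poly (b k) (y $ i)) \<noteq> 0"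
proof -
  obtain \<alpha> :: "'n \<Rightarrow> real" where \<alpha>: "\<And>j. \<alpha> j \<noteq> 0"
    "\<And>(y::real^'n::_) t. (\<Prod>i\<in>UNIV. t - y $ i) = t ^ CARD('n) + (\<Sum>j\<in>UNIV. \<alpha> j * elem_map y $ j * t ^ delta j)"
    by (rule prod_minus_roots_expansion) blast
  \<comment> \<open>Varying one root \<open>i\<close> in the expansion leaves the product over the other roots.\<close>
  have key: "(\<Sum>j\<in>UNIV. (\<alpha> j * t ^ delta j) * elem_partial y $ j $ i) = - (\<Prod>l\<in>UNIV-{i}. t - y $ l)" for t i
  proof -
    have upd: "(\<Prod>l\<in>UNIV. t - update_coord y i c $ l) = (t - c) * (\<Prod>l\<in>UNIV-{i}. t - y $ l)" for c
      by (subst prod.remove[of _ i]) (auto simp: update_coord_def intro!: prod.cong)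
    have "(\<Sum>j\<in>UNIV. (\<alpha> j * t ^ delta j) * elem_partial y $ j $ i)
      = (\<Prod>l\<in>UNIV. t - update_coord y i 1 $ l) - (\<Prod>l\<in>UNIV. t - update_coord y i 0 $ l)"
      by (simp add: \<alpha>(2) elem_partial_def right_diff_distrib sum_subtractf mult_ac)
    then show ?thesis by (simp add: upd algebra_simps)
  qed
  let ?A = "(\<chi> k j. poly (monom (\<alpha> j) (delta j)) (y $ k)) :: real^'n::_^'n::_"
  have prod: "?A ** elem_partial y = (\<chi> k i. if k = i then - (\<Prod>l\<in>UNIV-{i}. y $ i - y $ l) else 0)"
  proof -
    have "(\<Sum>j\<in>UNIV. poly (monom (\<alpha> j) (delta j)) (y $ k) * elem_partial y $ j $ i)
      = (if k = i then - (\<Prod>l\<in>UNIV-{i}. y $ i - y $ l) else 0)" for k i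
      using key[where t = "y $ k" and i = i] by (auto simp: poly_monom intro!: prod_zero bexI[of _ k])
    then show ?thesis by (simp add: matrix_matrix_mult_def)
  qed
  have "det (?A ** elem_partial y) = (\<Prod>i\<in>UNIV. - (\<Prod>l\<in>UNIV-{i}. y $ i - y $ l))"
    unfolding prod by (subst det_diagonal) auto
  also have "\<dots> \<noteq> 0" using inj by (auto simp: inj_def)
  finally have nz: "det ?A \<noteq> 0" "det (elem_partial y) \<noteq> 0" by (auto simp: det_mul)
  then show "det (elem_partial y) \<noteq> 0" by blast
  assume b: "graded_basis b"
  obtain g where "\<And>y. det (\<chi> i k. poly (monom (\<alpha> k) (delta k)) (y $ i)) = g y * det (\<chi> i k. poly (b k) (y $ i))"
    by (rule alternant_factorization[OF b, of "\<lambda>j. monom (\<alpha> j) (delta j)"]) blast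
  then have "det ?A = g y * det (\<chi> i k. poly (b k) (y $ i))" .
  then show "det (\<chi> i k. poly (b k) (y $ i)) \<noteq> 0" using nz by auto
qed

text \<open>Points with distinct coordinates are dense: move along a direction with distinct coordinates.\<close>

lemma continuous_eq_if_eq_on_inj:
  fixes f g :: "real^'n::{finite,wellorder} \<Rightarrow> real"
  assumes "continuous_on UNIV f" "continuous_on UNIV g"
    and eq: "\<And>y. inj (($) y) \<Longrightarrow> f y = g y"
  shows "f = g"
proof
  fix y :: "real^'n::_"
  define z where "z s = y + s *\<^sub>R (\<chi> i. real (delta i))" for s
  have "eventually (\<lambda>s. inj (($) (z s))) (at 0)"
  proof -
    have "eventually (\<lambda>s. i \<noteq> k \<longrightarrow> z s $ i \<noteq> z s $ k) (at 0)" for i k :: 'n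
    proof (cases "i = k")
      case False
      then have d: "real (delta i) - real (delta k) \<noteq> 0" using inj_delta by (auto simp: inj_def)
      have "eventually (\<lambda>s. s \<noteq> (y $ k - y $ i) / (real (delta i) - real (delta k))) (at 0)"
        by (rule eventually_neq_at_within)
      then show ?thesis
        by eventually_elim (use d in \<open>auto simp: z_def field_simps\<close>)
    qed simp
    then have "eventually (\<lambda>s. \<forall>i k. i \<noteq> k \<longrightarrow> z s $ i \<noteq> z s $ k) (at 0)"
      by (intro eventually_all_finite) auto
    then show ?thesis by eventually_elim (auto simp: inj_def)
  qed
  then have ev: "eventually (\<lambda>s. f (z s) = g (z s)) (at 0)" by eventually_elim (rule eq)
  have z: "isCont z 0" unfolding z_def by (intro continuous_intros)
  have z0: "z 0 = y" by (simp add: z_def)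
  have "((\<lambda>s. f (z s)) \<longlongrightarrow> f y) (at 0)" "((\<lambda>s. g (z s)) \<longlongrightarrow> g y) (at 0)"
    using isCont_o2[OF z, of f] isCont_o2[OF z, of g] assms(1,2) z0
    by (simp_all add: continuous_on_eq_continuous_at isCont_def)
  moreover have "((\<lambda>s. f (z s)) \<longlongrightarrow> g y) (at 0)"
    using calculation(2) ev by (subst tendsto_cong[OF ev])
  ultimately show "f y = g y" using tendsto_unique[of "at (0::real)"] by fastforce
qed

text \<open>Multiplying a permanent with the Vandermonde determinant gives a sum of alternants, each of
  which is divisible by that determinant again.\<close>

lemma permanent_in_sym_polys:
  fixes q :: "'n::{finite,wellorder} \<Rightarrow> real poly"
  shows "(\<lambda>y. \<Sum>\<sigma> | \<sigma> permutes UNIV. \<Prod>i\<in>UNIV. poly (q (\<sigma> i)) (y $ i)) \<in> sym_polys"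
proof -
  let ?P = "{\<sigma>. \<sigma> permutes (UNIV :: 'n set)}"
  define f where "f y = (\<Sum>\<sigma>\<in>?P. \<Prod>i\<in>UNIV. poly (q (\<sigma> i)) (y $ i))" for y :: "real^'n::_"
  define D where "D y = det (\<chi> i j. poly (monom 1 (delta j)) (y $ i))" for y :: "real^'n::_"
  have "\<forall>\<sigma>. \<exists>g. g \<in> sym_polys \<and> (\<forall>y. det (\<chi> i j. poly (q (\<sigma> j) * monom 1 (delta j)) (y $ i)) = g y * D y)"
  proof
    fix \<sigma>
    show "\<exists>g. g \<in> sym_polys \<and> (\<forall>y. det (\<chi> i j. poly (q (\<sigma> j) * monom 1 (delta j)) (y $ i)) = g y * D y)"
      unfolding D_def
      by (rule alternant_factorization[OF graded_basis_monom, of "\<lambda>j. q (\<sigma> j) * monom 1 (delta j)"]) blast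
  qed
  from choice[OF this] obtain g where g: "\<And>\<sigma>. g \<sigma> \<in> sym_polys"
    "\<And>\<sigma> y. det (\<chi> i j. poly (q (\<sigma> j) * monom 1 (delta j)) (y $ i)) = g \<sigma> y * D y" by blast
  have fD: "f y * D y = (\<Sum>\<sigma>\<in>?P. g \<sigma> y) * D y" for y
  proof -
    have "f y * D y = (\<Sum>\<tau>\<in>?P. \<Sum>\<sigma>\<in>?P. of_int (sign \<tau>)
        * (\<Prod>i\<in>UNIV. poly (q (\<sigma> i)) (y $ i) * poly (monom 1 (delta (\<tau> i))) (y $ i)))"
      unfolding f_def D_def det_def
      by (simp add: sum_product prod.distrib mult_ac) (rule sum.swap)
    also have "\<dots> = (\<Sum>\<tau>\<in>?P. \<Sum>\<sigma>\<in>?P. of_int (sign \<tau>)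
        * (\<Prod>i\<in>UNIV. poly (q (\<sigma> (\<tau> i))) (y $ i) * poly (monom 1 (delta (\<tau> i))) (y $ i)))"
      by (rule sum.cong[OF refl], subst sum_permutations_compose_right) auto
    also have "\<dots> = (\<Sum>\<sigma>\<in>?P. det (\<chi> i j. poly (q (\<sigma> j) * monom 1 (delta j)) (y $ i)))"
      unfolding det_def by (subst sum.swap) simp
    finally show ?thesis by (simp only: g(2) sum_distrib_right)
  qed
  have sym: "(\<lambda>y. \<Sum>\<sigma>\<in>?P. g \<sigma> y) \<in> sym_polys" by (intro sym_polys_sum g)
  moreover have "f = (\<lambda>y. \<Sum>\<sigma>\<in>?P. g \<sigma> y)"
  proof (rule continuous_eq_if_eq_on_inj)
    show "continuous_on UNIV f" unfolding f_def by (intro continuous_intros)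
    show "continuous_on UNIV (\<lambda>y. \<Sum>\<sigma>\<in>?P. g \<sigma> y)" by (rule sym_polys_continuous[OF sym])
    show "f y = (\<Sum>\<sigma>\<in>?P. g \<sigma> y)" if "inj (($) y)" for y
      using fD[of y] inj_alternants_nonzero(2)[OF that graded_basis_monom] unfolding D_def by simp
  qed
  ultimately show ?thesis unfolding f_def by metis
qed

text \<open>The fundamental theorem of symmetric polynomials: averaging over all rearrangements turns each
  product of univariate polynomials into a permanent and leaves a symmetric function unchanged.\<close>

theorem symmetric_imp_sym_polys:
  fixes f :: "real^'n::{finite,wellorder} \<Rightarrow> real"
  assumes f: "f \<in> prodsums G" and sym: "\<And>\<sigma> y. \<sigma> permutes UNIV \<Longrightarrow> f (permute_vec \<sigma> y) = f y"
  shows "f \<in> sym_polys"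
proof -
  have "(\<lambda>y. \<Sum>\<sigma> | \<sigma> permutes UNIV. f (permute_vec \<sigma> y)) \<in> sym_polys"
    using f
  proof induction
    case (prod q)
    have "(\<Sum>\<sigma> | \<sigma> permutes UNIV. \<Prod>i\<in>UNIV. poly (q i) (permute_vec \<sigma> y $ i))
      = (\<Sum>\<sigma> | \<sigma> permutes UNIV. \<Prod>i\<in>UNIV. poly (q (\<sigma> i)) (y $ i))" for y :: "real^'n::_"
    proof -
      have "(\<Prod>i\<in>UNIV. poly (q i) (permute_vec (inv \<sigma>) y $ i)) = (\<Prod>i\<in>UNIV. poly (q (\<sigma> i)) (y $ i))"
        if "\<sigma> permutes UNIV" for \<sigma>
        by (rule prod.reindex_bij_witness[of _ \<sigma> "inv \<sigma>"])
           (auto simp: permute_vec_def permutes_inverses[OF that])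
      then show ?thesis by (subst sum_permutations_inverse) simp
    qed
    then show ?case using permanent_in_sym_polys[of q] by simp
  next
    case (add f g)
    then show ?case using sym_polys_add by (simp add: sum.distrib)
  qed (simp add: sym_polys_const)
  then have "(\<lambda>y. fact CARD('n) * f y) \<in> sym_polys"
    by (simp add: sym card_permutations[OF refl finite])
  from sym_polys_mult[OF sym_polys_const[of "inverse (fact CARD('n))"] this] show ?thesis
    by (simp add: mult.assoc[symmetric])
qed

section \<open>Polynomials are determined by their values on the fundamental domain\<close>

text \<open>Digits in a large base separate finitely many exponent vectors by a single weighted sum.\<close>

lemma separating_weights:
  fixes A :: "'n::finite set"
  shows "\<exists>w. \<forall>m m'. (\<forall>i\<in>A. m i < B \<and> m' i < (B::nat)) \<longrightarrow>
    (\<Sum>i\<in>A. m i * w i) = (\<Sum>i\<in>A. m' i * w i) \<longrightarrow> (\<forall>i\<in>A. m i = m' i)"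
proof (induction A rule: finite_induct[OF finite])
  case (2 a A)
  then obtain w where w: "\<And>m m'. (\<forall>i\<in>A. m i < B \<and> m' i < B) \<Longrightarrow>
    (\<Sum>i\<in>A. m i * w i) = (\<Sum>i\<in>A. m' i * w i) \<Longrightarrow> (\<forall>i\<in>A. m i = m' i)" by blast
  define v where "v i = (if i = a then 1 else B * w i)" for i
  have sum: "(\<Sum>i\<in>insert a A. m i * v i) = m a + B * (\<Sum>i\<in>A. m i * w i)" for m
  proof -
    have "(\<Sum>i\<in>A. m i * v i) = (\<Sum>i\<in>A. B * (m i * w i))"
      using 2 by (intro sum.cong) (auto simp: v_def)
    then show ?thesis using 2 by (simp add: v_def sum_distrib_left)
  qed
  show ?case
  proof (rule exI[of _ v], intro allI impI)
    fix m m' assume lt: "\<forall>i\<in>insert a A. m i < B \<and> m' i < B"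
      and eq: "(\<Sum>i\<in>insert a A. m i * v i) = (\<Sum>i\<in>insert a A. m' i * v i)"
    from eq have eq': "m a + B * (\<Sum>i\<in>A. m i * w i) = m' a + B * (\<Sum>i\<in>A. m' i * w i)"
      unfolding sum .
    have "(m a + B * (\<Sum>i\<in>A. m i * w i)) mod B = m a" "(m' a + B * (\<Sum>i\<in>A. m' i * w i)) mod B = m' a"
      using bspec[OF lt insertI1] by (simp_all only: mod_mult_self2 mod_less)
    then have 1: "m a = m' a" using eq' by metis
    moreover have "B > 0" using lt by auto
    ultimately have "(\<Sum>i\<in>A. m i * w i) = (\<Sum>i\<in>A. m' i * w i)" using eq' by simp
    then show "\<forall>i\<in>insert a A. m i = m' i" using w[of m m'] lt 1 by auto
  qed
qed auto

text \<open>Along the curve \<open>Y\<^sub>i = t ^ w i\<close> with separating weights, different monomials become different powers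
  of \<open>t\<close>.\<close>

lemma mpoly_eval_zero_imp_zero:
  fixes p :: "'n::finite mpoly"
  assumes "\<And>Y. mpoly_eval p Y = 0"
  shows "p = 0"
proof (rule ccontr)
  assume "p \<noteq> 0"
  then obtain m0 where m0: "m0 \<in> Poly_Mapping.keys p" by (metis all_not_in_conv keys_eq_empty)
  define B where "B = Suc (Max ((\<lambda>(m,i). Poly_Mapping.lookup m i) ` (Poly_Mapping.keys p \<times> UNIV)))"
  have B: "Poly_Mapping.lookup m i < B" if "m \<in> Poly_Mapping.keys p" for m i
  proof -
    have "Poly_Mapping.lookup m i \<in> (\<lambda>(m,i). Poly_Mapping.lookup m i) ` (Poly_Mapping.keys p \<times> UNIV)"
      using that by (auto intro!: image_eqI[of _ _ "(m, i)"])
    then show ?thesis unfolding B_def less_Suc_eq_le by (intro Max_ge) auto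
  qed
  obtain w where w: "\<forall>m m'. (\<forall>i\<in>(UNIV::'n set). m i < B \<and> m' i < B) \<longrightarrow>
    (\<Sum>i\<in>UNIV. m i * w i) = (\<Sum>i\<in>UNIV. m' i * w i) \<longrightarrow> (\<forall>i\<in>UNIV. m i = m' i)"
    using separating_weights[of "UNIV :: 'n set" B] by blast
  define W where "W m = (\<Sum>i\<in>UNIV. Poly_Mapping.lookup m i * w i)" for m
  have W: "inj_on W (Poly_Mapping.keys p)"
  proof (rule inj_onI)
    fix m m' assume "m \<in> Poly_Mapping.keys p" "m' \<in> Poly_Mapping.keys p" "W m = W m'"
    then have "\<forall>i\<in>UNIV. Poly_Mapping.lookup m i < B \<and> Poly_Mapping.lookup m' i < B"
      "(\<Sum>i\<in>UNIV. Poly_Mapping.lookup m i * w i) = (\<Sum>i\<in>UNIV. Poly_Mapping.lookup m' i * w i)"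
      using B by (blast, simp only: W_def)
    then have "\<forall>i\<in>UNIV. Poly_Mapping.lookup m i = Poly_Mapping.lookup m' i"
      using w by blast
    then show "m = m'" by (intro poly_mapping_eqI) blast
  qed
  define q where "q = (\<Sum>m\<in>Poly_Mapping.keys p. monom (Poly_Mapping.lookup p m) (W m))"
  have "poly q t = mpoly_eval p (\<chi> i. t ^ w i)" for t
    by (simp add: q_def poly_sum poly_monom mpoly_eval_def W_def power_sum power_mult[symmetric] mult.commute)
  then have "q = 0" using assms by (simp add: poly_eq_poly_eq_iff[symmetric] fun_eq_iff)
  moreover have "coeff q (W m0) = Poly_Mapping.lookup p m0"
  proof -
    have "coeff q (W m0) = (\<Sum>m\<in>Poly_Mapping.keys p. if m = m0 then Poly_Mapping.lookup p m else 0)"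
      unfolding q_def coeff_sum coeff_monom using W m0
      by (intro sum.cong) (auto dest: inj_onD)
    then show ?thesis using m0 by simp
  qed
  ultimately show False using m0 by (simp add: in_keys_iff)
qed

text \<open>On a line through a point of the open set the polynomial is univariate with infinitely many zeros.\<close>

lemma mpoly_zero_on_open:
  fixes p :: "'n::finite mpoly"
  assumes "open U" "U \<noteq> {}" and U: "\<And>Y. Y \<in> U \<Longrightarrow> mpoly_eval p Y = 0"
  shows "p = 0"
proof (rule mpoly_eval_zero_imp_zero)
  fix Y :: "real^'n"
  obtain a where a: "a \<in> U" using assms by blast
  define q where "q = (\<Sum>m\<in>Poly_Mapping.keys p. smult (Poly_Mapping.lookup p m)
      (\<Prod>i\<in>UNIV. [:a $ i, Y $ i - a $ i:] ^ Poly_Mapping.lookup m i))"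
  define z where "z t = a + t *\<^sub>R (Y - a)" for t :: real
  have q: "poly q t = mpoly_eval p (z t)" for t
    by (simp add: q_def z_def poly_sum poly_prod mpoly_eval_def)
  have "isCont z 0" "z 0 \<in> U" unfolding z_def by (intro continuous_intros) (simp add: a)
  then have "eventually (\<lambda>t. z t \<in> U) (at 0)"
    using topological_tendstoD[of z "z 0" "at 0" U] \<open>open U\<close> by (simp add: isCont_def)
  then obtain e where e: "e > 0" "\<And>t. t \<noteq> 0 \<Longrightarrow> \<bar>t\<bar> < e \<Longrightarrow> z t \<in> U"
    by (auto simp: eventually_at dist_real_def)
  have "{0<..<e} \<subseteq> {t. poly q t = 0}" using e U q by auto
  then have "infinite {t. poly q t = 0}"
    using infinite_Ioo[OF e(1)] finite_subset by blast
  then have "q = 0" using poly_roots_finite by blast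
  then show "mpoly_eval p Y = 0" using q[of 1] by (simp add: z_def)
qed

definition cos_vec :: "real^'n \<Rightarrow> real^'n" where
  "cos_vec x = (\<chi> i. cos (pi * x $ i))"

lemma phi_eq: "phi (x :: real^'n::{finite,wellorder}) = elem_map (cos_vec x)"
proof -
  have "cos (pi * (if \<sigma> i \<le> j then 1 else 0) * x $ i) = (if \<sigma> i \<le> j then cos (pi * x $ i) else 1)" for \<sigma> :: "'n \<Rightarrow> 'n" and i j
    by (cases "\<sigma> i \<le> j") simp_all
  then show ?thesis
    by (simp add: phi_def X_fun_def cos_plus_def elem_map_def cos_vec_def cong: if_cong)
qed

lemma cos_vec_continuous: "continuous_on S cos_vec"
  unfolding cos_vec_def by (intro continuous_intros)

lemma phi_continuous: "continuous_on S phi"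
proof -
  have "phi = elem_map \<circ> cos_vec" by (simp add: fun_eq_iff phi_eq)
  then show ?thesis using continuous_on_compose[OF cos_vec_continuous elem_map_continuous] by metis
qed

lemma F_dom_antimono: "x \<in> F_dom \<Longrightarrow> antimono (($) x)"
  by (auto simp: F_dom_def antimono_def)

text \<open>The elementary symmetric polynomials determine the multiset of the cosines, hence of the angles, and
  a sorted vector is determined by its multiset of entries.\<close>

lemma inj_on_phi: "inj_on phi F_dom"
proof (rule inj_onI)
  fix x z :: "real^'n::{finite,wellorder}" assume x: "x \<in> F_dom" "z \<in> F_dom" "phi x = phi z"
  have ac: "arccos (cos (pi * x $ i)) = pi * x $ i" if "x \<in> F_dom" for x :: "real^'n::_" and i
    using that by (intro arccos_cos) (auto simp: F_dom_def)
  have "($) x = ($) z"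
  proof (rule antimono_eqI_card)
    show "card {i. c \<le> x $ i} = card {i. c \<le> z $ i}" for c
      using elem_map_eq_imp_card_eq[of "cos_vec x" "cos_vec z" "\<lambda>y. c \<le> arccos y / pi"] x
      by (simp add: phi_eq cos_vec_def ac)
  qed (use x F_dom_antimono in auto)
  then show "x = z" by (simp add: vec_eq_iff)
qed

lemma interior_F_dom:
  "interior F_dom = {x::real^'n::{finite,wellorder}. (\<forall>i. 0 < x $ i \<and> x $ i < 1) \<and> (\<forall>i j. i < j \<longrightarrow> x $ j < x $ i)}"
    (is "_ = ?O")
proof
  have "?O = (\<Inter>i. {x. 0 < x $ i} \<inter> {x. x $ i < 1}) \<inter> (\<Inter>i. \<Inter>j\<in>{i<..}. {x. x $ j < x $ i})" by auto
  also have "open \<dots>"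
    by (intro open_Int open_INT finite ballI open_Collect_less continuous_intros)
  finally have "open ?O" .
  moreover have "?O \<subseteq> F_dom" by (auto simp: F_dom_def less_le dest: antisym_conv1[THEN iffD1, rotated])
  ultimately show "?O \<subseteq> interior F_dom" by (rule interior_maximal[rotated])
  show "interior F_dom \<subseteq> ?O"
  proof
    fix x :: "real^'n::_" assume "x \<in> interior F_dom"
    then obtain e where e: "e > 0" "ball x e \<subseteq> F_dom" by (auto simp: mem_interior)
    have ax: "x + c *\<^sub>R axis i 1 \<in> F_dom" if "\<bar>c\<bar> < e" for c i
    proof -
      have "dist x (x + c *\<^sub>R axis i 1) < e"
        using that by (simp add: dist_norm)
      then show ?thesis using e by auto
    qed
    have 1: "x + (e/2) *\<^sub>R axis i 1 \<in> F_dom" "x + (-e/2) *\<^sub>R axis i 1 \<in> F_dom" for i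
      using ax[of "e/2" i] ax[of "-e/2" i] e(1) by auto
    have "0 < x $ i" "x $ i < 1" for i
      using 1[of i] e(1) unfolding F_dom_def by (auto simp: axis_def dest!: spec[of _ i])
    moreover have "x $ j < x $ i" if "i < j" for i j
    proof -
      have "(x + (e/2) *\<^sub>R axis j 1) $ j \<le> (x + (e/2) *\<^sub>R axis j 1) $ i"
        using 1(1)[of j] less_imp_le[OF that] unfolding F_dom_def by blast
      then show ?thesis using e(1) that by (simp add: axis_def split: if_splits)
    qed
    ultimately show "x \<in> ?O" by blast
  qed
qed

lemma interior_F_dom_nonempty: "interior (F_dom :: (real^'n::{finite,wellorder}) set) \<noteq> {}"
proof -
  have "(\<chi> i. (real (delta i) + 1) / (real CARD('n) + 1)) \<in> interior (F_dom :: (real^'n::_) set)"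
    using delta_less_CARD[where 'n='n] delta_strict_antimono
    by (auto simp: interior_F_dom intro!: divide_strict_right_mono)
  then show ?thesis by blast
qed

text \<open>By invariance of domain the image of the interior under \<open>phi\<close> is open, so that two polynomials
  that agree there are equal.\<close>

lemma the_mpoly_eval:
  fixes S :: "(real^'n::{finite,wellorder}) set"
  assumes g: "g \<in> sym_polys" and S: "interior F_dom \<subseteq> S" and h: "\<And>x. x \<in> S \<Longrightarrow> h x = g (cos_vec x)"
  shows "mpoly_eval (THE p. \<forall>x\<in>S. mpoly_eval p (phi x) = h x) (elem_map y) = g y"
proof -
  obtain p where p: "\<And>y. g y = mpoly_eval p (elem_map y)" using g unfolding sym_polys_def by blast
  have "(THE p. \<forall>x\<in>S. mpoly_eval p (phi x) = h x) = p"
  proof (rule the_equality)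
    show "\<forall>x\<in>S. mpoly_eval p (phi x) = h x" using h p by (simp add: phi_eq)
    fix q assume q: "\<forall>x\<in>S. mpoly_eval q (phi x) = h x"
    have "q - p = 0"
    proof (rule mpoly_zero_on_open)
      show "open (phi ` interior (F_dom :: (real^'n::_) set))"
        by (intro invariance_of_domain phi_continuous open_interior inj_on_subset[OF inj_on_phi] interior_subset)
      show "phi ` interior (F_dom :: (real^'n::_) set) \<noteq> {}" using interior_F_dom_nonempty by auto
      fix Y assume "Y \<in> phi ` interior (F_dom :: (real^'n::_) set)"
      then show "mpoly_eval (q - p) Y = 0"
        using q h p S by (auto simp: mpoly_eval_diff phi_eq)
    qed
    then show "q = p" by simp
  qed
  then show ?thesis using p by simp
qed

section \<open>Chebyshev polynomials and the cosine functions\<close>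

text \<open>The starting value \<open>[:0, 1:]\<close> gives the Chebyshev polynomials of the first kind, and
  \<open>[:- 1, 2:]\<close> those of the third kind.\<close>

fun cheb :: "real poly \<Rightarrow> nat \<Rightarrow> real poly" where
  "cheb p 0 = 1"
| "cheb p (Suc 0) = p"
| "cheb p (Suc (Suc m)) = [:0, 2:] * cheb p (Suc m) - cheb p m"

lemma cheb_degree:
  assumes "degree p = 1" "coeff p 1 > 0"
  shows "degree (cheb p m) \<le> m \<and> coeff (cheb p m) m > 0"
proof (induction m rule: induct_nat_012)
  case (ge2 m)
  have "degree ([:0, 2:] * cheb p (Suc m) - cheb p m) \<le> Suc (Suc m)"
    using ge2 by (intro degree_diff_le) (auto intro: order_trans[OF degree_pCons_le])
  moreover have "coeff (cheb p m) (Suc (Suc m)) = 0" using ge2 by (intro coeff_eq_0) auto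
  ultimately show ?case using ge2 by simp
qed (use assms in auto)

lemma graded_basis_cheb:
  assumes "degree p = 1" "coeff p 1 > 0"
  shows "graded_basis (\<lambda>j. cheb p (delta j))"
  unfolding graded_basis_def using cheb_degree[OF assms]
  by (metis coeff_0 le_antisym le_degree less_irrefl)

lemma cos_Suc_Suc: "cos ((a + 2) * t) = 2 * cos t * cos ((a + 1) * t) - cos (a * t :: real)"
proof -
  have "cos ((a + 1) * t + t) + cos ((a + 1) * t - t) = 2 * cos t * cos ((a + 1) * t)"
    by (simp add: cos_add cos_diff)
  then show ?thesis by (simp add: algebra_simps)
qed

lemma cheb_first_kind: "poly (cheb [:0, 1:] m) (cos t) = cos (real m * t)"
proof (induction m rule: induct_nat_012)
  case (ge2 m)
  then show ?case using cos_Suc_Suc[of "real m" t] by (simp add: algebra_simps)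
qed auto

lemma cheb_third_kind: "cos (t / 2) * poly (cheb [:- 1, 2:] m) (cos t) = cos ((real m + 1 / 2) * t)"
proof (induction m rule: induct_nat_012)
  case 1
  have "cos (t / 2) * (2 * cos t - 1) = cos (t + t / 2)"
    using cos_Suc_Suc[of "-1/2" t] by (simp add: algebra_simps)
  then show ?case by (simp add: algebra_simps)
next
  case (ge2 m)
  have "cos (t / 2) * poly (cheb [:- 1, 2:] (Suc (Suc m))) (cos t)
    = 2 * cos t * (cos (t / 2) * poly (cheb [:- 1, 2:] (Suc m)) (cos t)) - cos (t / 2) * poly (cheb [:- 1, 2:] m) (cos t)"
    by (simp add: algebra_simps)
  then show ?case unfolding ge2 using cos_Suc_Suc[of "real m + 1 / 2" t] by (simp add: algebra_simps)
qed auto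

text \<open>One formula covers both kinds: \<open>c\<close> is the constant \<open>1\<close> or the cosine of the half angle.\<close>

lemma cos_plus_eq_permanent:
  assumes "\<And>j t. c t * poly (q j) (cos t) = cos (l $ j * t)"
  shows "cos_plus l x = (\<Prod>i\<in>UNIV. c (pi * x $ i))
    * (\<Sum>\<sigma> | \<sigma> permutes UNIV. \<Prod>i\<in>UNIV. poly (q (\<sigma> i)) (cos_vec x $ i))"
proof -
  have "cos (pi * l $ j * x $ i) = c (pi * x $ i) * poly (q j) (cos_vec x $ i)" for i j
    by (simp add: cos_vec_def assms mult_ac)
  then show ?thesis by (simp add: cos_plus_def prod.distrib sum_distrib_left)
qed

lemma cos_minus_eq_det:
  assumes "\<And>j t. c t * poly (q j) (cos t) = cos (l $ j * t)"
  shows "cos_minus l x = (\<Prod>i\<in>UNIV. c (pi * x $ i)) * det (\<chi> i j. poly (q j) (cos_vec x $ i))"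
proof -
  have "cos (pi * l $ j * x $ i) = c (pi * x $ i) * poly (q j) (cos_vec x $ i)" for i j
    by (simp add: cos_vec_def assms mult_ac)
  then have "cos_minus l x = (\<Sum>\<sigma> | \<sigma> permutes UNIV. of_int (sign \<sigma>)
      * (\<Prod>i\<in>UNIV. c (pi * x $ i) * poly (q (\<sigma> i)) (cos_vec x $ i)))"
    by (simp only: cos_minus_def)
  then show ?thesis by (simp add: det_def prod.distrib sum_distrib_left mult_ac)
qed

section \<open>The Jacobian determinant and the weights\<close>

lemma elem_map_permute:
  fixes y :: "real^'n::{finite,wellorder}"
  assumes "\<sigma> permutes UNIV"
  shows "elem_map (permute_vec \<sigma> y) = elem_map y"
proof -
  have "(\<Sum>\<tau> | \<tau> permutes UNIV. \<Prod>i\<in>UNIV. if \<tau> i \<le> j then permute_vec \<sigma> y $ i else 1)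
     = (\<Sum>\<tau> | \<tau> permutes UNIV. \<Prod>i\<in>UNIV. if \<tau> i \<le> j then y $ i else 1)" for j
  proof -
    have "(\<Prod>i\<in>UNIV. if (\<tau> \<circ> \<sigma>) i \<le> j then permute_vec \<sigma> y $ i else 1)
       = (\<Prod>i\<in>UNIV. if \<tau> i \<le> j then y $ i else 1)" for \<tau> :: "'n \<Rightarrow> 'n"
      by (rule prod.reindex_bij_witness[of _ "inv \<sigma>" \<sigma>])
         (auto simp: permute_vec_def permutes_inverses[OF assms])
    then show ?thesis by (subst sum_permutations_compose_right[OF assms]) simp
  qed
  then show ?thesis by (simp add: elem_map_def)
qed

lemma sym_polys_permute:
  "g \<in> sym_polys \<Longrightarrow> \<sigma> permutes UNIV \<Longrightarrow> g (permute_vec \<sigma> y) = g y"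
  by (auto simp: sym_polys_def elem_map_permute)

text \<open>Rearranging the variables only permutes the columns of the matrix of partial derivatives.\<close>

lemma elem_partial_permute:
  assumes "\<sigma> permutes UNIV"
  shows "elem_partial (permute_vec \<sigma> y) $ j $ i = elem_partial y $ j $ \<sigma> i"
proof -
  have "update_coord (permute_vec \<sigma> y) i c = permute_vec \<sigma> (update_coord y (\<sigma> i) c)" for c
    using permutes_inj[OF assms] by (auto simp: update_coord_def permute_vec_def vec_eq_iff inj_eq)
  then show ?thesis by (simp add: elem_partial_def elem_map_permute[OF assms])
qed

lemma elem_partial_eq:
  "elem_partial y $ j $ i = (\<Sum>\<sigma> | \<sigma> permutes UNIV. if \<sigma> i \<le> j then \<Prod>k\<in>UNIV-{i}. if \<sigma> k \<le> j then y $ k else 1 else 0)"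
proof -
  have "(\<Prod>k\<in>UNIV. if \<sigma> k \<le> j then update_coord y i c $ k else 1)
     = (if \<sigma> i \<le> j then c else 1) * (\<Prod>k\<in>UNIV-{i}. if \<sigma> k \<le> j then y $ k else 1)" for \<sigma> :: "'a \<Rightarrow> 'a" and c
  proof (subst prod.remove[of _ i], simp, simp, rule arg_cong2[where f = "(*)"])
    show "(if \<sigma> i \<le> j then update_coord y i c $ i else 1) = (if \<sigma> i \<le> j then c else 1)"
      by (simp add: update_coord_def)
    show "(\<Prod>k\<in>UNIV-{i}. if \<sigma> k \<le> j then update_coord y i c $ k else 1)
      = (\<Prod>k\<in>UNIV-{i}. if \<sigma> k \<le> j then y $ k else 1)"
      by (rule prod.cong) (auto simp: update_coord_def)
  qed
  then show ?thesis
    by (auto simp: elem_partial_def elem_map_def sum_subtractf[symmetric] intro!: sum.cong)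
qed

lemma elem_partial_in_prodsums:
  "(\<lambda>y. elem_partial y $ j $ i) \<in> prodsums (deg_le 1)"
proof -
  have "(\<lambda>y::real^'a::_. if \<sigma> i \<le> j then \<Prod>k\<in>UNIV-{i}. if \<sigma> k \<le> j then y $ k else 1 else 0) \<in> prodsums (deg_le 1)"
    for \<sigma> :: "'a \<Rightarrow> 'a"
  proof (cases "\<sigma> i \<le> j")
    case True
    have "(\<lambda>y::real^'a::_. \<Prod>k\<in>UNIV. poly (if k \<noteq> i \<and> \<sigma> k \<le> j then [:0,1:] else 1) (y $ k)) \<in> prodsums (deg_le 1)"
      by (rule prodsums.prod) (auto simp: deg_le_def)
    moreover have "(\<Prod>k\<in>UNIV. poly (if k \<noteq> i \<and> \<sigma> k \<le> j then [:0,1:] else 1) (y $ k))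
      = (\<Prod>k\<in>UNIV-{i}. if \<sigma> k \<le> j then y $ k else 1)" for y :: "real^'a::_"
    proof (subst prod.remove[of _ i], simp, simp)
      have "(\<Prod>k\<in>UNIV-{i}. poly (if k \<noteq> i \<and> \<sigma> k \<le> j then [:0,1:] else 1) (y $ k))
        = (\<Prod>k\<in>UNIV-{i}. if \<sigma> k \<le> j then y $ k else 1)"
        by (rule prod.cong) auto
      then show "poly (if i \<noteq> i \<and> \<sigma> i \<le> j then [:0,1:] else 1) (y $ i)
          * (\<Prod>k\<in>UNIV-{i}. poly (if k \<noteq> i \<and> \<sigma> k \<le> j then [:0,1:] else 1) (y $ k))
        = (\<Prod>k\<in>UNIV-{i}. if \<sigma> k \<le> j then y $ k else 1)" by simp
    qed
    ultimately show ?thesis using True by simp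
  qed (simp add: prodsums.zero)
  then show ?thesis unfolding elem_partial_eq by (intro prodsums_sum)
qed

lemma phi_has_derivative:
  fixes x :: "real^'n::{finite,wellorder}"
  shows "(phi has_derivative (\<lambda>h. \<chi> j. \<Sum>i\<in>UNIV. elem_partial (cos_vec x) $ j $ i * (- sin (pi * x $ i) * pi) * h $ i)) (at x within S)"
proof -
  have 1: "((\<lambda>x. if \<sigma> i \<le> j then cos (pi * x $ i) else 1) has_derivative
     (\<lambda>h. if \<sigma> i \<le> j then - sin (pi * x $ i) * pi * h $ i else 0)) (at x within S)" for \<sigma> :: "'n \<Rightarrow> 'n" and i j
    by (cases "\<sigma> i \<le> j") (auto intro!: derivative_eq_intros bounded_linear_imp_has_derivative bounded_linear_vec_nth)
  have "((\<lambda>x. \<chi> j. \<Sum>\<sigma> | \<sigma> permutes UNIV. \<Prod>i\<in>UNIV. if \<sigma> i \<le> j then cos (pi * x $ i) else 1) has_derivative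
    (\<lambda>h. \<chi> j. \<Sum>\<sigma> | \<sigma> permutes UNIV. \<Sum>i\<in>UNIV. (if \<sigma> i \<le> j then - sin (pi * x $ i) * pi * h $ i else 0)
       * (\<Prod>k\<in>UNIV-{i}. if \<sigma> k \<le> j then cos (pi * x $ k) else 1))) (at x within S)"
    by (subst has_derivative_componentwise_within)
       (auto simp: Basis_vec_def inner_axis intro!: has_derivative_sum has_derivative_prod 1)
  moreover have "(\<lambda>x. \<chi> j. \<Sum>\<sigma> | \<sigma> permutes UNIV. \<Prod>i\<in>UNIV. if \<sigma> i \<le> j then cos (pi * x $ i) else 1) = (phi :: real^'n::_ \<Rightarrow> _)"
    by (simp add: fun_eq_iff phi_eq elem_map_def cos_vec_def cong: if_cong)
  moreover have "(\<Sum>\<sigma> | \<sigma> permutes UNIV. \<Sum>i\<in>UNIV. (if \<sigma> i \<le> j then - sin (pi * x $ i) * pi * h $ i else 0)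
       * (\<Prod>k\<in>UNIV-{i}. if \<sigma> k \<le> j then cos (pi * x $ k) else 1))
     = (\<Sum>i\<in>UNIV. elem_partial (cos_vec x) $ j $ i * (- sin (pi * x $ i) * pi) * h $ i)" for h j
    unfolding elem_partial_eq sum_distrib_right
    by (subst sum.swap) (auto simp: cos_vec_def intro!: sum.cong cong: if_cong)
  ultimately show ?thesis by simp
qed

lemma jacobian_phi:
  "jacobian phi (at x) = (\<chi> j i. elem_partial (cos_vec x) $ j $ i * (- sin (pi * x $ i) * pi))"
  unfolding jacobian_def frechet_derivative_at[OF phi_has_derivative, symmetric]
  by (simp add: matrix_def axis_def vec_eq_iff fun_eq_iff if_distrib[of "\<lambda>c. _ * c"] sum_negf cong: if_cong)

text \<open>The chain rule for \<open>phi = elem_map \<circ> cos_vec\<close>.\<close>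

lemma jac_det_eq:
  "jac_det x = (\<Prod>i\<in>UNIV. - sin (pi * x $ i) * pi) * det (elem_partial (cos_vec x))"
proof -
  have "jac_det x = det (transpose (jacobian phi (at x)))" by (simp add: jac_det_def)
  also have "transpose (jacobian phi (at x))
    = (\<chi> i. (- sin (pi * x $ i) * pi) *s transpose (elem_partial (cos_vec x)) $ i)"
    by (simp add: jacobian_phi transpose_def vec_eq_iff mult_ac)
  also have "det \<dots> = (\<Prod>i\<in>UNIV. - sin (pi * x $ i) * pi) * det (\<chi> i. transpose (elem_partial (cos_vec x)) $ i)"
    by (rule det_rows_mul)
  finally show ?thesis by simp
qed

lemma inj_cos_vec:
  assumes "x \<in> F_dom" "inj (($) x)" shows "inj (($) (cos_vec x))"
proof (rule injI)
  fix i j assume eq: "cos_vec x $ i = cos_vec x $ j"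
  have b: "0 \<le> pi * x $ k" "pi * x $ k \<le> pi" for k
    using assms by (auto simp: F_dom_def)
  have "cos (pi * x $ i) = cos (pi * x $ j)" using eq by (simp add: cos_vec_def)
  then have "pi * x $ i = pi * x $ j" by (rule cos_inj_pi[OF b b])
  then show "i = j" using injD[OF assms(2)] by simp
qed

lemma inj_cos_vec_interior:
  assumes "x \<in> interior F_dom" shows "inj (($) (cos_vec x))"
proof (rule inj_cos_vec)
  show "inj (($) x)"
    by (rule linorder_injI) (use assms in \<open>force simp: interior_F_dom\<close>)
qed (use assms interior_subset in blast)

lemma jac_det_nonzero:
  assumes "x \<in> interior F_dom" shows "jac_det x \<noteq> 0"
proof -
  have "sin (pi * x $ i) > 0" for i
    using assms by (intro sin_gt_zero) (auto simp: interior_F_dom)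
  then have "sin (pi * x $ i) \<noteq> 0" for i by (metis less_irrefl)
  then have "(\<Prod>i\<in>UNIV. - sin (pi * x $ i) * pi) \<noteq> 0" by simp
  then show ?thesis
    using inj_alternants_nonzero(1)[OF inj_cos_vec_interior[OF assms]] by (simp add: jac_det_eq)
qed

text \<open>The determinant of the partial derivatives changes only its sign when variables are permuted, and the
  squared sines are \<open>1 - y\<^sub>i\<^sup>2\<close>.\<close>

lemma jac_det_squared_sym:
  obtains g where "g \<in> sym_polys" "\<And>x::real^'n::{finite,wellorder}. (jac_det x)\<^sup>2 = g (cos_vec x)"
proof -
  define g where "g y = (\<Prod>i\<in>UNIV. pi\<^sup>2 * (1 - (y $ i)\<^sup>2)) * (det (elem_partial y))\<^sup>2" for y :: "real^'n::_"
  have 1: "(\<lambda>y::real^'n::_. \<Prod>i\<in>UNIV. pi\<^sup>2 * (1 - (y $ i)\<^sup>2)) \<in> prodsums (deg_le 2)"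
    using prodsums.prod[of "\<lambda>i::'n. [:pi\<^sup>2, 0, - (pi\<^sup>2):]" "deg_le 2"]
    by (simp add: deg_le_def algebra_simps power2_eq_square)
  have 2: "(\<lambda>y::real^'n::_. det (elem_partial y)) \<in> prodsums (deg_le (\<Sum>i\<in>(UNIV::'n set). 1))"
    unfolding det_def by (intro prodsums_sum prodsums_scale prodsums_deg_prod elem_partial_in_prodsums finite)
  have sym: "g (permute_vec \<sigma> y) = g y" if "\<sigma> permutes UNIV" for \<sigma> y
  proof -
    have "(\<Prod>i\<in>UNIV. pi\<^sup>2 * (1 - (permute_vec \<sigma> y $ i)\<^sup>2)) = (\<Prod>i\<in>UNIV. pi\<^sup>2 * (1 - (y $ i)\<^sup>2))"
      by (rule prod.reindex_bij_witness[of _ "inv \<sigma>" \<sigma>])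
         (auto simp: permute_vec_def permutes_inverses[OF that])
    moreover have "elem_partial (permute_vec \<sigma> y) = (\<chi> j i. elem_partial y $ j $ \<sigma> i)"
      by (simp add: vec_eq_iff elem_partial_permute[OF that])
    then have "det (elem_partial (permute_vec \<sigma> y)) = of_int (sign \<sigma>) * det (elem_partial y)"
      using det_permute_columns[OF that, of "elem_partial y"] by simp
    ultimately show ?thesis by (simp add: g_def power_mult_distrib sign_def)
  qed
  have "g \<in> prodsums (deg_le (2 + 2 * (\<Sum>i\<in>(UNIV::'n set). 1)))"
    unfolding g_def by (intro prodsums_deg_mult 1 prodsums_deg_power 2)
  then have "g \<in> sym_polys" by (rule symmetric_imp_sym_polys) (rule sym)
  moreover have "(jac_det x)\<^sup>2 = g (cos_vec x)" for x :: "real^'n::_"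
    by (simp add: jac_det_eq g_def power_mult_distrib prod_power_distrib cos_vec_def
        sin_squared_eq mult.commute)
  ultimately show ?thesis using that by blast
qed

lemma calJ_phi:
  fixes x :: "real^'n::{finite,wellorder}"
  assumes "x \<in> F_dom" shows "calJ (phi x) = \<bar>jac_det x\<bar>"
proof -
  obtain g where g: "g \<in> sym_polys" "\<And>x::real^'n::_. (jac_det x)\<^sup>2 = g (cos_vec x)"
    by (rule jac_det_squared_sym) blast
  have "mpoly_eval p_I_plus (elem_map (cos_vec x)) = g (cos_vec x)"
    unfolding p_I_plus_def by (rule the_mpoly_eval[OF g(1) interior_subset]) (rule g(2))
  then show ?thesis by (simp add: calJ_def phi_eq g(2)[symmetric])
qed

lemma alternant_permute:
  assumes "\<sigma> permutes UNIV"
  shows "det (\<chi> i j. poly (b j) (permute_vec \<sigma> y $ i)) = of_int (sign \<sigma>) * det (\<chi> i j. poly (b j) (y $ i))"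
  using det_permute_rows[OF assms, of "\<chi> i j. poly (b j) (y $ i)"] by (simp add: permute_vec_def)

lemma alternant_squared_sym:
  fixes b :: "'n::{finite,wellorder} \<Rightarrow> real poly"
  shows "(\<lambda>y. (det (\<chi> i j. poly (b j) (y $ i)))\<^sup>2) \<in> sym_polys"
proof (rule symmetric_imp_sym_polys)
  have "degree (b j) \<le> (\<Sum>j\<in>UNIV. degree (b j))" for j by (rule member_le_sum) auto
  then show "(\<lambda>y. (det (\<chi> i j. poly (b j) (y $ i)))\<^sup>2) \<in> prodsums (deg_le (2 * (\<Sum>j\<in>UNIV. degree (b j))))"
    by (intro prodsums_deg_power det_in_prodsums)
  fix \<sigma> :: "'n \<Rightarrow> 'n" and y :: "real^'n::_" assume "\<sigma> permutes UNIV"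
  then show "(det (\<chi> i j. poly (b j) (permute_vec \<sigma> y $ i)))\<^sup>2 = (det (\<chi> i j. poly (b j) (y $ i)))\<^sup>2"
    by (simp only: alternant_permute) (simp add: power_mult_distrib sign_def)
qed

abbreviation cheb1 where "cheb1 \<equiv> cheb [:0, 1:]"
abbreviation cheb3 where "cheb3 \<equiv> cheb [:- 1, 2:]"

text \<open>The squared product of the cosines of the half angles, written as a polynomial in the cosines.\<close>

definition half_weight :: "real^'n \<Rightarrow> real" where
  "half_weight y = (\<Prod>i\<in>UNIV. (1 + y $ i) / 2)"

lemma half_weight_cos_vec: "half_weight (cos_vec x) = (\<Prod>i\<in>UNIV. cos (pi * x $ i / 2))\<^sup>2"
proof -
  have "(1 + cos t) / 2 = (cos (t / 2))\<^sup>2" for t :: real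
    using cos_double_cos[of "t / 2"] by simp
  then show ?thesis by (simp add: half_weight_def cos_vec_def prod_power_distrib)
qed

lemma half_weight_in_prodsums: "half_weight \<in> prodsums {[:1/2, 1/2:]}"
  using prodsums.prod[of "\<lambda>i. [:1/2, 1/2:]" "{[:1/2, 1/2:]}"]
  unfolding half_weight_def[abs_def] by (simp add: add_divide_distrib)

lemma half_weight_sym: "half_weight \<in> sym_polys"
proof (rule symmetric_imp_sym_polys[OF half_weight_in_prodsums])
  fix \<sigma> :: "'a \<Rightarrow> 'a" and y :: "real^'a::_" assume s: "\<sigma> permutes UNIV"
  show "half_weight (permute_vec \<sigma> y) = half_weight y"
    unfolding half_weight_def
    by (rule prod.reindex_bij_witness[of _ "inv \<sigma>" \<sigma>]) (auto simp: permute_vec_def permutes_inverses[OF s])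
qed

lemma cos_minus_shift1:
  assumes "k \<in> P_plus"
  shows "cos_minus (real_vec k + rho1) x = det (\<chi> i j. poly (cheb1 (nat (k $ j) + delta j)) (cos_vec x $ i))"
proof (subst cos_minus_eq_det[where c = "\<lambda>_. 1"])
  fix j t
  have "real (nat (k $ j) + delta j) = (real_vec k + rho1) $ j"
    using assms by (simp add: real_vec_def rho1_def delta_def P_plus_def)
  then show "1 * poly (cheb1 (nat (k $ j) + delta j)) (cos t) = cos ((real_vec k + rho1) $ j * t)"
    by (simp only: cheb_first_kind mult_1)
qed simp

lemma cos_minus_shift2:
  assumes "k \<in> P_plus"
  shows "cos_minus (real_vec k + rho2) x = (\<Prod>i\<in>UNIV. cos (pi * x $ i / 2))
    * det (\<chi> i j. poly (cheb3 (nat (k $ j) + delta j)) (cos_vec x $ i))"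
proof (rule cos_minus_eq_det[where c = "\<lambda>t. cos (t / 2)"])
  fix j t
  have "real (nat (k $ j) + delta j) + 1 / 2 = (real_vec k + rho2) $ j"
    using assms by (simp add: real_vec_def rho2_def delta_def P_plus_def)
  then show "cos (t / 2) * poly (cheb3 (nat (k $ j) + delta j)) (cos t) = cos ((real_vec k + rho2) $ j * t)"
    by (simp only: cheb_third_kind)
qed

lemma cos_plus_shift0:
  assumes "k \<in> P_plus"
  shows "cos_plus (real_vec k) x = (\<Sum>\<sigma> | \<sigma> permutes UNIV. \<Prod>i\<in>UNIV. poly (cheb1 (nat (k $ \<sigma> i))) (cos_vec x $ i))"
proof (subst cos_plus_eq_permanent[where c = "\<lambda>_. 1"])
  fix j t
  have "real (nat (k $ j)) = real_vec k $ j"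
    using assms by (simp add: real_vec_def P_plus_def)
  then show "1 * poly (cheb1 (nat (k $ j))) (cos t) = cos (real_vec k $ j * t)"
    by (simp only: cheb_first_kind mult_1)
qed simp

lemma cos_plus_shift:
  assumes "k \<in> P_plus"
  shows "cos_plus (real_vec k + rho) x = (\<Prod>i\<in>UNIV. cos (pi * x $ i / 2))
    * (\<Sum>\<sigma> | \<sigma> permutes UNIV. \<Prod>i\<in>UNIV. poly (cheb3 (nat (k $ \<sigma> i))) (cos_vec x $ i))"
proof (rule cos_plus_eq_permanent[where c = "\<lambda>t. cos (t / 2)" and q = "\<lambda>j. cheb3 (nat (k $ j))"])
  fix j t
  have "real (nat (k $ j)) + 1 / 2 = (real_vec k + rho) $ j"
    using assms by (simp add: real_vec_def rho_def P_plus_def)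
  then show "cos (t / 2) * poly (cheb3 (nat (k $ j))) (cos t) = cos ((real_vec k + rho) $ j * t)"
    by (simp only: cheb_third_kind)
qed

lemma zero_in_P_plus: "0 \<in> P_plus" by (simp add: P_plus_def)
lemma real_vec_0: "real_vec 0 = 0" by (simp add: real_vec_def vec_eq_iff)

lemma cos_minus_rho1: "cos_minus rho1 x = det (\<chi> i j. poly (cheb1 (delta j)) (cos_vec x $ i))"
  using cos_minus_shift1[OF zero_in_P_plus, of x] by (simp add: real_vec_0)

lemma cos_minus_rho2:
  "cos_minus rho2 x = (\<Prod>i\<in>UNIV. cos (pi * x $ i / 2)) * det (\<chi> i j. poly (cheb3 (delta j)) (cos_vec x $ i))"
  using cos_minus_shift2[OF zero_in_P_plus, of x] by (simp add: real_vec_0)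

lemma cos_plus_rho:
  "cos_plus rho (x :: real^'n::{finite,wellorder}) = (\<Prod>i\<in>UNIV. cos (pi * x $ i / 2)) * fact CARD('n)"
  using cos_plus_shift[OF zero_in_P_plus, of x] by (simp add: real_vec_0 card_permutations[OF refl finite])

lemma J_I_minus_eval:
  "mpoly_eval J_I_minus (elem_map y) = (det (\<chi> i j. poly (cheb1 (delta j)) (y $ i)))\<^sup>2"
  unfolding J_I_minus_def
  by (rule the_mpoly_eval[OF alternant_squared_sym interior_subset]) (simp add: cos_minus_rho1)

lemma J_III_minus_eval:
  "mpoly_eval J_III_minus (elem_map y) = half_weight y * (det (\<chi> i j. poly (cheb3 (delta j)) (y $ i)))\<^sup>2"
  unfolding J_III_minus_def
  by (rule the_mpoly_eval[OF sym_polys_mult[OF half_weight_sym alternant_squared_sym] interior_subset])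
     (simp add: cos_minus_rho2 power_mult_distrib half_weight_cos_vec)

lemma J_III_plus_eval:
  "mpoly_eval J_III_plus (elem_map (y :: real^'n::{finite,wellorder})) = half_weight y * (fact CARD('n))\<^sup>2"
  unfolding J_III_plus_def
  by (rule the_mpoly_eval[OF sym_polys_mult[OF half_weight_sym sym_polys_const] interior_subset])
     (simp add: cos_plus_rho power_mult_distrib half_weight_cos_vec)

section \<open>Univariate quadrature\<close>

definition quadrature_exact :: "nat \<Rightarrow> real \<Rightarrow> (nat \<Rightarrow> real) \<Rightarrow> real poly set" where
  "quadrature_exact N c s =
     {q. integral {0..1} (\<lambda>x. poly q (cos (pi * x))) = c * (\<Sum>r<N. poly q (cos (pi * s r)))}"

text \<open>The degrees of the Chebyshev polynomials are exact, so leading terms can be split off one by one.\<close>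

lemma cheb_expansion:
  "degree q \<le> d \<Longrightarrow> \<exists>a. q = (\<Sum>k\<le>d. smult (a k) (cheb1 k))"
proof (induction d arbitrary: q)
  case 0
  then show ?case by (auto elim!: degree_eq_zeroE)
next
  case (Suc d)
  define T where "T = cheb1 (Suc d)"
  have T: "degree T \<le> Suc d" "coeff T (Suc d) > 0"
    using cheb_degree[of "[:0, 1:]" "Suc d"] by (auto simp: T_def)
  define l where "l = coeff q (Suc d) / coeff T (Suc d)"
  have "degree (q - smult l T) \<le> d"
  proof (rule degree_le, intro allI impI)
    fix i assume "i > d"
    then consider "i = Suc d" | "i > Suc d" by linarith
    then show "coeff (q - smult l T) i = 0"
    proof cases
      case 1
      then show ?thesis using T by (simp add: l_def)
    next
      case 2
      then show ?thesis using T(1) Suc.prems by (simp add: coeff_eq_0)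
    qed
  qed
  then obtain a where a: "q - smult l T = (\<Sum>k\<le>d. smult (a k) (cheb1 k))" using Suc.IH by blast
  have "q = (\<Sum>k\<le>Suc d. smult ((a(Suc d := l)) k) (cheb1 k))"
    using a by (simp add: T_def algebra_simps)
  then show ?case by blast
qed

lemma integral_cos_int:
  "((\<lambda>x. cos (real k * (pi * x))) has_integral (if k = 0 then 1 else 0)) {0..1}"
proof (cases "k = 0")
  case True
  then show ?thesis using has_integral_const_real[of "1::real" 0 1] by simp
next
  case False
  have "((\<lambda>x. cos (real k * (pi * x))) has_integral
     (sin (real k * (pi * 1)) / (real k * pi) - sin (real k * (pi * 0)) / (real k * pi))) {0..1}"
    by (rule fundamental_theorem_of_calculus)
       (use False in \<open>auto intro!: derivative_eq_intros simp: has_real_derivative_iff_has_vector_derivative[symmetric]\<close>)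
  then show ?thesis using False by simp
qed

lemma integral_poly_cos:
  "integral {0..1} (\<lambda>x. poly (\<Sum>k\<le>d. smult (a k) (cheb1 k)) (cos (pi * x))) = a 0"
proof -
  have "((\<lambda>x. \<Sum>k\<le>d. a k * cos (real k * (pi * x))) has_integral (\<Sum>k\<le>d. a k * (if k = 0 then 1 else 0))) {0..1}"
    by (intro has_integral_sum has_integral_mult_right integral_cos_int) auto
  then have "((\<lambda>x. \<Sum>k\<le>d. a k * cos (real k * (pi * x))) has_integral a 0) {0..1}"
    by (simp add: if_distrib[of "\<lambda>c. _ * c"] cong: if_cong)
  then show ?thesis by (intro integral_unique) (simp add: poly_sum cheb_first_kind)
qed

text \<open>Multiplication by \<open>2 * sin t\<close> makes the sum telescope.\<close>

lemma sum_cos_odd: "2 * sin t * (\<Sum>r<N. cos ((2 * real r + 1) * t)) = sin (2 * real N * t)"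
proof (induction N)
  case (Suc N)
  have "sin ((2 * real N + 1) * t + t) - sin ((2 * real N + 1) * t - t) = 2 * sin t * cos ((2 * real N + 1) * t)"
    by (simp add: sin_add sin_diff)
  then show ?case using Suc by (simp add: algebra_simps)
qed simp

lemma sin_npi_frac_nonzero:
  assumes "0 < k" "k < m" shows "sin (real k * pi / real m) \<noteq> 0"
proof -
  have "0 < real k * pi / real m" "real k * pi / real m < pi"
    using assms by (auto simp: field_simps)
  then have "sin (real k * pi / real m) > 0" by (rule sin_gt_zero)
  then show ?thesis by simp
qed

text \<open>The midpoint sum of the cosine of frequency \<open>k\<close> has the numerator \<open>sin (k * pi)\<close>, and its denominator
  \<open>sin (k * pi / (2 * N))\<close> does not vanish for \<open>0 < k < 2 * N\<close>.\<close>

lemma quadrature_midpoints: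
  assumes "N \<ge> 1"
  shows "deg_le (2 * N - 1) \<subseteq> quadrature_exact N (1 / real N) (\<lambda>r. (real r + 1/2) / real N)"
proof
  fix q assume "q \<in> deg_le (2 * N - 1)"
  then obtain a where q: "q = (\<Sum>k\<le>2 * N - 1. smult (a k) (cheb1 k))"
    using cheb_expansion by (auto simp: deg_le_def)
  have sum: "(\<Sum>r<N. cos (real k * (pi * ((real r + 1/2) / real N)))) = (if k = 0 then real N else 0)"
    if "k \<le> 2 * N - 1" for k
  proof (cases "k = 0")
    case False
    have "real k * (pi * ((real r + 1/2) / real N)) = (2 * real r + 1) * (real k * pi / real (2 * N))" for r
      by (simp add: field_simps)
    then have "2 * sin (real k * pi / real (2 * N)) * (\<Sum>r<N. cos (real k * (pi * ((real r + 1/2) / real N))))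
      = sin (2 * real N * (real k * pi / real (2 * N)))" by (simp only: sum_cos_odd)
    also have "2 * real N * (real k * pi / real (2 * N)) = real k * pi" using assms by simp
    finally show ?thesis using False that assms sin_npi_frac_nonzero[of k "2 * N"] by simp
  qed simp
  have "(\<Sum>r<N. poly q (cos (pi * ((real r + 1/2) / real N))))
    = (\<Sum>k\<le>2 * N - 1. a k * (\<Sum>r<N. cos (real k * (pi * ((real r + 1/2) / real N)))))"
    unfolding q by (simp add: poly_sum cheb_first_kind sum_distrib_left) (rule sum.swap)
  also have "\<dots> = a 0 * real N"
    using sum by (simp add: if_distrib[of "\<lambda>c. _ * c"] cong: if_cong)
  finally show "q \<in> quadrature_exact N (1 / real N) (\<lambda>r. (real r + 1/2) / real N)"
    using assms unfolding quadrature_exact_def mem_Collect_eq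
    by (subst q, subst integral_poly_cos) simp
qed

text \<open>This is the rule with the further node \<open>x = 1\<close>, which carries half the weight of the others; since
  \<open>cos pi = - 1\<close>, a root of \<open>q\<close> at \<open>- 1\<close> removes it.\<close>

lemma quadrature_third_kind:
  shows "{q. degree q \<le> 2 * N \<and> poly q (- 1) = 0}
    \<subseteq> quadrature_exact N (2 / (2 * real N + 1)) (\<lambda>r. 2 * (real r + 1/2) / (2 * real N + 1))"
proof safe
  fix q :: "real poly" assume deg: "degree q \<le> 2 * N" and root: "poly q (- 1) = 0"
  then obtain a where q: "q = (\<Sum>k\<le>2 * N. smult (a k) (cheb1 k))"
    using cheb_expansion by blast
  let ?s = "\<lambda>r. 2 * (real r + 1/2) / (2 * real N + 1)"
  have sum: "(\<Sum>r<N. cos (real k * (pi * ?s r))) = (if k = 0 then real N + 1/2 else 0) - cos (real k * pi) / 2"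
    if "k \<le> 2 * N" for k
  proof (cases "k = 0")
    case False
    let ?t = "real k * pi / real (2 * N + 1)"
    have "real k * (pi * ?s r) = (2 * real r + 1) * ?t" for r
      by (simp add: field_simps)
    then have "2 * sin ?t * (\<Sum>r<N. cos (real k * (pi * ?s r))) = sin (2 * real N * ?t)"
      by (simp only: sum_cos_odd)
    also have "2 * real N * ?t = real k * pi - ?t" by (simp add: field_simps)
    also have "sin (real k * pi - ?t) = - cos (real k * pi) * sin ?t" by (simp add: sin_diff)
    finally have "sin ?t * (2 * (\<Sum>r<N. cos (real k * (pi * ?s r))) + cos (real k * pi)) = 0"
      by (simp add: algebra_simps)
    then show ?thesis using False that sin_npi_frac_nonzero[of k "2 * N + 1"] by simp
  qed simp
  have "poly q (cos pi) = (\<Sum>k\<le>2 * N. a k * cos (real k * pi))"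
    unfolding q by (simp only: poly_sum poly_smult cheb_first_kind)
  then have alt: "(\<Sum>k\<le>2 * N. a k * cos (real k * pi)) = 0" using root by simp
  have "(\<Sum>r<N. poly q (cos (pi * ?s r))) = (\<Sum>k\<le>2 * N. a k * (\<Sum>r<N. cos (real k * (pi * ?s r))))"
    unfolding q by (simp add: poly_sum cheb_first_kind sum_distrib_left del: times_divide_eq_right) (rule sum.swap)
  also have "\<dots> = (\<Sum>k\<le>2 * N. a k * (if k = 0 then real N + 1/2 else 0) - a k * cos (real k * pi) / 2)"
    using sum by (intro sum.cong) (auto simp: right_diff_distrib)
  also have "\<dots> = a 0 * (real N + 1/2) - (\<Sum>k\<le>2 * N. a k * cos (real k * pi)) / 2"
    by (simp add: sum_subtractf sum_divide_distrib if_distrib[of "\<lambda>c. _ * c"] cong: if_cong)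
  finally have "(\<Sum>r<N. poly q (cos (pi * ?s r))) = a 0 * (real N + 1/2)" using alt by simp
  moreover have "2 / (2 * real N + 1) * (a 0 * (real N + 1/2)) = a 0" by (simp add: field_simps)
  moreover have "integral {0..1} (\<lambda>x. poly q (cos (pi * x))) = a 0"
    unfolding q by (rule integral_poly_cos)
  ultimately show "q \<in> quadrature_exact N (2 / (2 * real N + 1)) ?s"
    unfolding quadrature_exact_def by simp
qed

section \<open>Integrals over the cube and over the fundamental domain\<close>

definition unit_cube :: "(real^'n::finite) set" where
  "unit_cube = {x. \<forall>i. 0 \<le> x $ i \<and> x $ i \<le> 1}"

lemma unit_cube_eq_cbox: "unit_cube = cbox 0 1"
  by (auto simp: unit_cube_def mem_box_cart)

lemma compact_unit_cube: "compact unit_cube"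
  by (simp add: unit_cube_eq_cbox)

lemma integral_lborel_prod:
  fixes f :: "'n::finite \<Rightarrow> real \<Rightarrow> real"
  assumes "\<And>i. integrable lborel (f i)"
  shows "(\<integral>x. (\<Prod>i\<in>UNIV. f i (x $ i)) \<partial>lborel) = (\<Prod>i\<in>UNIV. \<integral>t. f i t \<partial>lborel)"
proof -
  define ix where "ix b = (THE i. b = axis i (1::real))" for b :: "real^'n"
  have ix: "ix (axis i 1) = i" for i unfolding ix_def by (rule the_equality) (auto simp: axis_eq_axis)
  have inj: "inj (\<lambda>i::'n. axis i (1::real))" by (auto simp: inj_def axis_eq_axis)
  have Basis: "(Basis :: (real^'n) set) = range (\<lambda>i. axis i 1)" by (auto simp: Basis_vec_def)
  interpret product_sigma_finite "\<lambda>_::real^'n. lborel :: real measure" ..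
  have meas: "(\<lambda>x. \<Prod>b\<in>(Basis :: (real^'n) set). f (ix b) (x \<bullet> b)) \<in> borel_measurable borel"
  proof (rule borel_measurable_prod)
    fix b :: "real^'n"
    have "f (ix b) \<in> borel_measurable borel" using borel_measurable_integrable[OF assms] by simp
    then show "(\<lambda>x. f (ix b) (x \<bullet> b)) \<in> borel_measurable borel" by measurable
  qed
  have "(\<integral>x. (\<Prod>i\<in>UNIV. f i (x $ i)) \<partial>lborel) = (\<integral>x. (\<Prod>b\<in>(Basis :: (real^'n) set). f (ix b) (x \<bullet> b)) \<partial>lborel)"
    unfolding Basis by (subst prod.reindex[OF inj]) (simp add: ix inner_axis)
  also have "\<dots> = (\<integral>y. (\<Prod>b\<in>(Basis :: (real^'n) set). f (ix b) (y b)) \<partial>(\<Pi>\<^sub>M b\<in>(Basis :: (real^'n) set). lborel))"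
    by (subst lborel_eq, subst integral_distr) (use meas in simp_all)
  also have "\<dots> = (\<Prod>b\<in>(Basis :: (real^'n) set). \<integral>t. f (ix b) t \<partial>lborel)"
    by (rule product_integral_prod) (auto intro: assms)
  also have "\<dots> = (\<Prod>i\<in>UNIV. \<integral>t. f i t \<partial>lborel)"
    unfolding Basis by (subst prod.reindex[OF inj]) (simp add: ix)
  finally show ?thesis .
qed

lemma set_integrable_continuous_compact:
  fixes f :: "'a::euclidean_space \<Rightarrow> real"
  assumes "compact S" "continuous_on UNIV f" shows "set_integrable lborel S f"
  unfolding set_integrable_def
  using borel_integrable_compact[OF assms(1) continuous_on_subset[OF assms(2) subset_UNIV]] by (simp add: indicator_def if_distrib cong: if_cong)

lemma integral_unit_cube_prod:
  fixes f :: "'n::finite \<Rightarrow> real \<Rightarrow> real"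
  assumes "\<And>i. continuous_on UNIV (f i)"
  shows "integral unit_cube (\<lambda>x. \<Prod>i\<in>UNIV. f i (x $ i)) = (\<Prod>i\<in>UNIV. integral {0..1} (f i))"
proof -
  have int: "set_integrable lborel {0..1} (f i)" for i
    using assms by (intro set_integrable_continuous_compact) auto
  have "continuous_on UNIV (\<lambda>x::real^'n. \<Prod>i\<in>UNIV. f i (x $ i))"
    by (intro continuous_intros continuous_on_compose2[OF assms]) auto
  then have "integral unit_cube (\<lambda>x. \<Prod>i\<in>UNIV. f i (x $ i))
     = (LINT x:unit_cube|lborel. \<Prod>i\<in>UNIV. f i (x $ i))"
    by (intro set_borel_integral_eq_integral(2)[symmetric] set_integrable_continuous_compact compact_unit_cube)
  also have "\<dots> = (\<integral>x. (\<Prod>i\<in>UNIV. indicator {0..1} (x $ i) * f i (x $ i)) \<partial>lborel)"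
  proof -
    have "indicator unit_cube x = (\<Prod>i\<in>UNIV. indicator {0..1} (x $ i) :: real)" for x :: "real^'n"
      by (auto simp: unit_cube_def indicator_def)
    then show ?thesis unfolding set_lebesgue_integral_def by (simp add: prod.distrib)
  qed
  also have "\<dots> = (\<Prod>i\<in>UNIV. \<integral>t. indicator {0..1} t * f i t \<partial>lborel)"
    by (rule integral_lborel_prod) (use int in \<open>simp add: set_integrable_def\<close>)
  also have "\<dots> = (\<Prod>i\<in>UNIV. integral {0..1} (f i))"
    using set_borel_integral_eq_integral(2)[OF int] by (simp add: set_lebesgue_integral_def)
  finally show ?thesis .
qed

lemma continuous_cos_vec_comp:
  "continuous_on UNIV h \<Longrightarrow> continuous_on UNIV (\<lambda>x. h (cos_vec x))"
  by (rule continuous_on_compose2[OF _ cos_vec_continuous]) auto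

lemma integrable_unit_cube:
  "continuous_on UNIV (h :: real^'n::finite \<Rightarrow> real) \<Longrightarrow> h integrable_on unit_cube"
  by (intro set_borel_integral_eq_integral(1) set_integrable_continuous_compact compact_unit_cube)

definition int_grid :: "nat \<Rightarrow> (int^'n::finite) set" where
  "int_grid N = {r. \<forall>i. 0 \<le> r $ i \<and> r $ i < int N}"

lemma int_grid_eq: "int_grid N = (\<lambda>g. \<chi> i. int (g i)) ` (UNIV \<rightarrow>\<^sub>E {..<N})"
proof safe
  fix r :: "int^'n" assume r: "r \<in> int_grid N"
  then have "r = (\<chi> i. int (nat (r $ i)))" by (simp add: int_grid_def)
  moreover have "(\<lambda>i. nat (r $ i)) \<in> UNIV \<rightarrow>\<^sub>E {..<N}" using r by (auto simp: int_grid_def nat_less_iff)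
  ultimately show "r \<in> (\<lambda>g. \<chi> i. int (g i)) ` (UNIV \<rightarrow>\<^sub>E {..<N})" by (rule image_eqI)
qed (auto simp: int_grid_def PiE_def Pi_def)

lemma finite_int_grid: "finite (int_grid N)"
  unfolding int_grid_eq by (intro finite_imageI finite_PiE) auto

lemma integral_unit_cube_prodsums:
  fixes h :: "real^'n::finite \<Rightarrow> real"
  assumes "h \<in> prodsums G" and G: "G \<subseteq> quadrature_exact N c s"
  shows "integral unit_cube (\<lambda>x. h (cos_vec x))
    = c ^ CARD('n) * (\<Sum>r\<in>int_grid N. h (cos_vec (\<chi> i. s (nat (r $ i)))))"
  using assms(1)
proof induction
  case (prod q)
  have inj: "inj_on (\<lambda>g. \<chi> i. int (g i) :: int^'n) (UNIV \<rightarrow>\<^sub>E {..<N})"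
    by (auto simp: inj_on_def vec_eq_iff fun_eq_iff)
  have "integral unit_cube (\<lambda>x::real^'n. \<Prod>i\<in>UNIV. poly (q i) (cos_vec x $ i))
    = (\<Prod>i\<in>UNIV. integral {0..1} (\<lambda>t. poly (q i) (cos (pi * t))))"
    unfolding cos_vec_def vec_lambda_beta
    by (rule integral_unit_cube_prod) (intro continuous_intros)
  also have "\<dots> = (\<Prod>i\<in>UNIV. c * (\<Sum>r<N. poly (q i) (cos (pi * s r))))"
    using prod G by (intro prod.cong) (auto simp: quadrature_exact_def)
  also have "\<dots> = c ^ CARD('n) * (\<Prod>i\<in>UNIV. \<Sum>r<N. poly (q i) (cos (pi * s r)))"
    by (simp add: prod.distrib)
  also have "(\<Prod>i\<in>UNIV. \<Sum>r<N. poly (q i) (cos (pi * s r)))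
    = (\<Sum>g\<in>UNIV \<rightarrow>\<^sub>E {..<N}. \<Prod>i\<in>UNIV. poly (q i) (cos (pi * s (g i))))"
    by (rule prod_sum_PiE) auto
  also have "\<dots> = (\<Sum>r\<in>int_grid N. \<Prod>i\<in>UNIV. poly (q i) (cos_vec (\<chi> i. s (nat (r $ i))) $ i))"
    unfolding int_grid_eq by (subst sum.reindex[OF inj]) (simp add: cos_vec_def)
  finally show ?case .
next
  case (add f g)
  have "(\<lambda>x. f (cos_vec x)) integrable_on unit_cube" "(\<lambda>x. g (cos_vec x)) integrable_on unit_cube"
    using add(1,2)[THEN prodsums_continuous, THEN continuous_cos_vec_comp, THEN integrable_unit_cube]
    by simp_all
  then show ?case using add by (simp add: integral_add sum.distrib distrib_left)
qed simp

lemma lborel_distr_permute_vec: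
  assumes "\<sigma> permutes UNIV"
  shows "distr lborel borel (permute_vec \<sigma>) = (lborel :: (real^'n) measure)"
proof (rule lborel_eqI[symmetric])
  fix l u :: "real^'n" assume le: "\<And>b. b \<in> Basis \<Longrightarrow> l \<bullet> b \<le> u \<bullet> b"
  have le': "l $ i \<le> u $ i" for i using le[of "axis i 1"] by (simp add: axis_in_Basis_iff inner_axis)
  have meas: "permute_vec \<sigma> \<in> borel_measurable (lborel :: (real^'n) measure)"
    unfolding permute_vec_def by (simp, intro borel_measurable_continuous_onI continuous_intros)
  have "permute_vec \<sigma> -` box l u = box (permute_vec (inv \<sigma>) l) (permute_vec (inv \<sigma>) u)"
  proof (intro set_eqI iffI)
    fix x assume "x \<in> permute_vec \<sigma> -` box l u"
    then have "l $ i < x $ \<sigma> i \<and> x $ \<sigma> i < u $ i" for i by (auto simp: mem_box_cart permute_vec_def)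
    from this[of "inv \<sigma> _"] show "x \<in> box (permute_vec (inv \<sigma>) l) (permute_vec (inv \<sigma>) u)"
      by (simp add: mem_box_cart permute_vec_def permutes_inverses[OF assms])
  next
    fix x assume "x \<in> box (permute_vec (inv \<sigma>) l) (permute_vec (inv \<sigma>) u)"
    then have "l $ inv \<sigma> i < x $ i \<and> x $ i < u $ inv \<sigma> i" for i by (auto simp: mem_box_cart permute_vec_def)
    from this[of "\<sigma> _"] show "x \<in> permute_vec \<sigma> -` box l u"
      by (simp add: mem_box_cart permute_vec_def permutes_inverses[OF assms])
  qed
  then have "emeasure (distr lborel borel (permute_vec \<sigma>)) (box l u)
     = emeasure lborel (box (permute_vec (inv \<sigma>) l) (permute_vec (inv \<sigma>) u))"
    using meas by (subst emeasure_distr) auto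
  also have "\<dots> = (\<Prod>b\<in>Basis. (permute_vec (inv \<sigma>) u - permute_vec (inv \<sigma>) l) \<bullet> b)"
    using le' by (intro emeasure_lborel_box) (auto simp: Basis_vec_def inner_axis permute_vec_def)
  also have "(\<Prod>b\<in>Basis. (permute_vec (inv \<sigma>) u - permute_vec (inv \<sigma>) l) \<bullet> b) = (\<Prod>i\<in>UNIV. u $ inv \<sigma> i - l $ inv \<sigma> i)"
  proof -
    have "(Basis :: (real^'n) set) = range (\<lambda>i. axis i 1)" by (auto simp: Basis_vec_def)
    then show ?thesis
      by (subst prod.reindex_bij_betw[of "\<lambda>i. axis i 1" UNIV, symmetric])
         (auto simp: bij_betw_def inj_def axis_eq_axis inner_axis permute_vec_def)
  qed
  also have "\<dots> = (\<Prod>i\<in>UNIV. u $ i - l $ i)"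
    by (rule prod.reindex_bij_witness[of _ \<sigma> "inv \<sigma>"]) (auto simp: permutes_inverses[OF assms])
  also have "\<dots> = (\<Prod>b\<in>Basis. (u - l) \<bullet> b)"
  proof -
    have "(Basis :: (real^'n) set) = range (\<lambda>i. axis i 1)" by (auto simp: Basis_vec_def)
    then show ?thesis
      by (subst prod.reindex_bij_betw[of "\<lambda>i. axis i 1" UNIV, symmetric])
         (auto simp: bij_betw_def inj_def axis_eq_axis inner_axis)
  qed
  finally show "emeasure (distr lborel borel (permute_vec \<sigma>)) (box l u) = ennreal (\<Prod>b\<in>Basis. (u - l) \<bullet> b)" .
qed simp

lemma AE_inj_vec: "AE x in lborel. inj (($) (x :: real^'n::finite))"
proof -
  have "AE x in lborel. i \<noteq> j \<longrightarrow> x $ i \<noteq> (x :: real^'n) $ j" for i j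
  proof (cases "i = j")
    case False
    let ?a = "axis i 1 - axis j 1 :: real^'n"
    have "?a \<noteq> 0" using False by (simp add: axis_eq_axis)
    then have "{x. ?a \<bullet> x = 0} \<in> null_sets lebesgue"
      using negligible_hyperplane[of ?a 0] by (simp add: negligible_iff_null_sets)
    moreover have "{x. ?a \<bullet> x = 0} = {x. x $ i = x $ j}"
      by (simp add: inner_diff_left inner_axis')
    ultimately have "AE x in lebesgue. \<not> (x :: real^'n) $ i = x $ j"
      by (intro AE_I'[of "{x. ?a \<bullet> x = 0}"]) auto
    then show ?thesis unfolding AE_completion_iff by eventually_elim auto
  qed simp
  then have "AE x in lborel. \<forall>i j. i \<noteq> j \<longrightarrow> x $ i \<noteq> (x :: real^'n) $ j"
    by (intro eventually_all_finite) auto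
  then show ?thesis by eventually_elim (auto simp: inj_def)
qed

lemma F_dom_eq: "F_dom = unit_cube \<inter> sorted_vecs"
  by (auto simp: F_dom_def unit_cube_def sorted_vecs_def antimono_def)

lemma closed_F_dom: "closed (F_dom :: (real^'n::{finite,wellorder}) set)"
proof -
  have "F_dom = (\<Inter>i. {x. 0 \<le> x $ i} \<inter> {x. x $ i \<le> 1}) \<inter> (\<Inter>i. \<Inter>j\<in>{i..}. {x::real^'n::_. x $ j \<le> x $ i})"
    by (auto simp: F_dom_def)
  also have "closed \<dots>"
    by (intro closed_Int closed_INT ballI closed_Collect_le continuous_intros)
  finally show ?thesis .
qed

lemma compact_F_dom: "compact (F_dom :: (real^'n::{finite,wellorder}) set)"
  using closed_F_dom compact_unit_cube by (metis F_dom_eq Int_lower1 Int_absorb1 compact_Int_closed)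

lemma convex_F_dom: "convex (F_dom :: (real^'n::{finite,wellorder}) set)"
proof (rule convexI)
  fix x y :: "real^'n::_" and u v :: real
  assume xy: "x \<in> F_dom" "y \<in> F_dom" and uv: "0 \<le> u" "0 \<le> v" "u + v = 1"
  have "u * x $ i + v * y $ i \<le> 1" for i
    using xy uv convex_bound_le[of "x $ i" 1 "y $ i" u v] by (simp add: F_dom_def)
  moreover have "u * x $ j + v * y $ j \<le> u * x $ i + v * y $ i" if "i \<le> j" for i j
    using xy uv that by (intro add_mono mult_left_mono) (auto simp: F_dom_def)
  ultimately show "u *\<^sub>R x + v *\<^sub>R y \<in> F_dom"
    using xy uv by (simp add: F_dom_def)
qed

lemma negligible_F_dom_boundary:
  "negligible (F_dom - interior F_dom :: (real^'n::{finite,wellorder}) set)"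
  by (metis closed_F_dom closure_closed convex_F_dom frontier_def negligible_convex_frontier)

text \<open>Almost every point is sorted by exactly one permutation, and rearranging preserves volumes.\<close>

lemma integral_unit_cube_symmetric:
  fixes h :: "real^'n::{finite,wellorder} \<Rightarrow> real"
  assumes cont: "continuous_on UNIV h" and sym: "\<And>\<sigma> x. \<sigma> permutes UNIV \<Longrightarrow> h (permute_vec \<sigma> x) = h x"
  shows "integral unit_cube h = fact CARD('n) * integral F_dom h"
proof -
  let ?P = "{\<sigma>. \<sigma> permutes (UNIV :: 'n set)}"
  define u where "u x = indicator F_dom x * h x" for x
  have intF: "set_integrable lborel F_dom h" and intC: "set_integrable lborel unit_cube h"
    by (auto intro: set_integrable_continuous_compact compact_F_dom compact_unit_cube cont)
  then have int: "integrable lborel u" by (simp add: set_integrable_def u_def[abs_def])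
  have meas: "permute_vec \<sigma> \<in> borel_measurable (lborel :: (real^'n::_) measure)" for \<sigma>
    unfolding permute_vec_def by (simp, intro borel_measurable_continuous_onI continuous_intros)
  have inv: "integrable lborel (\<lambda>x. u (permute_vec \<sigma> x))" "(\<integral>x. u (permute_vec \<sigma> x) \<partial>lborel) = integral\<^sup>L lborel u"
    if "\<sigma> \<in> ?P" for \<sigma>
    using that int integrable_distr[of "permute_vec \<sigma>" lborel borel u] meas
      integral_distr[of "permute_vec \<sigma>" lborel borel u] lborel_distr_permute_vec[of \<sigma>]
    by (auto simp: borel_measurable_integrable[OF int, simplified])
  have "AE x in lborel. indicator unit_cube x * h x = (\<Sum>\<sigma>\<in>?P. u (permute_vec \<sigma> x))"
    using AE_inj_vec
  proof eventually_elim
    fix x :: "real^'n::_" assume inj: "inj (($) x)"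
    have "u (permute_vec \<sigma> x) = indicator unit_cube x * h x * indicator sorted_vecs (permute_vec \<sigma> x)"
      if "\<sigma> permutes UNIV" for \<sigma>
    proof -
      have "(\<forall>i. 0 \<le> x $ \<sigma> i \<and> x $ \<sigma> i \<le> 1) \<longleftrightarrow> (\<forall>i. 0 \<le> x $ i \<and> x $ i \<le> 1)"
        using permutes_surj[OF that] by (metis surjD)
      then have "permute_vec \<sigma> x \<in> unit_cube \<longleftrightarrow> x \<in> unit_cube"
        by (simp add: unit_cube_def permute_vec_def)
      then show ?thesis using sym[OF that] by (simp add: u_def F_dom_eq indicator_inter_arith) (simp add: indicator_def)
    qed
    then have "(\<Sum>\<sigma>\<in>?P. u (permute_vec \<sigma> x))
      = indicator unit_cube x * h x * (\<Sum>\<sigma>\<in>?P. indicator sorted_vecs (permute_vec \<sigma> x))"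
      by (simp add: sum_distrib_left)
    then show "indicator unit_cube x * h x = (\<Sum>\<sigma>\<in>?P. u (permute_vec \<sigma> x))"
      using sum_indicator_sorted_vecs[of x] vec_stab_inj[OF inj] by simp
  qed
  then have "(\<integral>x. indicator unit_cube x * h x \<partial>lborel) = (\<integral>x. (\<Sum>\<sigma>\<in>?P. u (permute_vec \<sigma> x)) \<partial>lborel)"
    by (rule integral_cong_AE[rotated 2])
       (use intC inv in \<open>auto simp: set_integrable_def intro!: borel_measurable_integrable\<close>)
  also have "\<dots> = fact CARD('n) * integral\<^sup>L lborel u"
    by (subst Bochner_Integration.integral_sum) (simp_all add: inv card_permutations[OF refl finite])
  finally show ?thesis
    using set_borel_integral_eq_integral(2)[OF intF] set_borel_integral_eq_integral(2)[OF intC]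
    by (simp add: set_lebesgue_integral_def u_def[abs_def])
qed

section \<open>Dimensions and numbers of nodes\<close>

definition exponents_le :: "int \<Rightarrow> ('n::finite \<Rightarrow>\<^sub>0 nat) set" where
  "exponents_le d = {m. int (\<Sum>i\<in>UNIV. Poly_Mapping.lookup m i) \<le> d}"

lemma lookup_mpoly_scale: "Poly_Mapping.lookup (mpoly_scale c p) m = c * Poly_Mapping.lookup p m"
  by (simp add: mpoly_scale_def Poly_Mapping.map.rep_eq when_def)

text \<open>The monomials form a basis.\<close>

lemma dim_mpolys_le:
  "mpoly.dim (mpolys_le d :: 'n::finite mpoly set) = card (exponents_le d :: ('n \<Rightarrow>\<^sub>0 nat) set)"
proof (rule mpoly.dim_unique)
  let ?s = "\<lambda>m :: 'n \<Rightarrow>\<^sub>0 nat. Poly_Mapping.single m (1::real)"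
  let ?B = "?s ` exponents_le d"
  show "?B \<subseteq> mpolys_le d" by (auto simp: mpolys_le_def exponents_le_def)
  show "mpolys_le d \<subseteq> mpoly.span ?B"
  proof
    fix p :: "'n mpoly" assume p: "p \<in> mpolys_le d"
    have single: "Poly_Mapping.single m c = mpoly_scale c (?s m)" for m c
      by (rule poly_mapping_eqI) (simp add: lookup_mpoly_scale lookup_single when_def)
    have "p = (\<Sum>m\<in>Poly_Mapping.keys p. mpoly_scale (Poly_Mapping.lookup p m) (?s m))"
      unfolding single[symmetric] by (rule poly_mapping_sum_single)
    moreover have "(\<Sum>m\<in>Poly_Mapping.keys p. mpoly_scale (Poly_Mapping.lookup p m) (?s m)) \<in> mpoly.span ?B"
      using p by (intro mpoly.span_sum mpoly.span_scale mpoly.span_base) (auto simp: mpolys_le_def exponents_le_def)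
    ultimately show "p \<in> mpoly.span ?B" by metis
  qed
  have inj: "inj ?s"
    by (rule injI) (metis lookup_single_eq lookup_single_not_eq zero_neq_one)
  show "card ?B = card (exponents_le d :: ('n \<Rightarrow>\<^sub>0 nat) set)"
    by (rule card_image[OF inj_on_subset[OF inj subset_UNIV]])
  show "mpoly.independent ?B"
    unfolding mpoly.independent_explicit_module
  proof (intro allI impI)
    fix t :: "'n mpoly set" and u v
    assume t: "finite t" "t \<subseteq> ?B" "(\<Sum>w\<in>t. mpoly_scale (u w) w) = 0" "v \<in> t"
    then obtain m where m: "v = ?s m" by blast
    have "Poly_Mapping.lookup w m = (if w = v then 1 else 0)" if "w \<in> t" for w
      using t(2) that inj unfolding m by (auto simp: lookup_single when_def inj_eq)
    then have "Poly_Mapping.lookup (\<Sum>w\<in>t. mpoly_scale (u w) w) m = u v"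
      using t(1,4) by (simp add: lookup_sum lookup_mpoly_scale if_distrib[of "\<lambda>c. _ * c"] cong: if_cong)
    then show "u v = 0" using t(3) by simp
  qed
qed

lemma greaterThan_eq_atLeast:
  fixes i :: "'n::{finite,wellorder}"
  assumes "{i<..} \<noteq> {}" shows "{i<..} = {Min {i<..}..}"
proof -
  have "i < Min {i<..}" using Min_in[OF _ assms] by auto
  then show ?thesis by (auto intro: Min_le order_less_le_trans)
qed

lemma delta_eq: "delta i = card {i<..}"
  by (simp add: delta_def greaterThan_def)

text \<open>The inverse of taking differences: it turns exponent vectors into nonincreasing sequences, and the
  first entry of the sequence is the total degree.\<close>

definition tail_sums :: "('n::{finite,wellorder} \<Rightarrow>\<^sub>0 nat) \<Rightarrow> int^'n::_" where
  "tail_sums m = (\<chi> i. int (\<Sum>j\<in>{i..}. Poly_Mapping.lookup m j))"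

definition decreasing_le :: "int \<Rightarrow> (int^'n::{finite,wellorder}) set" where
  "decreasing_le d = {r. (\<forall>i. 0 \<le> r $ i \<and> r $ i \<le> d) \<and> (\<forall>i j. i < j \<longrightarrow> r $ j \<le> r $ i)}"

lemma sum_atLeast_split:
  fixes f :: "'n::{finite,wellorder} \<Rightarrow> nat"
  shows "sum f {i..} = f i + (if {i<..} = {} then 0 else sum f {Min {i<..}..})"
proof -
  have "{i..} = insert i {i<..}" by auto
  then have "sum f {i..} = f i + sum f {i<..}" by simp
  then show ?thesis using greaterThan_eq_atLeast[of i] by auto
qed

lemma atLeast_Min_UNIV: "{Min UNIV..} = (UNIV :: 'n::{finite,wellorder} set)"
  by auto

lemma bij_betw_tail_sums: "bij_betw tail_sums (exponents_le d) (decreasing_le d :: (int^'n::{finite,wellorder}) set)"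
proof (rule bij_betw_imageI)
  show "inj_on tail_sums (exponents_le d :: ('n \<Rightarrow>\<^sub>0 nat) set)"
  proof (rule inj_onI)
    fix m m' :: "'n \<Rightarrow>\<^sub>0 nat" assume "tail_sums m = tail_sums m'"
    then have eq: "sum (Poly_Mapping.lookup m) {i..} = sum (Poly_Mapping.lookup m') {i..}" for i
      by (simp add: tail_sums_def vec_eq_iff del: of_nat_sum)
    have "Poly_Mapping.lookup m i = Poly_Mapping.lookup m' i" for i
      using eq[of i] eq[of "Min {i<..}"] sum_atLeast_split[of "Poly_Mapping.lookup m" i]
        sum_atLeast_split[of "Poly_Mapping.lookup m'" i] by (auto split: if_splits)
    then show "m = m'" by (rule poly_mapping_eqI)
  qed
  show "tail_sums ` exponents_le d = (decreasing_le d :: (int^'n::_) set)"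
  proof (intro subset_antisym subsetI)
    fix r :: "int^'n::_" assume "r \<in> tail_sums ` exponents_le d"
    then obtain m where m: "r = tail_sums m" "int (\<Sum>i\<in>UNIV. Poly_Mapping.lookup m i) \<le> d"
      by (auto simp: exponents_le_def)
    have "(\<Sum>j\<in>{i..}. Poly_Mapping.lookup m j) \<le> (\<Sum>j\<in>UNIV. Poly_Mapping.lookup m j)" for i
      by (rule sum_mono2) auto
    moreover have "(\<Sum>k\<in>{j..}. Poly_Mapping.lookup m k) \<le> (\<Sum>k\<in>{i..}. Poly_Mapping.lookup m k)" if "i < j" for i j
      using that by (intro sum_mono2) auto
    ultimately show "r \<in> decreasing_le d"
      using m unfolding decreasing_le_def tail_sums_def
      by (auto simp del: of_nat_sum simp: of_nat_le_iff) (meson of_nat_mono order_trans)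
  next
    fix r :: "int^'n::_" assume r: "r \<in> decreasing_le d"
    define f where "f i = nat (r $ i - (if {i<..} = {} then 0 else r $ Min {i<..}))" for i
    have f: "int (f i) = r $ i - (if {i<..} = {} then 0 else r $ Min {i<..})" for i
    proof (cases "{i<..} = {}")
      case False
      then have "i < Min {i<..}" using Min_in[OF _ False] by auto
      then show ?thesis using r False by (simp add: f_def decreasing_le_def)
    qed (use r in \<open>simp add: f_def decreasing_le_def\<close>)
    have tail: "int (sum f {i..}) = r $ i" for i
    proof (induction "delta i" arbitrary: i rule: less_induct)
      case less
      show ?case
      proof (cases "{i<..} = {}")
        case False
        then have "i < Min {i<..}" using Min_in[OF _ False] by auto
        then have "int (sum f {Min {i<..}..}) = r $ Min {i<..}" by (intro less delta_strict_antimono)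
        then show ?thesis using sum_atLeast_split[of f i] f[of i] False by simp
      qed (use sum_atLeast_split[of f i] f[of i] in simp)
    qed
    define m where "m = Abs_poly_mapping f"
    have m: "Poly_Mapping.lookup m = f" unfolding m_def by (rule lookup_Abs_poly_mapping) simp
    have "r = tail_sums m" by (simp add: tail_sums_def m tail vec_eq_iff del: of_nat_sum)
    moreover have "m \<in> exponents_le d"
      using tail[of "Min UNIV"] r unfolding atLeast_Min_UNIV by (simp add: exponents_le_def m decreasing_le_def)
    ultimately show "r \<in> tail_sums ` exponents_le d" by blast
  qed
qed

lemma card_decreasing_le:
  "card (decreasing_le d :: (int^'n::{finite,wellorder}) set) = mpoly.dim (mpolys_le d :: 'n mpoly set)"
  using bij_betw_same_card[OF bij_betw_tail_sums] by (metis dim_mpolys_le)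

lemma D_plus_eq_decreasing_le: "D_plus N = decreasing_le (int N - 1)"
  by (auto simp: D_plus_def decreasing_le_def)

text \<open>The entries are distinct integers, so the values at the positions between \<open>i\<close> and \<open>j\<close>, after \<open>i\<close>
  or before \<open>i\<close> need that much room in the respective interval. This is what makes subtracting the staircase
  \<open>delta\<close> turn strictly decreasing sequences into nonincreasing ones.\<close>

lemma D_minus_gap:
  fixes r :: "int^'n::{finite,wellorder}"
  assumes "r \<in> D_minus N"
  shows "i < j \<Longrightarrow> r $ j - int (delta j) \<le> r $ i - int (delta i)"
    and "int (delta i) \<le> r $ i" and "r $ i - int (delta i) \<le> int N - int CARD('n)"
proof -
  have r: "i < j \<Longrightarrow> r $ j < r $ i" "0 \<le> r $ i" "r $ i \<le> int N - 1" for i j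
    using assms by (auto simp: D_minus_def)
  have inj: "inj (($) r)"
    by (rule linorder_injI) (use r(1) in \<open>force\<close>)
  have inj': "inj_on (($) r) A" for A using inj by (rule inj_on_subset) simp
  {
    assume "i < j"
    have "card {i..<j} \<le> card {r $ j <.. r $ i}"
      by (rule card_inj_on_le[OF inj']) (auto simp: r(1) intro: less_imp_le[OF r(1)] simp: le_less)
    moreover have "{i<..} = {i<..j} \<union> {j<..}" using \<open>i < j\<close> by auto
    then have "delta i = card {i<..j} + delta j"
      unfolding delta_eq by (metis card_Un_disjoint finite greaterThanAtMost_iff greaterThan_iff disjoint_iff not_le)
    moreover have "card {i..<j} = card {i<..j}"
    proof -
      have "insert j {i..<j} = insert i {i<..j}" using \<open>i < j\<close> by auto
      moreover have "card (insert j {i..<j}) = Suc (card {i..<j})" "card (insert i {i<..j}) = Suc (card {i<..j})"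
        by auto
      ultimately show ?thesis by simp
    qed
    ultimately show "r $ j - int (delta j) \<le> r $ i - int (delta i)" using r(1)[OF \<open>i < j\<close>] by simp
  }
  have "card {i<..} \<le> card {0..<r $ i}"
    by (rule card_inj_on_le[OF inj']) (auto simp: r)
  then show "int (delta i) \<le> r $ i" using r(2)[of i] by (simp add: delta_eq)
  have "r $ k < int N" for k using r(3)[of k] by simp
  then have "card {..<i} \<le> card {r $ i<..int N - 1}"
    by (intro card_inj_on_le[OF inj']) (auto simp: r)
  moreover have "Suc (card {..<i}) = CARD('n) - delta i"
    unfolding card_atMost_eq[symmetric] by (simp add: lessThan_Suc_atMost ivl_disj_un_singleton(2)[symmetric])
  ultimately show "r $ i - int (delta i) \<le> int N - int CARD('n)" using r(3)[of i] delta_less_CARD[of i] by simp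
qed

lemma card_D_minus:
  "card (D_minus N :: (int^'n::{finite,wellorder}) set) = card (decreasing_le (int N - int CARD('n)) :: (int^'n::_) set)"
proof (rule bij_betw_same_card, rule bij_betw_byWitness)
  let ?f = "\<lambda>r::int^'n::_. \<chi> i. r $ i - int (delta i)" and ?g = "\<lambda>r::int^'n::_. \<chi> i. r $ i + int (delta i)"
  show "\<forall>a\<in>D_minus N. ?g (?f a) = a" "\<forall>a\<in>decreasing_le (int N - int CARD('n)). ?f (?g a) = a" by auto
  show "?f ` D_minus N \<subseteq> decreasing_le (int N - int CARD('n))"
    using D_minus_gap by (auto simp: decreasing_le_def)
  show "?g ` decreasing_le (int N - int CARD('n)) \<subseteq> D_minus N"
  proof safe
    fix r :: "int^'n::_" assume r: "r \<in> decreasing_le (int N - int CARD('n))"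
    have "r $ i + int (delta i) \<le> int N - 1" for i
    proof -
      have "r $ i \<le> int N - int CARD('n)" using r by (simp add: decreasing_le_def)
      then show ?thesis using delta_less_CARD[of i] by linarith
    qed
    moreover have "r $ j + int (delta j) < r $ i + int (delta i)" if "i < j" for i j
      using r delta_strict_antimono[OF that] that by (fastforce simp: decreasing_le_def)
    ultimately show "?g r \<in> D_minus N" using r by (simp add: D_minus_def decreasing_le_def)
  qed
qed

section \<open>The cubature formulas\<close>

text \<open>Change of variables \<open>Y = phi x\<close>: the Jacobian determinant cancels the denominator \<open>calJ\<close> of the
  weight function except on the boundary, which is a null set.\<close>

lemma integral_frakF:
  fixes H :: "real^'n::{finite,wellorder} \<Rightarrow> real"
  assumes cont: "continuous_on UNIV H"
    and u: "\<And>x. x \<in> interior F_dom \<Longrightarrow> \<bar>jac_det x\<bar> * u (phi x) = H x"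
  shows "set_integrable lebesgue frakF u" "(LINT Y:frakF|lebesgue. u Y) = integral F_dom H"
proof -
  define D where "D x = \<bar>jac_det x\<bar> * u (phi x)" for x
  have sub: "F_dom \<subseteq> (unit_cube :: (real^'n::_) set)" by (auto simp: F_dom_eq)
  have "H absolutely_integrable_on unit_cube"
    unfolding unit_cube_eq_cbox by (intro absolutely_integrable_continuous continuous_on_subset[OF cont]) auto
  then have H: "H absolutely_integrable_on F_dom"
    by (rule set_integrable_subset[OF _ _ sub]) (intro fmeasurableD lmeasurable_compact compact_F_dom)
  have DH: "D x = H x" if "x \<in> F_dom - (F_dom - interior F_dom)" for x
    using that u by (auto simp: D_def)
  have D: "D absolutely_integrable_on F_dom"
    by (rule absolutely_integrable_spike[OF H negligible_F_dom_boundary DH])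
  have DI: "integral F_dom D = integral F_dom H"
    by (rule integral_spike[OF negligible_F_dom_boundary]) (use DH in auto)
  have der: "(phi has_derivative (\<lambda>h. jacobian phi (at x) *v h)) (at x within F_dom)" for x :: "real^'n::_"
  proof -
    have "phi differentiable (at x)" using phi_has_derivative[of x UNIV] by (rule differentiableI)
    then have "(phi has_derivative (\<lambda>h. jacobian phi (at x) *v h)) (at x)" unfolding jacobian_works .
    then show ?thesis by (rule has_derivative_at_withinI)
  qed
  have "(\<lambda>x. \<bar>det (matrix (\<lambda>h. jacobian phi (at x) *v h))\<bar> *\<^sub>R (vec (u (phi x)) :: real^1)) absolutely_integrable_on F_dom
      \<and> integral F_dom (\<lambda>x. \<bar>det (matrix (\<lambda>h. jacobian phi (at x) *v h))\<bar> *\<^sub>R (vec (u (phi x)) :: real^1)) = vec (integral F_dom H)"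
    using D DI
    by (simp add: absolutely_integrable_on_1_iff integral_on_1_eq jac_det_def[symmetric] D_def[abs_def])
  then have "(\<lambda>Y. vec (u Y) :: real^1) absolutely_integrable_on (phi ` F_dom)
      \<and> integral (phi ` F_dom) (\<lambda>Y. vec (u Y) :: real^1) = vec (integral F_dom H)"
    by (subst (asm) has_absolute_integral_change_of_variables[where f = "\<lambda>Y. vec (u Y) :: real^1"])
       (auto intro: der inj_on_phi lmeasurable_compact compact_F_dom fmeasurableD)
  then show *: "set_integrable lebesgue frakF u" and "(LINT Y:frakF|lebesgue. u Y) = integral F_dom H"
    by (simp_all add: absolutely_integrable_on_1_iff integral_on_1_eq frakF_def set_lebesgue_integral_eq_integral(2) vec_eq_iff)
qed

text \<open>The nodes of both families are obtained from an increasing sequence \<open>s\<close> in the unit interval.\<close>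

definition grid_point :: "(nat \<Rightarrow> real) \<Rightarrow> int^'n \<Rightarrow> real^'n" where
  "grid_point s r = (\<chi> i. s (nat (r $ i)))"

definition node_sequence :: "nat \<Rightarrow> (nat \<Rightarrow> real) \<Rightarrow> bool" where
  "node_sequence N s \<longleftrightarrow> strict_mono s \<and> (\<forall>r<N. 0 \<le> s r \<and> s r < 1)"

lemma D_plus_eq: "D_plus N = int_grid N \<inter> sorted_vecs"
proof -
  have "antimono (($) r) \<longleftrightarrow> (\<forall>i j. i < j \<longrightarrow> r $ j \<le> r $ i)" for r :: "int^'a::{finite,wellorder}"
    unfolding antimono_def by (metis order_le_less order_refl)
  moreover have "a \<le> int N - 1 \<longleftrightarrow> a < int N" for a by linarith
  ultimately show ?thesis by (auto simp: D_plus_def int_grid_def sorted_vecs_def)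
qed

lemma D_minus_subset: "D_minus N \<subseteq> D_plus N"
  by (auto simp: D_minus_def D_plus_def less_imp_le)

lemma D_plus_inj_iff:
  fixes r :: "int^'n::{finite,wellorder}"
  shows "r \<in> D_plus N \<Longrightarrow> inj (($) r) \<longleftrightarrow> r \<in> D_minus N"
proof (rule iffI)
  assume r: "r \<in> D_plus N" and inj: "inj (($) r)"
  have "r $ j < r $ i" if "i < j" for i j
  proof -
    have "r $ j \<le> r $ i" using r that by (simp add: D_plus_def)
    moreover have "r $ j \<noteq> r $ i" using injD[OF inj, of j i] that by auto
    ultimately show ?thesis by simp
  qed
  then show "r \<in> D_minus N" using r by (simp add: D_minus_def D_plus_def)
next
  assume "r \<in> D_minus N"
  then have "r $ i \<noteq> r $ j" if "i < j" for i j
    using that unfolding D_minus_def by (metis (mono_tags, lifting) less_irrefl mem_Collect_eq)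
  then show "inj (($) r)" by (rule linorder_injI)
qed

context
  fixes N s
  assumes s: "node_sequence N s"
begin

lemma node_sequence_eq_iff: "s a = s b \<longleftrightarrow> a = b"
  using s by (metis node_sequence_def strict_mono_eq)

lemma inj_on_grid_point: "inj_on (grid_point s) (int_grid N :: (int^'n::finite) set)"
  by (rule inj_onI) (auto simp: grid_point_def int_grid_def vec_eq_iff node_sequence_eq_iff nat_eq_iff2)

lemma grid_point_in_F_dom:
  assumes "r \<in> D_plus N" shows "grid_point s r \<in> F_dom"
proof -
  have "s (nat (r $ j)) \<le> s (nat (r $ i))" if "i \<le> j" for i j
  proof -
    have "r $ j \<le> r $ i" using assms that by (auto simp: D_plus_eq sorted_vecs_def antimono_def)
    then have "nat (r $ j) \<le> nat (r $ i)" by simp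
    then show ?thesis using s by (auto simp: node_sequence_def strict_mono_less_eq)
  qed
  moreover have "0 \<le> s (nat (r $ i)) \<and> s (nat (r $ i)) \<le> 1" for i
  proof -
    have "nat (r $ i) < N" using assms by (auto simp: D_plus_eq int_grid_def nat_less_iff)
    then show ?thesis using s by (auto simp: node_sequence_def less_imp_le)
  qed
  ultimately show ?thesis by (simp add: F_dom_def grid_point_def)
qed

lemma inj_on_phi_grid: "inj_on (\<lambda>r. phi (grid_point s r)) (D_plus N)"
  using comp_inj_on[OF inj_on_subset[OF inj_on_grid_point] inj_on_subset[OF inj_on_phi], of "D_plus N"]
    grid_point_in_F_dom by (auto simp: D_plus_eq comp_def)

lemma stab_card_grid_point:
  assumes "r \<in> int_grid N" shows "stab_card (grid_point s r) = vec_stab r"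
proof -
  have "(\<chi> i. grid_point s r $ \<sigma> i) = grid_point s r \<longleftrightarrow> permute_vec \<sigma> r = r" for \<sigma>
    using assms by (auto simp: grid_point_def permute_vec_def vec_eq_iff node_sequence_eq_iff int_grid_def nat_eq_iff2)
  then show ?thesis by (simp add: stab_card_def vec_stab_def)
qed

lemma calH_phi_grid:
  assumes "r \<in> D_plus N" shows "calH (phi (grid_point s r)) = vec_stab r"
  using assms grid_point_in_F_dom[OF assms] inv_into_f_f[OF inj_on_phi grid_point_in_F_dom[OF assms]] stab_card_grid_point[of r]
  by (simp add: calH_def D_plus_eq)

text \<open>The chain of the whole argument: from \<open>frakF\<close> to \<open>F_dom\<close>, to the cube, to the full cubic grid, and
  back to the sorted grid points. Symmetry of the integrand is used in the second and the last step.\<close>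

lemma cubature_integral:
  fixes f :: "'n::{finite,wellorder} mpoly"
  assumes \<omega>: "\<And>x. x \<in> F_dom \<Longrightarrow> \<omega> (phi x) = W (cos_vec x) / calJ (phi x)"
    and W: "W \<in> sym_polys"
    and h: "(\<lambda>y. mpoly_eval f (elem_map y) * W y) \<in> prodsums G"
    and G: "G \<subseteq> quadrature_exact N c s"
  shows "set_integrable lebesgue frakF (\<lambda>Y. mpoly_eval f Y * \<omega> Y)"
    and "(LINT Y:frakF|lebesgue. mpoly_eval f Y * \<omega> Y) = c ^ CARD('n) *
      (\<Sum>r\<in>D_plus N. mpoly_eval f (phi (grid_point s r)) * W (cos_vec (grid_point s r)) / vec_stab r)"
proof -
  define g where "g y = mpoly_eval f (elem_map y) * W y" for y
  have g: "g \<in> prodsums G" "g \<in> sym_polys"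
    using h W sym_polys_mult[of "\<lambda>y. mpoly_eval f (elem_map y)" W] unfolding g_def sym_polys_def by auto
  have cont: "continuous_on UNIV (\<lambda>x. g (cos_vec x))"
    by (rule continuous_cos_vec_comp[OF prodsums_continuous[OF g(1)]])
  have cos: "cos_vec (permute_vec \<sigma> x) = permute_vec \<sigma> (cos_vec x)" for \<sigma> and x :: "real^'n::_"
    by (simp add: cos_vec_def permute_vec_def)
  have grid: "grid_point s (permute_vec \<sigma> r) = permute_vec \<sigma> (grid_point s r)" for \<sigma> and r :: "int^'n::_"
    by (simp add: grid_point_def permute_vec_def)
  have u: "\<bar>jac_det x\<bar> * (mpoly_eval f (phi x) * \<omega> (phi x)) = g (cos_vec x)" if "x \<in> interior F_dom" for x
  proof -
    have "x \<in> F_dom" using that interior_subset by blast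
    then show ?thesis using jac_det_nonzero[OF that] by (simp add: \<omega> calJ_phi g_def) (simp add: phi_eq)
  qed
  show "set_integrable lebesgue frakF (\<lambda>Y. mpoly_eval f Y * \<omega> Y)"
    by (rule integral_frakF(1)[OF cont u])
  have "(LINT Y:frakF|lebesgue. mpoly_eval f Y * \<omega> Y) = integral F_dom (\<lambda>x. g (cos_vec x))"
    by (rule integral_frakF(2)[OF cont u])
  moreover have "integral unit_cube (\<lambda>x. g (cos_vec x)) = fact CARD('n) * integral F_dom (\<lambda>x. g (cos_vec x))"
    by (rule integral_unit_cube_symmetric[OF cont]) (simp add: cos sym_polys_permute[OF g(2)])
  moreover have "integral unit_cube (\<lambda>x. g (cos_vec x))
      = c ^ CARD('n) * (\<Sum>r\<in>int_grid N. g (cos_vec (grid_point s r)))"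
    unfolding grid_point_def by (rule integral_unit_cube_prodsums[OF g(1) G])
  moreover have "(\<Sum>r\<in>int_grid N. g (cos_vec (grid_point s r)))
      = fact CARD('n) * (\<Sum>r\<in>int_grid N \<inter> sorted_vecs. g (cos_vec (grid_point s r)) / vec_stab r)"
    by (rule sum_symmetric_eq_sum_sorted)
       (auto simp: finite_int_grid grid cos sym_polys_permute[OF g(2)], auto simp: int_grid_def permute_vec_def)
  ultimately show "(LINT Y:frakF|lebesgue. mpoly_eval f Y * \<omega> Y) = c ^ CARD('n) *
      (\<Sum>r\<in>D_plus N. mpoly_eval f (phi (grid_point s r)) * W (cos_vec (grid_point s r)) / vec_stab r)"
    by (simp add: D_plus_eq g_def phi_eq)
qed

lemma cubature_plus:
  fixes \<omega> :: "real^'n::{finite,wellorder} \<Rightarrow> real"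
  assumes \<omega>: "\<And>x. x \<in> F_dom \<Longrightarrow> \<omega> (phi x) = W (cos_vec x) / calJ (phi x)"
    and W: "W \<in> sym_polys"
    and h: "\<And>f. f \<in> mpolys_le (2 * int N - 1) \<Longrightarrow> (\<lambda>y. mpoly_eval f (elem_map y) * W y) \<in> prodsums G"
    and G: "G \<subseteq> quadrature_exact N c s"
    and w: "\<And>x. x \<in> F_dom \<Longrightarrow> w (phi x) = c ^ CARD('n) * (inverse (real (calH (phi x))) * W (cos_vec x))"
  shows "optimal_gaussian_cubature frakF \<omega> (phi ` grid_point s ` D_plus N) w (int N)"
proof -
  have inj: "inj_on (\<lambda>r. phi (grid_point s r)) (D_plus N)" by (rule inj_on_phi_grid)
  have fin: "finite (D_plus N :: (int^'n::_) set)" by (simp add: D_plus_eq finite_int_grid)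
  have "(\<Sum>Y\<in>phi ` grid_point s ` D_plus N. w Y * mpoly_eval f Y)
    = c ^ CARD('n) * (\<Sum>r\<in>D_plus N. mpoly_eval f (phi (grid_point s r)) * W (cos_vec (grid_point s r)) / vec_stab r)"
    for f :: "'n mpoly"
    unfolding image_image sum.reindex[OF inj] comp_def sum_distrib_left
    by (rule sum.cong) (simp_all add: w grid_point_in_F_dom calH_phi_grid field_simps)
  then have "cubature_exact frakF \<omega> (phi ` grid_point s ` D_plus N) w (2 * int N - 1)"
    unfolding cubature_exact_def using cubature_integral[OF \<omega> W h G] fin by simp
  moreover have "card (phi ` grid_point s ` (D_plus N :: (int^'n::_) set)) = mpoly.dim (mpolys_le (int N - 1) :: 'n mpoly set)"
    unfolding image_image card_image[OF inj] by (simp add: D_plus_eq_decreasing_le card_decreasing_le)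
  ultimately show ?thesis by (simp add: optimal_gaussian_cubature_def)
qed

text \<open>A weight that vanishes at points with a repeated coordinate removes all nodes outside \<open>D_minus\<close>; the
  remaining ones have trivial stabilizer.\<close>

lemma cubature_minus:
  fixes \<omega> :: "real^'n::{finite,wellorder} \<Rightarrow> real"
  assumes \<omega>: "\<And>x. x \<in> F_dom \<Longrightarrow> \<omega> (phi x) = W (cos_vec x) / calJ (phi x)"
    and W: "W \<in> sym_polys" "\<And>y. \<not> inj (($) y) \<Longrightarrow> W y = 0"
    and h: "\<And>f. f \<in> mpolys_le (2 * (int N - int CARD('n) + 1) - 1) \<Longrightarrow> (\<lambda>y. mpoly_eval f (elem_map y) * W y) \<in> prodsums G"
    and G: "G \<subseteq> quadrature_exact N c s"
    and w: "\<And>x. x \<in> F_dom \<Longrightarrow> w (phi x) = c ^ CARD('n) * W (cos_vec x)"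
  shows "optimal_gaussian_cubature frakF \<omega> (phi ` grid_point s ` D_minus N) w (int N - int CARD('n) + 1)"
proof -
  have inj: "inj_on (\<lambda>r. phi (grid_point s r)) (D_minus N)"
    using inj_on_phi_grid D_minus_subset by (rule inj_on_subset)
  have fin: "finite (D_plus N :: (int^'n::_) set)" by (simp add: D_plus_eq finite_int_grid)
  have "(\<Sum>Y\<in>phi ` grid_point s ` D_minus N. w Y * mpoly_eval f Y)
    = c ^ CARD('n) * (\<Sum>r\<in>D_plus N. mpoly_eval f (phi (grid_point s r)) * W (cos_vec (grid_point s r)) / vec_stab r)"
    for f :: "'n mpoly"
    unfolding image_image sum.reindex[OF inj] comp_def sum_distrib_left
  proof (rule sum.mono_neutral_cong_left[OF fin D_minus_subset])
    show "\<forall>r\<in>D_plus N - D_minus N. c ^ CARD('n)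
      * (mpoly_eval f (phi (grid_point s r)) * W (cos_vec (grid_point s r)) / vec_stab r) = 0"
    proof
      fix r :: "int^'n::_" assume r: "r \<in> D_plus N - D_minus N"
      then have "\<not> inj (($) r)" using D_plus_inj_iff by blast
      then obtain i j where ij: "i \<noteq> j" "r $ i = r $ j" by (auto simp: inj_def)
      then have "cos_vec (grid_point s r) $ i = cos_vec (grid_point s r) $ j" by (simp add: cos_vec_def grid_point_def)
      then have "\<not> inj (($) (cos_vec (grid_point s r)))" using ij(1) by (auto dest: injD)
      then show "c ^ CARD('n) * (mpoly_eval f (phi (grid_point s r)) * W (cos_vec (grid_point s r)) / vec_stab r) = 0"
        using W(2) by simp
    qed
  next
    fix r :: "int^'n::_" assume r: "r \<in> D_minus N"
    then have "r \<in> D_plus N" "inj (($) r)" using D_minus_subset D_plus_inj_iff by blast+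
    then show "w (phi (grid_point s r)) * mpoly_eval f (phi (grid_point s r)) = c ^ CARD('n)
      * (mpoly_eval f (phi (grid_point s r)) * W (cos_vec (grid_point s r)) / vec_stab r)"
      by (simp add: w grid_point_in_F_dom vec_stab_inj)
  qed
  then have "cubature_exact frakF \<omega> (phi ` grid_point s ` D_minus N) w (2 * (int N - int CARD('n) + 1) - 1)"
    unfolding cubature_exact_def
    using cubature_integral[OF \<omega> W(1) h G] finite_subset[OF D_minus_subset fin] by simp
  moreover have "card (phi ` grid_point s ` (D_minus N :: (int^'n::_) set)) = mpoly.dim (mpolys_le (int N - int CARD('n)) :: 'n mpoly set)"
    unfolding image_image card_image[OF inj] by (simp add: card_D_minus card_decreasing_le)
  ultimately show ?thesis by (simp add: optimal_gaussian_cubature_def)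
qed

end

text \<open>Every component of \<open>elem_map\<close> has degree one in each variable, so the total degree of \<open>f\<close> bounds
  the degree in each variable after the substitution.\<close>

lemma mpoly_eval_elem_map_in_prodsums:
  assumes "f \<in> mpolys_le (int d)"
  shows "(\<lambda>y. mpoly_eval f (elem_map y)) \<in> prodsums (deg_le d)"
  unfolding mpoly_eval_def
proof (intro prodsums_sum prodsums_scale)
  fix m assume m: "m \<in> Poly_Mapping.keys f"
  have "(\<lambda>y. \<Prod>i\<in>UNIV. elem_map y $ i ^ Poly_Mapping.lookup m i) \<in> prodsums (deg_le (\<Sum>i\<in>UNIV. Poly_Mapping.lookup m i * 1))"
    by (intro prodsums_deg_prod prodsums_deg_power elem_map_in_prodsums finite)
  then show "(\<lambda>y. \<Prod>i\<in>UNIV. elem_map y $ i ^ Poly_Mapping.lookup m i) \<in> prodsums (deg_le d)"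
  proof (rule prodsums_mono[rotated])
    have "int (\<Sum>i\<in>UNIV. Poly_Mapping.lookup m i) \<le> int d" using assms m by (auto simp: mpolys_le_def simp del: of_nat_sum)
    then have "(\<Sum>i\<in>UNIV. Poly_Mapping.lookup m i) \<le> d" by (simp only: of_nat_le_iff)
    then show "deg_le (\<Sum>i\<in>UNIV. Poly_Mapping.lookup m i * 1) \<subseteq> deg_le d"
      by (intro deg_le_mono) simp
  qed
qed

lemma mpolys_le_negative: "d < 0 \<Longrightarrow> mpolys_le d = {0}"
  unfolding mpolys_le_def by (force simp: sum_nonneg simp del: of_nat_sum)

text \<open>The squared alternant has degree \<open>2 * (n - 1)\<close> in each variable, which together with the degree
  \<open>2 * (N - n) + 1\<close> of \<open>f\<close> adds up to \<open>2 * N - 1\<close>. For \<open>N < n\<close> only \<open>f = 0\<close> occurs.\<close>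

lemma alternant_in_prodsums:
  fixes p :: "real poly"
  assumes "degree p = 1" "coeff p 1 > 0"
    and f: "f \<in> mpolys_le (2 * (int N - int CARD('n) + 1) - 1)"
  shows "(\<lambda>y::real^'n::{finite,wellorder}. mpoly_eval f (elem_map y) * (det (\<chi> i j. poly (cheb p (delta j)) (y $ i)))\<^sup>2)
    \<in> prodsums (deg_le (2 * N - 1))"
proof (cases "CARD('n) \<le> N")
  case True
  have "degree (cheb p (delta j)) \<le> CARD('n) - 1" for j :: 'n
    using cheb_degree[OF assms(1,2), of "delta j"] delta_less_CARD[of j] by linarith
  then have det: "(\<lambda>y::real^'n::_. (det (\<chi> i j. poly (cheb p (delta j)) (y $ i)))\<^sup>2) \<in> prodsums (deg_le (2 * (CARD('n) - 1)))"
    by (intro prodsums_deg_power det_in_prodsums)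
  have eq: "2 * (int N - int CARD('n) + 1) - 1 = int (2 * (N - CARD('n)) + 1)" using True by simp
  have f': "(\<lambda>y. mpoly_eval f (elem_map y)) \<in> prodsums (deg_le (2 * (N - CARD('n)) + 1))"
    using f unfolding eq by (rule mpoly_eval_elem_map_in_prodsums)
  have "2 * (N - CARD('n)) + 1 + 2 * (CARD('n) - 1) \<le> 2 * N - 1"
    using True zero_less_card_finite[where 'a='n] by linarith
  from prodsums_mono[OF deg_le_mono[OF this] prodsums_deg_mult[OF f' det]] show ?thesis .
next
  case False
  then have neg: "2 * (int N - int CARD('n) + 1) - 1 < 0" by simp
  have "f = 0" using f by (simp only: mpolys_le_negative[OF neg] singleton_iff)
  then show ?thesis by (simp add: prodsums.zero)
qed

lemma half_weight_prodsums:
  assumes "h \<in> prodsums (deg_le (2 * N - 1))" "N \<ge> 1"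
  shows "(\<lambda>y. h y * half_weight y) \<in> prodsums {q. degree q \<le> 2 * N \<and> poly q (- 1) = 0}"
  by (rule prodsums_mult[OF assms(1) half_weight_in_prodsums])
     (use assms(2) in \<open>auto simp: deg_le_def simp del: mult_pCons_right intro!: order_trans[OF degree_mult_le]\<close>)

section \<open>Zeros at the nodes\<close>

lemma cos_int_plus_half: "cos (pi * (of_int a + 1 / 2)) = 0"
proof -
  have "cos (pi * (of_int a + 1 / 2)) = - sin (of_int a * pi)"
    by (simp add: distrib_left cos_add mult.commute)
  then show ?thesis by (simp add: sin_times_pi_eq_0)
qed

text \<open>Each permutation assigns the component \<open>j\<close> of \<open>l\<close> to some coordinate, so each product has a zero factor.\<close>

lemma cos_plus_zero:
  assumes "\<And>i. cos (pi * l $ j * x $ i) = 0" shows "cos_plus l x = 0"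
  unfolding cos_plus_def
proof (intro sum.neutral ballI)
  fix \<sigma> :: "'a \<Rightarrow> 'a" assume "\<sigma> \<in> {\<sigma>. \<sigma> permutes UNIV}"
  then have "\<sigma> (inv \<sigma> j) = j" by (simp add: permutes_inverses)
  then show "(\<Prod>i\<in>UNIV. cos (pi * l $ \<sigma> i * x $ i)) = 0"
    using assms by (intro prod_zero bexI[of _ "inv \<sigma> j"]) simp_all
qed

lemma cos_minus_zero:
  assumes "\<And>i. cos (pi * l $ j * x $ i) = 0" shows "cos_minus l x = 0"
  unfolding cos_minus_def
proof (intro sum.neutral ballI)
  fix \<sigma> :: "'a \<Rightarrow> 'a" assume "\<sigma> \<in> {\<sigma>. \<sigma> permutes UNIV}"
  then have "\<sigma> (inv \<sigma> j) = j" by (simp add: permutes_inverses)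
  then have "(\<Prod>i\<in>UNIV. cos (pi * l $ \<sigma> i * x $ i)) = 0"
    using assms by (intro prod_zero bexI[of _ "inv \<sigma> j"]) simp_all
  then show "of_int (sign \<sigma>) * (\<Prod>i\<in>UNIV. cos (pi * l $ \<sigma> i * x $ i)) = 0" by simp
qed

lemma prod_half_cos_nonzero:
  assumes "\<And>i. 0 \<le> x $ i \<and> x $ i < 1" shows "(\<Prod>i\<in>UNIV. cos (pi * x $ i / 2)) \<noteq> 0"
proof -
  have "cos (pi * x $ i / 2) > 0" for i
    using assms[of i] by (intro cos_gt_zero_pi) (auto simp: field_simps intro: less_le_trans[of _ 0])
  then have "cos (pi * x $ i / 2) \<noteq> 0" for i by (metis less_irrefl)
  then show ?thesis by simp
qed

lemma interior_F_dom_bounds: "x \<in> interior F_dom \<Longrightarrow> 0 \<le> x $ i \<and> x $ i < 1"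
  by (simp add: interior_F_dom less_imp_le)

text \<open>The defining relations concern interior points. As polynomial identities, with the denominators
  multiplied out, they extend to all points and in particular to the nodes on the boundary of \<open>F_dom\<close>.\<close>

lemma P_I_plus_eval:
  assumes "k \<in> P_plus" shows "mpoly_eval (P_I_plus k) (phi x) = cos_plus (real_vec k) x"
proof -
  have "mpoly_eval (P_I_plus k) (elem_map (cos_vec x))
    = (\<Sum>\<sigma> | \<sigma> permutes UNIV. \<Prod>i\<in>UNIV. poly (cheb1 (nat (k $ \<sigma> i))) (cos_vec x $ i))"
    unfolding P_I_plus_def
    by (rule the_mpoly_eval[OF permanent_in_sym_polys[of "\<lambda>j. cheb1 (nat (k $ j))"] order_refl])
       (rule cos_plus_shift0[OF assms])
  then show ?thesis by (simp add: phi_eq cos_plus_shift0[OF assms])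
qed

lemma P_III_plus_eval:
  assumes "k \<in> P_plus"
  shows "mpoly_eval (P_III_plus k) (phi x) * cos_plus rho x = cos_plus (real_vec k + rho) x"
proof -
  define g where "g y = (\<Sum>\<sigma> | \<sigma> permutes UNIV. \<Prod>i\<in>UNIV. poly (cheb3 (nat (k $ \<sigma> i))) (y $ i)) * inverse (fact CARD('a))"
    for y
  have "g \<in> sym_polys" unfolding g_def[abs_def]
    by (intro sym_polys_mult sym_polys_const permanent_in_sym_polys[of "\<lambda>j. cheb3 (nat (k $ j))"])
  then have "mpoly_eval (P_III_plus k) (elem_map (cos_vec x)) = g (cos_vec x)"
    unfolding P_III_plus_def
  proof (rule the_mpoly_eval[OF _ order_refl])
    fix x :: "real^'a::_" assume "x \<in> interior F_dom"
    then have "(\<Prod>i\<in>UNIV. cos (pi * x $ i / 2)) \<noteq> 0" by (intro prod_half_cos_nonzero interior_F_dom_bounds)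
    then show "cos_plus (real_vec k + rho) x / cos_plus rho x = g (cos_vec x)"
      by (simp only: cos_plus_shift[OF assms] cos_plus_rho g_def) (simp add: field_simps)
  qed
  then show ?thesis by (simp add: phi_eq cos_plus_shift[OF assms] cos_plus_rho g_def)
qed

lemma P_I_minus_eval:
  assumes "k \<in> P_plus"
  shows "mpoly_eval (P_I_minus k) (phi x) * cos_minus rho1 x = cos_minus (real_vec k + rho1) x"
proof -
  have b: "graded_basis (\<lambda>j. cheb1 (delta j))" by (rule graded_basis_cheb) auto
  obtain g where g: "g \<in> sym_polys" "\<And>y. det (\<chi> i j. poly (cheb1 (nat (k $ j) + delta j)) (y $ i))
      = g y * det (\<chi> i j. poly (cheb1 (delta j)) (y $ i))"
    by (rule alternant_factorization[OF b, of "\<lambda>j. cheb1 (nat (k $ j) + delta j)"]) blast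
  have "mpoly_eval (P_I_minus k) (elem_map (cos_vec x)) = g (cos_vec x)"
    unfolding P_I_minus_def
  proof (rule the_mpoly_eval[OF g(1) order_refl])
    fix x :: "real^'a::_" assume "x \<in> interior F_dom"
    then have "det (\<chi> i j. poly (cheb1 (delta j)) (cos_vec x $ i)) \<noteq> 0"
      by (intro inj_alternants_nonzero(2)[OF inj_cos_vec_interior b])
    then show "cos_minus (real_vec k + rho1) x / cos_minus rho1 x = g (cos_vec x)"
      by (simp add: cos_minus_shift1[OF assms] cos_minus_rho1 g(2))
  qed
  then show ?thesis by (simp add: phi_eq cos_minus_shift1[OF assms] cos_minus_rho1 g(2))
qed

lemma P_III_minus_eval:
  assumes "k \<in> P_plus"
  shows "mpoly_eval (P_III_minus k) (phi x) * cos_minus rho2 x = cos_minus (real_vec k + rho2) x"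
proof -
  have b: "graded_basis (\<lambda>j. cheb3 (delta j))" by (rule graded_basis_cheb) auto
  obtain g where g: "g \<in> sym_polys" "\<And>y. det (\<chi> i j. poly (cheb3 (nat (k $ j) + delta j)) (y $ i))
      = g y * det (\<chi> i j. poly (cheb3 (delta j)) (y $ i))"
    by (rule alternant_factorization[OF b, of "\<lambda>j. cheb3 (nat (k $ j) + delta j)"]) blast
  have "mpoly_eval (P_III_minus k) (elem_map (cos_vec x)) = g (cos_vec x)"
    unfolding P_III_minus_def
  proof (rule the_mpoly_eval[OF g(1) order_refl])
    fix x :: "real^'a::_" assume x: "x \<in> interior F_dom"
    then have "det (\<chi> i j. poly (cheb3 (delta j)) (cos_vec x $ i)) \<noteq> 0"
      by (intro inj_alternants_nonzero(2)[OF inj_cos_vec_interior b])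
    moreover have "(\<Prod>i\<in>UNIV. cos (pi * x $ i / 2)) \<noteq> 0"
      using x by (intro prod_half_cos_nonzero interior_F_dom_bounds)
    ultimately show "cos_minus (real_vec k + rho2) x / cos_minus rho2 x = g (cos_vec x)"
      by (simp only: cos_minus_shift2[OF assms] cos_minus_rho2 g(2)) (simp add: field_simps)
  qed
  then show ?thesis by (simp add: phi_eq cos_minus_shift2[OF assms] cos_minus_rho2 g(2))
qed

lemma node_II_eq_grid_point:
  "r \<in> int_grid N \<Longrightarrow> node_II N r = grid_point (\<lambda>r. (real r + 1/2) / real N) r"
  by (auto simp: node_II_def grid_point_def int_grid_def)

lemma node_VIII_eq_grid_point:
  "r \<in> int_grid N \<Longrightarrow> node_VIII N r = grid_point (\<lambda>r. 2 * (real r + 1/2) / (2 * real N + 1)) r"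
  by (auto simp: node_VIII_def grid_point_def int_grid_def)

lemma node_images_eq:
  assumes "A \<subseteq> int_grid N"
  shows "node_II N ` A = grid_point (\<lambda>r. (real r + 1/2) / real N) ` A"
    and "node_VIII N ` A = grid_point (\<lambda>r. 2 * (real r + 1/2) / (2 * real N + 1)) ` A"
  by (intro image_cong refl node_II_eq_grid_point node_VIII_eq_grid_point; use assms in blast)+

lemma node_sequence_II: "N \<ge> 1 \<Longrightarrow> node_sequence N (\<lambda>r. (real r + 1/2) / real N)"
  by (auto simp: node_sequence_def strict_mono_def divide_strict_right_mono field_simps)

lemma node_sequence_VIII: "node_sequence N (\<lambda>r. 2 * (real r + 1/2) / (2 * real N + 1))"
proof -
  have "2 * (real r + 1/2) / (2 * real N + 1) < 1" if "r < N" for r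
    using that by (simp add: field_simps)
  then show ?thesis
    by (auto simp: node_sequence_def strict_mono_def divide_strict_right_mono)
qed

lemma D_subset_int_grid: "D_plus N \<subseteq> int_grid N" "D_minus N \<subseteq> int_grid N"
  using D_minus_subset by (auto simp: D_plus_eq)

lemma inj_cos_vec_grid:
  assumes "node_sequence N s" "r \<in> D_minus N"
  shows "inj (($) (cos_vec (grid_point s r)))"
proof (rule inj_cos_vec)
  have r: "r \<in> D_plus N" "inj (($) r)" using assms(2) D_minus_subset D_plus_inj_iff by blast+
  show "grid_point s r \<in> F_dom" by (rule grid_point_in_F_dom[OF assms(1) r(1)])
  show "inj (($) (grid_point s r))"
    using r by (auto simp: inj_def grid_point_def node_sequence_eq_iff[OF assms(1)] D_plus_def nat_eq_iff2)
qed

lemma grid_point_bounds: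
  assumes "node_sequence N s" "r \<in> int_grid N"
  shows "0 \<le> grid_point s r $ i \<and> grid_point s r $ i < 1"
proof -
  have "nat (r $ i) < N" using assms(2) by (auto simp: int_grid_def nat_less_iff)
  then show ?thesis using assms(1) by (simp add: node_sequence_def grid_point_def)
qed

lemma delta_Min: "delta (Min UNIV :: 'n::{finite,wellorder}) = CARD('n) - 1"
proof -
  have "{i. Min UNIV < i} = UNIV - {Min UNIV :: 'n}" by (auto simp: less_le)
  then show ?thesis by (simp add: delta_def)
qed

context
  fixes N :: nat and k :: "int^'n::{finite,wellorder}" and r :: "int^'n::_"
  assumes N: "N \<ge> 1" and k: "k \<in> P_plus"
begin

lemma P_I_plus_zero:
  assumes "vec_first k = int N"
  shows "mpoly_eval (P_I_plus k) (phi (node_II N r)) = 0"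
  unfolding P_I_plus_eval[OF k]
proof (rule cos_plus_zero)
  fix i
  have "pi * real_vec k $ Min UNIV * node_II N r $ i = pi * (of_int (r $ i) + 1/2)"
    using assms N by (simp add: real_vec_def vec_first_def node_II_def)
  then show "cos (pi * real_vec k $ Min UNIV * node_II N r $ i) = 0" by (simp only: cos_int_plus_half)
qed

lemma P_III_plus_zero:
  assumes "vec_first k = int N" "r \<in> D_plus N"
  shows "mpoly_eval (P_III_plus k) (phi (node_VIII N r)) = 0"
proof -
  have "cos_plus (real_vec k + rho) (node_VIII N r) = 0"
  proof (rule cos_plus_zero)
    fix i
    have "pi * (real_vec k + rho) $ Min UNIV * node_VIII N r $ i = pi * (of_int (r $ i) + 1/2)"
      using assms N by (simp add: real_vec_def vec_first_def node_VIII_def rho_def field_simps)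
    then show "cos (pi * (real_vec k + rho) $ Min UNIV * node_VIII N r $ i) = 0" by (simp only: cos_int_plus_half)
  qed
  moreover have "cos_plus rho (node_VIII N r) \<noteq> 0"
  proof -
    have "r \<in> int_grid N" using assms(2) D_subset_int_grid by blast
    then have "0 \<le> node_VIII N r $ i \<and> node_VIII N r $ i < 1" for i
      using grid_point_bounds[OF node_sequence_VIII] by (simp add: node_VIII_eq_grid_point)
    then show ?thesis unfolding cos_plus_rho using prod_half_cos_nonzero[of "node_VIII N r"] by simp
  qed
  ultimately show ?thesis using P_III_plus_eval[OF k, of "node_VIII N r"] by simp
qed

lemma P_I_minus_zero:
  assumes "vec_first k = int N - int CARD('n) + 1" "r \<in> D_minus N"
  shows "mpoly_eval (P_I_minus k) (phi (node_II N r)) = 0"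
proof -
  have "cos_minus (real_vec k + rho1) (node_II N r) = 0"
  proof (rule cos_minus_zero)
    fix i
    have "(real_vec k + rho1) $ Min UNIV = real N"
      using assms(1) delta_Min[where 'n='n] by (simp add: real_vec_def vec_first_def rho1_def delta_def)
    then have "pi * (real_vec k + rho1) $ Min UNIV * node_II N r $ i = pi * (of_int (r $ i) + 1/2)"
      using N by (simp add: node_II_def)
    then show "cos (pi * (real_vec k + rho1) $ Min UNIV * node_II N r $ i) = 0" by (simp only: cos_int_plus_half)
  qed
  moreover have "cos_minus rho1 (node_II N r) \<noteq> 0"
  proof -
    have "r \<in> int_grid N" using assms(2) D_subset_int_grid by blast
    note eq = node_II_eq_grid_point[OF this]
    show ?thesis
      unfolding eq
      using inj_alternants_nonzero(2)[OF inj_cos_vec_grid[OF node_sequence_II[OF N] assms(2)] graded_basis_cheb[of "[:0, 1:]"]]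
      by (simp add: cos_minus_rho1)
  qed
  ultimately show ?thesis using P_I_minus_eval[OF k, of "node_II N r"] by simp
qed

lemma P_III_minus_zero:
  assumes "vec_first k = int N - int CARD('n) + 1" "r \<in> D_minus N"
  shows "mpoly_eval (P_III_minus k) (phi (node_VIII N r)) = 0"
proof -
  have "cos_minus (real_vec k + rho2) (node_VIII N r) = 0"
  proof (rule cos_minus_zero)
    fix i
    have first: "(real_vec k + rho2) $ Min UNIV = real N + 1/2"
      using assms(1) delta_Min[where 'n='n] by (simp add: real_vec_def vec_first_def rho2_def delta_def)
    have "pi * (real_vec k + rho2) $ Min UNIV * node_VIII N r $ i = pi * (of_int (r $ i) + 1/2)"
      by (simp only: first) (simp add: node_VIII_def field_simps)
    then show "cos (pi * (real_vec k + rho2) $ Min UNIV * node_VIII N r $ i) = 0" by (simp only: cos_int_plus_half)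
  qed
  moreover have "cos_minus rho2 (node_VIII N r) \<noteq> 0"
  proof -
    have r: "r \<in> int_grid N" using assms(2) D_subset_int_grid by blast
    note eq = node_VIII_eq_grid_point[OF r]
    from r have "(\<Prod>i\<in>UNIV. cos (pi * node_VIII N r $ i / 2)) \<noteq> 0"
      unfolding eq by (intro prod_half_cos_nonzero grid_point_bounds[OF node_sequence_VIII])
    moreover have "det (\<chi> i j. poly (cheb3 (delta j)) (cos_vec (node_VIII N r) $ i)) \<noteq> 0"
      unfolding eq
      by (rule inj_alternants_nonzero(2)[OF inj_cos_vec_grid[OF node_sequence_VIII assms(2)] graded_basis_cheb]) auto
    ultimately show ?thesis by (simp only: cos_minus_rho2) simp
  qed
  ultimately show ?thesis using P_III_minus_eval[OF k, of "node_VIII N r"] by simp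
qed

end

lemma alternant_not_inj:
  assumes "\<not> inj (($) y)" shows "det (\<chi> i j. poly (b j) (y $ i)) = 0"
proof -
  obtain i i' where "i \<noteq> i'" "y $ i = y $ i'" using assms by (auto simp: inj_def)
  then show ?thesis by (intro det_identical_rows[of i i']) (auto simp: row_def)
qed

theorem theorem5p3:
  fixes N :: nat
  assumes "N \<ge> 1"
  shows
    "optimal_gaussian_cubature (frakF :: (real^'n::{finite,wellorder}) set) omega_I_plus (frakF_II_plus N)
       (\<lambda>Y. (1 / real N) ^ CARD('n) * inverse (real (calH Y)))
       (int N) \<and>
     optimal_gaussian_cubature (frakF :: (real^'n::_) set) omega_III_plus (frakF_VIII_plus N)
       (\<lambda>Y. (2 / (2 * real N + 1)) ^ CARD('n) * (inverse (real (calH Y)) * mpoly_eval J_III_plus Y))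
       (int N) \<and>
     optimal_gaussian_cubature (frakF :: (real^'n::_) set) omega_I_minus (frakF_II_minus N)
       (\<lambda>Y. (1 / real N) ^ CARD('n) * mpoly_eval J_I_minus Y)
       (int N - int CARD('n) + 1) \<and>
     optimal_gaussian_cubature (frakF :: (real^'n::_) set) omega_III_minus (frakF_VIII_minus N)
       (\<lambda>Y. (2 / (2 * real N + 1)) ^ CARD('n) * mpoly_eval J_III_minus Y)
       (int N - int CARD('n) + 1) \<and>
     (\<forall>k\<in>(P_plus :: (int^'n::_) set). vec_first k = int N \<longrightarrow>
       (\<forall>Y\<in>frakF_II_plus N. mpoly_eval (P_I_plus k) Y = 0)) \<and>
     (\<forall>k\<in>(P_plus :: (int^'n::_) set). vec_first k = int N \<longrightarrow>
       (\<forall>Y\<in>frakF_VIII_plus N. mpoly_eval (P_III_plus k) Y = 0)) \<and>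
     (\<forall>k\<in>(P_plus :: (int^'n::_) set). vec_first k = int N - int CARD('n) + 1 \<longrightarrow>
       (\<forall>Y\<in>frakF_II_minus N. mpoly_eval (P_I_minus k) Y = 0)) \<and>
     (\<forall>k\<in>(P_plus :: (int^'n::_) set). vec_first k = int N - int CARD('n) + 1 \<longrightarrow>
       (\<forall>Y\<in>frakF_VIII_minus N. mpoly_eval (P_III_minus k) Y = 0))"
proof (intro conjI)
  have exact: "2 * int N - 1 = int (2 * N - 1)" using assms by simp
  have f: "(\<lambda>y. mpoly_eval f (elem_map y)) \<in> prodsums (deg_le (2 * N - 1))"
    if "f \<in> mpolys_le (2 * int N - 1)" for f :: "'n mpoly"
    using that unfolding exact by (rule mpoly_eval_elem_map_in_prodsums)
  let ?D1 = "\<lambda>y::real^'n::_. (det (\<chi> i j. poly (cheb1 (delta j)) (y $ i)))\<^sup>2"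
  let ?D3 = "\<lambda>y::real^'n::_. (det (\<chi> i j. poly (cheb3 (delta j)) (y $ i)))\<^sup>2"
  show "optimal_gaussian_cubature (frakF :: (real^'n::_) set) omega_I_plus (frakF_II_plus N)
       (\<lambda>Y. (1 / real N) ^ CARD('n) * inverse (real (calH Y))) (int N)"
    unfolding frakF_II_plus_def node_images_eq[OF D_subset_int_grid(1)]
  proof (rule cubature_plus[OF node_sequence_II[OF assms] _ _ _ quadrature_midpoints[OF assms], where W = "\<lambda>_. 1"])
    fix g :: "'n mpoly" assume "g \<in> mpolys_le (2 * int N - 1)"
    then show "(\<lambda>y. mpoly_eval g (elem_map y) * 1) \<in> prodsums (deg_le (2 * N - 1))"
      unfolding mult_1_right by (rule f)
  qed (simp_all add: omega_I_plus_def sym_polys_const)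
  show "optimal_gaussian_cubature (frakF :: (real^'n::_) set) omega_III_plus (frakF_VIII_plus N)
       (\<lambda>Y. (2 / (2 * real N + 1)) ^ CARD('n) * (inverse (real (calH Y)) * mpoly_eval J_III_plus Y)) (int N)"
    unfolding frakF_VIII_plus_def node_images_eq[OF D_subset_int_grid(1)]
  proof (rule cubature_plus[OF node_sequence_VIII _ _ _ quadrature_third_kind,
        where W = "\<lambda>y. half_weight y * (fact CARD('n))\<^sup>2"])
    show "(\<lambda>y::real^'n::_. half_weight y * (fact CARD('n))\<^sup>2) \<in> sym_polys"
      by (intro sym_polys_mult half_weight_sym sym_polys_const)
    fix g :: "'n mpoly" assume "g \<in> mpolys_le (2 * int N - 1)"
    from half_weight_prodsums[OF prodsums_scale[OF f[OF this], of "(fact CARD('n))\<^sup>2"] assms]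
    show "(\<lambda>y. mpoly_eval g (elem_map y) * (half_weight y * (fact CARD('n))\<^sup>2))
        \<in> prodsums {q. degree q \<le> 2 * N \<and> poly q (- 1) = 0}"
      by (simp add: mult_ac)
  qed (simp_all add: omega_III_plus_def phi_eq J_III_plus_eval)
  show "optimal_gaussian_cubature (frakF :: (real^'n::_) set) omega_I_minus (frakF_II_minus N)
       (\<lambda>Y. (1 / real N) ^ CARD('n) * mpoly_eval J_I_minus Y) (int N - int CARD('n) + 1)"
    unfolding frakF_II_minus_def node_images_eq[OF D_subset_int_grid(2)]
  proof (rule cubature_minus[OF node_sequence_II[OF assms] _ _ _ _ quadrature_midpoints[OF assms], where W = ?D1])
    show "?D1 \<in> sym_polys" by (rule alternant_squared_sym)
    fix g :: "'n mpoly" assume "g \<in> mpolys_le (2 * (int N - int CARD('n) + 1) - 1)"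
    then show "(\<lambda>y. mpoly_eval g (elem_map y) * ?D1 y) \<in> prodsums (deg_le (2 * N - 1))"
      by (rule alternant_in_prodsums[rotated 2]) auto
  qed (simp_all add: omega_I_minus_def phi_eq J_I_minus_eval alternant_not_inj)
  show "optimal_gaussian_cubature (frakF :: (real^'n::_) set) omega_III_minus (frakF_VIII_minus N)
       (\<lambda>Y. (2 / (2 * real N + 1)) ^ CARD('n) * mpoly_eval J_III_minus Y) (int N - int CARD('n) + 1)"
    unfolding frakF_VIII_minus_def node_images_eq[OF D_subset_int_grid(2)]
  proof (rule cubature_minus[OF node_sequence_VIII _ _ _ _ quadrature_third_kind,
        where W = "\<lambda>y. half_weight y * ?D3 y"])
    show "(\<lambda>y. half_weight y * ?D3 y) \<in> sym_polys"
      by (intro sym_polys_mult half_weight_sym alternant_squared_sym)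
    fix g :: "'n mpoly" assume "g \<in> mpolys_le (2 * (int N - int CARD('n) + 1) - 1)"
    then have "(\<lambda>y. mpoly_eval g (elem_map y) * ?D3 y) \<in> prodsums (deg_le (2 * N - 1))"
      by (rule alternant_in_prodsums[rotated 2]) auto
    from half_weight_prodsums[OF this assms]
    show "(\<lambda>y. mpoly_eval g (elem_map y) * (half_weight y * ?D3 y))
        \<in> prodsums {q. degree q \<le> 2 * N \<and> poly q (- 1) = 0}"
      by (simp add: mult_ac)
  qed (simp_all add: omega_III_minus_def phi_eq J_III_minus_eval alternant_not_inj)
qed (use assms in \<open>auto simp: frakF_II_plus_def frakF_VIII_plus_def frakF_II_minus_def frakF_VIII_minus_def
      P_I_plus_zero P_III_plus_zero P_I_minus_zero P_III_minus_zero\<close>)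

end
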